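(* Let $\iota : R \to \Sigma\otimes_A\Sigma'$, $\iota(r)=e_r\otimes_A\varphi_r$, be a homomorphism of rings, where $R$ is a firm ring, $A$ and $B$ are rings with unity, ${}_B\Sigma_A$ and ${}_A\Sigma'_B$ are bimodules, $\mu:\Sigma'\otimes_B\Sigma\to A$ is a homomorphism of $A$-bimodules, and $\Sigma\otimes_A\Sigma'$ carries the ring structure induced by $\mu$. If $\Sigma$ is firm as a left $R$-module, then $\Sigma'\otimes_R\Sigma$ is an $A$-coring with comultiplication $$\Delta=(\Sigma'\otimes_R\iota\otimes_R\Sigma)\circ(\Sigma'\otimes_R d_\Sigma):\Sigma'\otimes_R\Sigma\to\Sigma'\otimes_R R\otimes_R\Sigma\to\Sigma'\otimes_R\Sigma\otimes_A\Sigma'\otimes_R\Sigma$$ and counit $\mu:\Sigma'\otimes_R\Sigma\to A$. Moreover, $\Sigma$ is an $R$-$(\Sigma'\otimes_R\Sigma)$-bicomodule and $\Sigma^{\dag}=\Sigma'\otimes_R R$ is a $(\Sigma'\otimes_R\Sigma)$-$R$-bicomodule with the coactions $$\rho_\Sigma=(\iota\otimes_R\Sigma)\circ d_\Sigma:\Sigma\to R\otimes_R\Sigma\to\Sigma\otimes_A\Sigma'\otimes_R\Sigma,$$ $$\lambda_{\Sigma^\dag}=(\Sigma'\otimes_R\iota\otimes_R R)\circ(\Sigma'\otimes_R d_R):\Sigma'\otimes_R R\to\Sigma'\otimes_R R\otimes_R R\to\Sigma'\otimes_R\Sigma\otimes_A\Sigma'\otimes_R R.$$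
   Context: Rings are associative (over a fixed commutative unital ring $K$) and need not have a unity; modules over unital rings are unital. A left $R$-module $M$ is firm if the multiplication map $\varpi_M:R\otimes_R M\to M$, $r\otimes m\mapsto rm$, is bijective; its inverse is denoted $d_M:M\to R\otimes_R M$. Similarly for right modules. A ring $R$ is firm if $\varpi_R:R\otimes_R R\to R$ is bijective, with inverse $d_R$. The identity morphism of an object $X$ is written $X$. Given $\mu$, the product on $\Sigma\otimes_A\Sigma'$ is $(x\otimes_A\phi)(y\otimes_A\psi)=x\mu(\phi\otimes_B y)\otimes_A\psi$. For $r\in R$ write $\iota(r)=e_r\otimes_A\varphi_r$ (sum understood). Then $\Sigma$ is an $R$-$A$-bimodule by $ru=e_r\mu(\varphi_r\otimes_B u)$ and $\Sigma'$ is an $A$-$R$-bimodule by $\phi r=\mu(\phi\otimes_B e_r)\varphi_r$; $\mu$ factors through an $A$-bimodule map $\mu:\Sigma'\otimes_R\Sigma\to A$, and $\iota$ is $R$-bilinear. An $A$-coring is an $A$-bimodule with a coassociative $A$-bilinear comultiplication and an $A$-bilinear counit. For an $A$-coring $\mathfrak C$, an $R$-$\mathfrak C$-bicomodule is an $R$-$A$-bimodule that is a right $\mathfrak C$-comodule with left $R$-linear coaction; a $\mathfrak C$-$R$-bicomodule is an $A$-$R$-bimodule that is a left $\mathfrak C$-comodule with right $R$-linear coaction. *)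

theory Defs
  imports "HOL-Algebra.Algebra"
begin

text \<open>
  Everything is linear over a commutative unital ring \<open>K\<close>.  A ring is a \<open>K\<close>-algebra, represented by
  the library record \<open>('k, 'r) module\<close> (a ring record together with the scalar multiplication by \<open>K\<close>).
  For a ring without unity the field \<open>one\<close> carries no information.
\<close>

locale k_algebra = module K R for K (structure) and R (structure) +
  assumes mult_closed: "\<lbrakk>x \<in> carrier R; y \<in> carrier R\<rbrakk> \<Longrightarrow> x \<otimes>\<^bsub>R\<^esub> y \<in> carrier R"
    and mult_assoc: "\<lbrakk>x \<in> carrier R; y \<in> carrier R; z \<in> carrier R\<rbrakk> \<Longrightarrow>
      (x \<otimes>\<^bsub>R\<^esub> y) \<otimes>\<^bsub>R\<^esub> z = x \<otimes>\<^bsub>R\<^esub> (y \<otimes>\<^bsub>R\<^esub> z)"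
    and mult_l_distr: "\<lbrakk>x \<in> carrier R; y \<in> carrier R; z \<in> carrier R\<rbrakk> \<Longrightarrow>
      (x \<oplus>\<^bsub>R\<^esub> y) \<otimes>\<^bsub>R\<^esub> z = x \<otimes>\<^bsub>R\<^esub> z \<oplus>\<^bsub>R\<^esub> y \<otimes>\<^bsub>R\<^esub> z"
    and mult_r_distr: "\<lbrakk>x \<in> carrier R; y \<in> carrier R; z \<in> carrier R\<rbrakk> \<Longrightarrow>
      x \<otimes>\<^bsub>R\<^esub> (y \<oplus>\<^bsub>R\<^esub> z) = x \<otimes>\<^bsub>R\<^esub> y \<oplus>\<^bsub>R\<^esub> x \<otimes>\<^bsub>R\<^esub> z"
    and mult_smult_l: "\<lbrakk>k \<in> carrier K; x \<in> carrier R; y \<in> carrier R\<rbrakk> \<Longrightarrow>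
      (k \<odot>\<^bsub>R\<^esub> x) \<otimes>\<^bsub>R\<^esub> y = k \<odot>\<^bsub>R\<^esub> (x \<otimes>\<^bsub>R\<^esub> y)"
    and mult_smult_r: "\<lbrakk>k \<in> carrier K; x \<in> carrier R; y \<in> carrier R\<rbrakk> \<Longrightarrow>
      x \<otimes>\<^bsub>R\<^esub> (k \<odot>\<^bsub>R\<^esub> y) = k \<odot>\<^bsub>R\<^esub> (x \<otimes>\<^bsub>R\<^esub> y)"

locale unital_k_algebra = k_algebra K A + A: ring A for K (structure) and A (structure)

definition k_algebra_hom :: "'k ring \<Rightarrow> ('k, 'r) module \<Rightarrow> ('k, 'q) module \<Rightarrow> ('r \<Rightarrow> 'q) \<Rightarrow> bool"
  where "k_algebra_hom K R Q f \<longleftrightarrow>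
    f \<in> carrier R \<rightarrow> carrier Q \<and>
    (\<forall>x\<in>carrier R. \<forall>y\<in>carrier R. f (x \<oplus>\<^bsub>R\<^esub> y) = f x \<oplus>\<^bsub>Q\<^esub> f y) \<and>
    (\<forall>k\<in>carrier K. \<forall>x\<in>carrier R. f (k \<odot>\<^bsub>R\<^esub> x) = k \<odot>\<^bsub>Q\<^esub> f x) \<and>
    (\<forall>x\<in>carrier R. \<forall>y\<in>carrier R. f (x \<otimes>\<^bsub>R\<^esub> y) = f x \<otimes>\<^bsub>Q\<^esub> f y)"


section \<open>Modules and bimodules\<close>

text \<open>
  As for library modules, the fields \<open>mult\<close> and \<open>one\<close> of a bimodule record carry no information.
  One-sided notions simply ignore the action on the other side.
\<close>

record ('k, 'r, 'm, 's) bimodule = "('k, 'm) module" +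
  lact :: "'r \<Rightarrow> 'm \<Rightarrow> 'm"
  ract :: "'m \<Rightarrow> 's \<Rightarrow> 'm"

definition with_actions ::
  "('k, 'm, 'x) module_scheme \<Rightarrow> ('r \<Rightarrow> 'm \<Rightarrow> 'm) \<Rightarrow> ('m \<Rightarrow> 's \<Rightarrow> 'm) \<Rightarrow> ('k, 'r, 'm, 's) bimodule"
  where "with_actions M l r =
    \<lparr>carrier = carrier M, monoid.mult = monoid.mult M, one = one M,
     ring.zero = ring.zero M, ring.add = ring.add M, smult = smult M, lact = l, ract = r\<rparr>"

definition regular :: "('k, 'r) module \<Rightarrow> ('k, 'r, 'r, 'r) bimodule"
  where "regular R = with_actions R (monoid.mult R) (monoid.mult R)"

locale left_module = R: k_algebra K R + M: module K M
  for K :: "'k ring" and R :: "('k, 'r) module" and M :: "('k, 'r, 'm, 's) bimodule" +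
  assumes lact_closed: "\<lbrakk>r \<in> carrier R; m \<in> carrier M\<rbrakk> \<Longrightarrow> lact M r m \<in> carrier M"
    and lact_add_l: "\<lbrakk>r \<in> carrier R; r' \<in> carrier R; m \<in> carrier M\<rbrakk> \<Longrightarrow>
      lact M (r \<oplus>\<^bsub>R\<^esub> r') m = lact M r m \<oplus>\<^bsub>M\<^esub> lact M r' m"
    and lact_add_r: "\<lbrakk>r \<in> carrier R; m \<in> carrier M; m' \<in> carrier M\<rbrakk> \<Longrightarrow>
      lact M r (m \<oplus>\<^bsub>M\<^esub> m') = lact M r m \<oplus>\<^bsub>M\<^esub> lact M r m'"
    and lact_smult_l: "\<lbrakk>k \<in> carrier K; r \<in> carrier R; m \<in> carrier M\<rbrakk> \<Longrightarrow>
      lact M (k \<odot>\<^bsub>R\<^esub> r) m = k \<odot>\<^bsub>M\<^esub> lact M r m"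
    and lact_smult_r: "\<lbrakk>k \<in> carrier K; r \<in> carrier R; m \<in> carrier M\<rbrakk> \<Longrightarrow>
      lact M r (k \<odot>\<^bsub>M\<^esub> m) = k \<odot>\<^bsub>M\<^esub> lact M r m"
    and lact_assoc: "\<lbrakk>r \<in> carrier R; r' \<in> carrier R; m \<in> carrier M\<rbrakk> \<Longrightarrow>
      lact M (r \<otimes>\<^bsub>R\<^esub> r') m = lact M r (lact M r' m)"

locale right_module = S: k_algebra K S + M: module K M
  for K :: "'k ring" and S :: "('k, 's) module" and M :: "('k, 'r, 'm, 's) bimodule" +
  assumes ract_closed: "\<lbrakk>m \<in> carrier M; s \<in> carrier S\<rbrakk> \<Longrightarrow> ract M m s \<in> carrier M"
    and ract_add_l: "\<lbrakk>m \<in> carrier M; m' \<in> carrier M; s \<in> carrier S\<rbrakk> \<Longrightarrow>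
      ract M (m \<oplus>\<^bsub>M\<^esub> m') s = ract M m s \<oplus>\<^bsub>M\<^esub> ract M m' s"
    and ract_add_r: "\<lbrakk>m \<in> carrier M; s \<in> carrier S; s' \<in> carrier S\<rbrakk> \<Longrightarrow>
      ract M m (s \<oplus>\<^bsub>S\<^esub> s') = ract M m s \<oplus>\<^bsub>M\<^esub> ract M m s'"
    and ract_smult_l: "\<lbrakk>k \<in> carrier K; m \<in> carrier M; s \<in> carrier S\<rbrakk> \<Longrightarrow>
      ract M (k \<odot>\<^bsub>M\<^esub> m) s = k \<odot>\<^bsub>M\<^esub> ract M m s"
    and ract_smult_r: "\<lbrakk>k \<in> carrier K; m \<in> carrier M; s \<in> carrier S\<rbrakk> \<Longrightarrow>
      ract M m (k \<odot>\<^bsub>S\<^esub> s) = k \<odot>\<^bsub>M\<^esub> ract M m s"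
    and ract_assoc: "\<lbrakk>m \<in> carrier M; s \<in> carrier S; s' \<in> carrier S\<rbrakk> \<Longrightarrow>
      ract M m (s \<otimes>\<^bsub>S\<^esub> s') = ract M (ract M m s) s'"

locale bimodule = left_module K R M + right_module K S M
  for K :: "'k ring" and R :: "('k, 'r) module" and S :: "('k, 's) module"
    and M :: "('k, 'r, 'm, 's) bimodule" +
  assumes lact_ract: "\<lbrakk>r \<in> carrier R; m \<in> carrier M; s \<in> carrier S\<rbrakk> \<Longrightarrow>
      ract M (lact M r m) s = lact M r (ract M m s)"

definition left_unital :: "('k, 'r) module \<Rightarrow> ('k, 'r, 'm, 's) bimodule \<Rightarrow> bool"
  where "left_unital R M \<longleftrightarrow> (\<forall>m\<in>carrier M. lact M \<one>\<^bsub>R\<^esub> m = m)"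

definition right_unital :: "('k, 's) module \<Rightarrow> ('k, 'r, 'm, 's) bimodule \<Rightarrow> bool"
  where "right_unital S M \<longleftrightarrow> (\<forall>m\<in>carrier M. ract M m \<one>\<^bsub>S\<^esub> = m)"

definition bimodule_hom ::
  "'k ring \<Rightarrow> ('k, 'r) module \<Rightarrow> ('k, 's) module \<Rightarrow> ('k, 'r, 'm, 's) bimodule \<Rightarrow>
   ('k, 'r, 'n, 's) bimodule \<Rightarrow> ('m \<Rightarrow> 'n) \<Rightarrow> bool"
  where "bimodule_hom K R S M N f \<longleftrightarrow>
    f \<in> carrier M \<rightarrow> carrier N \<and>
    (\<forall>x\<in>carrier M. \<forall>y\<in>carrier M. f (x \<oplus>\<^bsub>M\<^esub> y) = f x \<oplus>\<^bsub>N\<^esub> f y) \<and>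
    (\<forall>k\<in>carrier K. \<forall>x\<in>carrier M. f (k \<odot>\<^bsub>M\<^esub> x) = k \<odot>\<^bsub>N\<^esub> f x) \<and>
    (\<forall>r\<in>carrier R. \<forall>x\<in>carrier M. f (lact M r x) = lact N r (f x)) \<and>
    (\<forall>s\<in>carrier S. \<forall>x\<in>carrier M. f (ract M x s) = ract N (f x) s)"


section \<open>Tensor products\<close>

text \<open>
  The tensor product of \<open>M\<close> and \<open>N\<close> over \<open>S\<close> is the free abelian group on the pairs modulo the
  subgroup generated by the biadditivity, \<open>S\<close>-balance and \<open>K\<close>-balance relations.  The \<open>K\<close>-balance has to
  be imposed because \<open>S\<close> need not have a unity.
\<close>

type_synonym ('m, 'n) tensor = "(('m \<times> 'n) \<Rightarrow>\<^sub>0 int) set"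

definition tensor_relations ::
  "'k ring \<Rightarrow> ('k, 's) module \<Rightarrow> ('k, 'r, 'm, 's) bimodule \<Rightarrow> ('k, 's, 'n, 't) bimodule \<Rightarrow> ('m, 'n) tensor"
  where "tensor_relations K S M N =
    {frag_of (m \<oplus>\<^bsub>M\<^esub> m', n) - frag_of (m, n) - frag_of (m', n) | m m' n.
       m \<in> carrier M \<and> m' \<in> carrier M \<and> n \<in> carrier N} \<union>
    {frag_of (m, n \<oplus>\<^bsub>N\<^esub> n') - frag_of (m, n) - frag_of (m, n') | m n n'.
       m \<in> carrier M \<and> n \<in> carrier N \<and> n' \<in> carrier N} \<union>
    {frag_of (ract M m s, n) - frag_of (m, lact N s n) | m s n.
       m \<in> carrier M \<and> s \<in> carrier S \<and> n \<in> carrier N} \<union>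
    {frag_of (k \<odot>\<^bsub>M\<^esub> m, n) - frag_of (m, k \<odot>\<^bsub>N\<^esub> n) | k m n.
       k \<in> carrier K \<and> m \<in> carrier M \<and> n \<in> carrier N}"

definition tensor_kernel ::
  "'k ring \<Rightarrow> ('k, 's) module \<Rightarrow> ('k, 'r, 'm, 's) bimodule \<Rightarrow> ('k, 's, 'n, 't) bimodule \<Rightarrow> ('m, 'n) tensor"
  where "tensor_kernel K S M N =
    generate (free_Abelian_group (carrier M \<times> carrier N)) (tensor_relations K S M N)"

definition pure_tensor ::
  "'k ring \<Rightarrow> ('k, 's) module \<Rightarrow> ('k, 'r, 'm, 's) bimodule \<Rightarrow> ('k, 's, 'n, 't) bimodule \<Rightarrow>
   'm \<Rightarrow> 'n \<Rightarrow> ('m, 'n) tensor"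
  where "pure_tensor K S M N m n =
    tensor_kernel K S M N #>\<^bsub>free_Abelian_group (carrier M \<times> carrier N)\<^esub> frag_of (m, n)"

definition tensor_group ::
  "'k ring \<Rightarrow> ('k, 's) module \<Rightarrow> ('k, 'r, 'm, 's) bimodule \<Rightarrow> ('k, 's, 'n, 't) bimodule \<Rightarrow>
   ('m, 'n) tensor ring"
  where "tensor_group K S M N =
    (let Q = free_Abelian_group (carrier M \<times> carrier N) Mod tensor_kernel K S M N
     in \<lparr>carrier = carrier Q, monoid.mult = undefined, one = undefined,
         ring.zero = one Q, ring.add = monoid.mult Q\<rparr>)"

text \<open>
  \<open>tensor_lift P b\<close> is the additive map from a tensor product to the abelian group \<open>P\<close> that sends the
  class of the pair \<open>(m, n)\<close> to \<open>b m n\<close>.  It is meaningful only for balanced biadditive \<open>b\<close>, when the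
  extension of \<open>b\<close> to the free abelian group is constant on each coset \<open>t\<close>.
\<close>

definition tensor_lift :: "('p, 'x) ring_scheme \<Rightarrow> ('m \<Rightarrow> 'n \<Rightarrow> 'p) \<Rightarrow> ('m, 'n) tensor \<Rightarrow> 'p"
  where "tensor_lift P b t =
    the_elem ((\<lambda>c. \<Oplus>\<^bsub>P\<^esub>p\<in>Poly_Mapping.keys c.
      [Poly_Mapping.lookup c p] \<cdot>\<^bsub>P\<^esub> b (fst p) (snd p)) ` t)"

definition tensor ::
  "'k ring \<Rightarrow> ('k, 's) module \<Rightarrow> ('k, 'r, 'm, 's) bimodule \<Rightarrow> ('k, 's, 'n, 't) bimodule \<Rightarrow>
   ('k, 'r, ('m, 'n) tensor, 't) bimodule"
  where "tensor K S M N =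
    (let T = tensor_group K S M N; pt = pure_tensor K S M N
     in \<lparr>carrier = carrier T, monoid.mult = monoid.mult T, one = one T,
         ring.zero = ring.zero T, ring.add = ring.add T,
         smult = (\<lambda>k. tensor_lift T (\<lambda>m n. pt (k \<odot>\<^bsub>M\<^esub> m) n)),
         lact = (\<lambda>r. tensor_lift T (\<lambda>m n. pt (lact M r m) n)),
         ract = (\<lambda>x t. tensor_lift T (\<lambda>m n. pt m (ract N n t)) x)\<rparr>)"

text \<open>The map induced by \<open>f\<close> and \<open>g\<close>; the arguments \<open>M\<close> and \<open>N\<close> are the factors of the codomain.\<close>

definition tensor_map ::
  "'k ring \<Rightarrow> ('k, 's) module \<Rightarrow> ('k, 'r, 'm, 's) bimodule \<Rightarrow> ('k, 's, 'n, 't) bimodule \<Rightarrow>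
   ('m0 \<Rightarrow> 'm) \<Rightarrow> ('n0 \<Rightarrow> 'n) \<Rightarrow> ('m0, 'n0) tensor \<Rightarrow> ('m, 'n) tensor"
  where "tensor_map K S M N f g =
    tensor_lift (tensor K S M N) (\<lambda>m n. pure_tensor K S M N (f m) (g n))"

text \<open>The canonical map \<open>(M \<otimes>\<^sub>S N) \<otimes>\<^sub>T P \<rightarrow> M \<otimes>\<^sub>S (N \<otimes>\<^sub>T P)\<close>.\<close>

definition tensor_assoc ::
  "'k ring \<Rightarrow> ('k, 's) module \<Rightarrow> ('k, 't) module \<Rightarrow>
   ('k, 'r, 'm, 's) bimodule \<Rightarrow> ('k, 's, 'n, 't) bimodule \<Rightarrow> ('k, 't, 'p, 'u) bimodule \<Rightarrow>
   (('m, 'n) tensor, 'p) tensor \<Rightarrow> ('m, ('n, 'p) tensor) tensor"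
  where "tensor_assoc K S T M N P =
    (let NP = tensor K T N P; Z = tensor K S M NP
     in tensor_lift Z (\<lambda>x p.
          tensor_lift Z (\<lambda>m n. pure_tensor K S M NP m (pure_tensor K T N P n p)) x))"

text \<open>The canonical map \<open>L \<otimes>\<^sub>R ((M \<otimes>\<^sub>S N) \<otimes>\<^sub>T P) \<rightarrow> (L \<otimes>\<^sub>R M) \<otimes>\<^sub>S (N \<otimes>\<^sub>T P)\<close>.\<close>

definition tensor_regroup ::
  "'k ring \<Rightarrow> ('k, 'r) module \<Rightarrow> ('k, 's) module \<Rightarrow> ('k, 't) module \<Rightarrow>
   ('k, 'q, 'l, 'r) bimodule \<Rightarrow> ('k, 'r, 'm, 's) bimodule \<Rightarrow>
   ('k, 's, 'n, 't) bimodule \<Rightarrow> ('k, 't, 'p, 'u) bimodule \<Rightarrow>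
   ('l, (('m, 'n) tensor, 'p) tensor) tensor \<Rightarrow> (('l, 'm) tensor, ('n, 'p) tensor) tensor"
  where "tensor_regroup K R S T L M N P =
    (let LM = tensor K R L M; NP = tensor K T N P; Z = tensor K S LM NP
     in tensor_lift Z (\<lambda>l y.
          tensor_lift Z (\<lambda>x p.
            tensor_lift Z (\<lambda>m n.
              pure_tensor K S LM NP (pure_tensor K R L M l m) (pure_tensor K T N P n p)) x) y))"


section \<open>Firm modules and firm rings\<close>

text \<open>The multiplication maps \<open>R \<otimes>\<^sub>R M \<rightarrow> M\<close> and \<open>M \<otimes>\<^sub>S S \<rightarrow> M\<close>.\<close>

definition left_mult_map :: "('k, 'r, 'm, 's) bimodule \<Rightarrow> ('r, 'm) tensor \<Rightarrow> 'm"
  where "left_mult_map M = tensor_lift M (lact M)"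

definition right_mult_map :: "('k, 'r, 'm, 's) bimodule \<Rightarrow> ('m, 's) tensor \<Rightarrow> 'm"
  where "right_mult_map M = tensor_lift M (ract M)"

locale firm_left_module = left_module K R M
  for K :: "'k ring" and R :: "('k, 'r) module" and M :: "('k, 'r, 'm, 's) bimodule" +
  assumes left_mult_bij:
    "bij_betw (left_mult_map M) (carrier (tensor K R (regular R) M)) (carrier M)"

definition firm_d ::
  "'k ring \<Rightarrow> ('k, 'r) module \<Rightarrow> ('k, 'r, 'm, 's) bimodule \<Rightarrow> 'm \<Rightarrow> ('r, 'm) tensor"
  where "firm_d K R M = the_inv_into (carrier (tensor K R (regular R) M)) (left_mult_map M)"

locale firm_ring = k_algebra K R
  for K :: "'k ring" and R :: "('k, 'r) module" +
  assumes mult_bij: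
    "bij_betw (left_mult_map (regular R)) (carrier (tensor K R (regular R) (regular R))) (carrier R)"


section \<open>Corings and bicomodules\<close>

locale coring = A: unital_k_algebra K A + C: bimodule K A A C
  for K :: "'k ring" and A :: "('k, 'a) module" and C :: "('k, 'a, 'c, 'a) bimodule"
    and \<Delta> :: "'c \<Rightarrow> ('c, 'c) tensor" and \<epsilon> :: "'c \<Rightarrow> 'a" +
  assumes unital: "left_unital A C" "right_unital A C"
    and comult_hom: "bimodule_hom K A A C (tensor K A C C) \<Delta>"
    and counit_hom: "bimodule_hom K A A C (regular A) \<epsilon>"
    and coassoc: "c \<in> carrier C \<Longrightarrow>
      tensor_assoc K A A C C C (tensor_map K A (tensor K A C C) C \<Delta> id (\<Delta> c)) =
      tensor_map K A C (tensor K A C C) id \<Delta> (\<Delta> c)"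
    and counit_l: "c \<in> carrier C \<Longrightarrow>
      left_mult_map C (tensor_map K A (regular A) C \<epsilon> id (\<Delta> c)) = c"
    and counit_r: "c \<in> carrier C \<Longrightarrow>
      right_mult_map C (tensor_map K A C (regular A) id \<epsilon> (\<Delta> c)) = c"

text \<open>\<open>R\<close>-\<open>C\<close>-bicomodules for a ring \<open>R\<close> and an \<open>A\<close>-coring \<open>C\<close>.\<close>

locale ring_coring_bicomodule = coring K A C \<Delta> \<epsilon> + M: bimodule K R A M
  for K :: "'k ring" and R :: "('k, 'r) module" and A :: "('k, 'a) module"
    and C :: "('k, 'a, 'c, 'a) bimodule" and \<Delta> \<epsilon>
    and M :: "('k, 'r, 'm, 'a) bimodule" and \<rho> :: "'m \<Rightarrow> ('m, 'c) tensor" +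
  assumes right_unital: "right_unital A M"
    and coaction_hom: "bimodule_hom K R A M (tensor K A M C) \<rho>"
    and coaction_coassoc: "m \<in> carrier M \<Longrightarrow>
      tensor_assoc K A A M C C (tensor_map K A (tensor K A M C) C \<rho> id (\<rho> m)) =
      tensor_map K A M (tensor K A C C) id \<Delta> (\<rho> m)"
    and coaction_counit: "m \<in> carrier M \<Longrightarrow>
      right_mult_map M (tensor_map K A M (regular A) id \<epsilon> (\<rho> m)) = m"

text \<open>\<open>C\<close>-\<open>R\<close>-bicomodules for an \<open>A\<close>-coring \<open>C\<close> and a ring \<open>R\<close>.\<close>

locale coring_ring_bicomodule = coring K A C \<Delta> \<epsilon> + M: bimodule K A R M
  for K :: "'k ring" and A :: "('k, 'a) module" and C :: "('k, 'a, 'c, 'a) bimodule" and \<Delta> \<epsilon>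
    and R :: "('k, 'r) module"
    and M :: "('k, 'a, 'm, 'r) bimodule" and \<rho> :: "'m \<Rightarrow> ('c, 'm) tensor" +
  assumes left_unital: "left_unital A M"
    and coaction_hom: "bimodule_hom K A R M (tensor K A C M) \<rho>"
    and coaction_coassoc: "m \<in> carrier M \<Longrightarrow>
      tensor_assoc K A A C C M (tensor_map K A (tensor K A C C) M \<Delta> id (\<rho> m)) =
      tensor_map K A C (tensor K A C M) id \<rho> (\<rho> m)"
    and coaction_counit: "m \<in> carrier M \<Longrightarrow>
      left_mult_map M (tensor_map K A (regular A) M \<epsilon> id (\<rho> m)) = m"


section \<open>Structures induced by \<open>\<mu>\<close> and \<open>\<iota>\<close>\<close>

text \<open>
  \<open>S\<close> and \<open>S'\<close> stand for \<open>\<Sigma>\<close> and \<open>\<Sigma>'\<close>.  First the ring \<open>\<Sigma> \<otimes>\<^sub>A \<Sigma>'\<close>, with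
  \<open>(x \<otimes> \<phi>)(y \<otimes> \<psi>) = x \<mu>(\<phi> \<otimes> y) \<otimes> \<psi>\<close>.
\<close>

definition tensor_ring ::
  "'k ring \<Rightarrow> ('k, 'a) module \<Rightarrow> ('k, 'b) module \<Rightarrow> ('k, 'b, 's, 'a) bimodule \<Rightarrow>
   ('k, 'a, 't, 'b) bimodule \<Rightarrow> (('t, 's) tensor \<Rightarrow> 'a) \<Rightarrow> ('k, ('s, 't) tensor) module"
  where "tensor_ring K A B S S' \<mu> =
    (let T = tensor K A S S'
     in \<lparr>carrier = carrier T,
         monoid.mult = (\<lambda>u v. tensor_lift T (\<lambda>x \<phi>. tensor_lift T (\<lambda>y \<psi>.
           pure_tensor K A S S' (ract S x (\<mu> (pure_tensor K B S' S \<phi> y))) \<psi>) v) u),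
         one = undefined, ring.zero = ring.zero T, ring.add = ring.add T, smult = smult T\<rparr>)"

text \<open>\<open>\<Sigma>\<close> as an \<open>R\<close>-\<open>A\<close>-bimodule: \<open>r u = e\<^sub>r \<mu>(\<phi>\<^sub>r \<otimes> u)\<close> where \<open>\<iota> r = e\<^sub>r \<otimes> \<phi>\<^sub>r\<close>.\<close>

definition Sigma_R ::
  "'k ring \<Rightarrow> ('k, 'b) module \<Rightarrow> ('k, 'b, 's, 'a) bimodule \<Rightarrow>
   ('k, 'a, 't, 'b) bimodule \<Rightarrow> (('t, 's) tensor \<Rightarrow> 'a) \<Rightarrow> ('r \<Rightarrow> ('s, 't) tensor) \<Rightarrow>
   ('k, 'r, 's, 'a) bimodule"
  where "Sigma_R K B S S' \<mu> \<iota> = with_actions S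
    (\<lambda>r u. tensor_lift S (\<lambda>e \<phi>. ract S e (\<mu> (pure_tensor K B S' S \<phi> u))) (\<iota> r))
    (ract S)"

text \<open>\<open>\<Sigma>'\<close> as an \<open>A\<close>-\<open>R\<close>-bimodule: \<open>\<phi> r = \<mu>(\<phi> \<otimes> e\<^sub>r) \<phi>\<^sub>r\<close>.\<close>

definition Sigma'_R ::
  "'k ring \<Rightarrow> ('k, 'b) module \<Rightarrow> ('k, 'b, 's, 'a) bimodule \<Rightarrow>
   ('k, 'a, 't, 'b) bimodule \<Rightarrow> (('t, 's) tensor \<Rightarrow> 'a) \<Rightarrow> ('r \<Rightarrow> ('s, 't) tensor) \<Rightarrow>
   ('k, 'a, 't, 'r) bimodule"
  where "Sigma'_R K B S S' \<mu> \<iota> = with_actions S'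
    (lact S')
    (\<lambda>\<phi> r. tensor_lift S' (\<lambda>e \<psi>. lact S' (\<mu> (pure_tensor K B S' S \<phi> e)) \<psi>) (\<iota> r))"

text \<open>The map \<open>\<Sigma>' \<otimes>\<^sub>R \<Sigma> \<rightarrow> A\<close> through which \<open>\<mu>\<close> factors.\<close>

definition mu_R ::
  "'k ring \<Rightarrow> ('k, 'a) module \<Rightarrow> ('k, 'b) module \<Rightarrow> ('k, 'b, 's, 'a) bimodule \<Rightarrow>
   ('k, 'a, 't, 'b) bimodule \<Rightarrow> (('t, 's) tensor \<Rightarrow> 'a) \<Rightarrow> ('t, 's) tensor \<Rightarrow> 'a"
  where "mu_R K A B S S' \<mu> = tensor_lift A (\<lambda>\<phi> x. \<mu> (pure_tensor K B S' S \<phi> x))"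

text \<open>
  In the remaining definitions \<open>S\<close> and \<open>S'\<close> carry their \<open>R\<close>-actions.  The canonical rebracketings that
  identify the iterated tensor products are made explicit.
\<close>

definition comatrix_comult ::
  "'k ring \<Rightarrow> ('k, 'r) module \<Rightarrow> ('k, 'a) module \<Rightarrow> ('k, 'r, 's, 'a) bimodule \<Rightarrow>
   ('k, 'a, 't, 'r) bimodule \<Rightarrow> ('r \<Rightarrow> ('s, 't) tensor) \<Rightarrow>
   ('t, 's) tensor \<Rightarrow> (('t, 's) tensor, ('t, 's) tensor) tensor"
  where "comatrix_comult K R A S S' \<iota> =
    tensor_regroup K R A R S' S S' S
    \<circ> tensor_map K R S' (tensor K R (tensor K A S S') S)
        id (tensor_map K R (tensor K A S S') S \<iota> id)
    \<circ> tensor_map K R S' (tensor K R (regular R) S) id (firm_d K R S)"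

definition Sigma_coaction ::
  "'k ring \<Rightarrow> ('k, 'r) module \<Rightarrow> ('k, 'a) module \<Rightarrow> ('k, 'r, 's, 'a) bimodule \<Rightarrow>
   ('k, 'a, 't, 'r) bimodule \<Rightarrow> ('r \<Rightarrow> ('s, 't) tensor) \<Rightarrow>
   's \<Rightarrow> ('s, ('t, 's) tensor) tensor"
  where "Sigma_coaction K R A S S' \<iota> =
    tensor_assoc K A R S S' S
    \<circ> tensor_map K R (tensor K A S S') S \<iota> id
    \<circ> firm_d K R S"

definition Sigma_dag_coaction ::
  "'k ring \<Rightarrow> ('k, 'r) module \<Rightarrow> ('k, 'a) module \<Rightarrow> ('k, 'r, 's, 'a) bimodule \<Rightarrow>
   ('k, 'a, 't, 'r) bimodule \<Rightarrow> ('r \<Rightarrow> ('s, 't) tensor) \<Rightarrow>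
   ('t, 'r) tensor \<Rightarrow> (('t, 's) tensor, ('t, 'r) tensor) tensor"
  where "Sigma_dag_coaction K R A S S' \<iota> =
    tensor_regroup K R A R S' S S' (regular R)
    \<circ> tensor_map K R S' (tensor K R (tensor K A S S') (regular R))
        id (tensor_map K R (tensor K A S S') (regular R) \<iota> id)
    \<circ> tensor_map K R S' (tensor K R (regular R) (regular R)) id (firm_d K R (regular R))"

end

theory Submission
  imports Defs
begin

text \<open>
  Since \<open>R\<close> is firm and \<open>\<Sigma>\<close> is a firm left \<open>R\<close>-module, all coactions are determined by their values on
  elements \<open>r p\<close>, where they just insert \<open>\<iota>(r) = e\<^sub>r \<otimes> \<phi>\<^sub>r\<close>.  Counitality then is the definition of the
  \<open>R\<close>-actions on \<open>\<Sigma>\<close> and \<open>\<Sigma>'\<close> through \<open>\<iota>\<close> and \<open>\<mu>\<close>.  For coassociativity one evaluates on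
  \<open>r (s p) = (r s) p\<close>: by \<open>R\<close>-linearity \<open>\<iota>(r s) = r \<iota>(s)\<close>, and both sides become the insertion of
  \<open>\<iota>(r) \<otimes> \<iota>(s)\<close>.  The comultiplication of \<open>\<Sigma>' \<otimes>\<^sub>R \<Sigma>\<close> and the coaction of \<open>\<Sigma>' \<otimes>\<^sub>R R\<close> are the cases
  \<open>P = \<Sigma>\<close> and \<open>P = R\<close> of one coaction on \<open>\<Sigma>' \<otimes>\<^sub>R P\<close>, for \<open>P\<close> a firm left \<open>R\<close>-module.
\<close>

section \<open>Tensor products\<close>

text \<open>The element \<iota>(r) has no canonical expansion into pure tensors, so a formula in e
  and \<phi> with the sum understood is written \<open>tensor_lift P b (\<iota> r)\<close>; it has a
  meaning only once \<open>b\<close> is known to be balanced. Calculations with such sums rest on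
  three rules: an additive map moves inside (\<open>tensor_lift_natural\<close>), two sums may be
  exchanged (\<open>tensor_lift_swap\<close>), and a sum over \<iota>(r s) becomes a double sum
  (\<open>lift_\<iota>_mult\<close>). As R may lack a unity, d has no formula on a general element,
  only d(r p) = r \<otimes> p. Coassociativity applies coactions twice, so it can be computed only
  where two factors from R have been split off. The R-linearity of \<iota> is itself derived: it is
  the multiplicativity of \<iota> for the product given by \<mu>, with one of the two sums read as
  an R-action. Once it is known that \<mu> also factors over R, the ring B no longer occurs, and the
  coring argument takes place in a setting without it.\<close>

definition balanced_map ::
  "'k ring \<Rightarrow> ('k, 's) module \<Rightarrow> ('k, 'r, 'm, 's) bimodule \<Rightarrow> ('k, 's, 'n, 't) bimodule \<Rightarrow>
   ('p, 'x) ring_scheme \<Rightarrow> ('m \<Rightarrow> 'n \<Rightarrow> 'p) \<Rightarrow> bool"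
  where "balanced_map K S M N P b \<longleftrightarrow>
    (\<forall>m\<in>carrier M. \<forall>n\<in>carrier N. b m n \<in> carrier P) \<and>
    (\<forall>m\<in>carrier M. \<forall>m'\<in>carrier M. \<forall>n\<in>carrier N. b (m \<oplus>\<^bsub>M\<^esub> m') n = b m n \<oplus>\<^bsub>P\<^esub> b m' n) \<and>
    (\<forall>m\<in>carrier M. \<forall>n\<in>carrier N. \<forall>n'\<in>carrier N. b m (n \<oplus>\<^bsub>N\<^esub> n') = b m n \<oplus>\<^bsub>P\<^esub> b m n') \<and>
    (\<forall>m\<in>carrier M. \<forall>s\<in>carrier S. \<forall>n\<in>carrier N. b (ract M m s) n = b m (lact N s n)) \<and>
    (\<forall>k\<in>carrier K. \<forall>m\<in>carrier M. \<forall>n\<in>carrier N. b (k \<odot>\<^bsub>M\<^esub> m) n = b m (k \<odot>\<^bsub>N\<^esub> n))"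

lemma balanced_mapI:
  assumes "\<And>m n. \<lbrakk>m \<in> carrier M; n \<in> carrier N\<rbrakk> \<Longrightarrow> b m n \<in> carrier P"
    and "\<And>m m' n. \<lbrakk>m \<in> carrier M; m' \<in> carrier M; n \<in> carrier N\<rbrakk> \<Longrightarrow>
      b (m \<oplus>\<^bsub>M\<^esub> m') n = b m n \<oplus>\<^bsub>P\<^esub> b m' n"
    and "\<And>m n n'. \<lbrakk>m \<in> carrier M; n \<in> carrier N; n' \<in> carrier N\<rbrakk> \<Longrightarrow>
      b m (n \<oplus>\<^bsub>N\<^esub> n') = b m n \<oplus>\<^bsub>P\<^esub> b m n'"
    and "\<And>m s n. \<lbrakk>m \<in> carrier M; s \<in> carrier S; n \<in> carrier N\<rbrakk> \<Longrightarrow> b (ract M m s) n = b m (lact N s n)"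
    and "\<And>k m n. \<lbrakk>k \<in> carrier K; m \<in> carrier M; n \<in> carrier N\<rbrakk> \<Longrightarrow>
      b (k \<odot>\<^bsub>M\<^esub> m) n = b m (k \<odot>\<^bsub>N\<^esub> n)"
  shows "balanced_map K S M N P b"
  unfolding balanced_map_def using assms by blast

lemma balanced_mapD:
  assumes "balanced_map K S M N P b"
  shows "\<And>m n. \<lbrakk>m \<in> carrier M; n \<in> carrier N\<rbrakk> \<Longrightarrow> b m n \<in> carrier P"
    and "\<And>m m' n. \<lbrakk>m \<in> carrier M; m' \<in> carrier M; n \<in> carrier N\<rbrakk> \<Longrightarrow>
      b (m \<oplus>\<^bsub>M\<^esub> m') n = b m n \<oplus>\<^bsub>P\<^esub> b m' n"
    and "\<And>m n n'. \<lbrakk>m \<in> carrier M; n \<in> carrier N; n' \<in> carrier N\<rbrakk> \<Longrightarrow>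
      b m (n \<oplus>\<^bsub>N\<^esub> n') = b m n \<oplus>\<^bsub>P\<^esub> b m n'"
    and "\<And>m s n. \<lbrakk>m \<in> carrier M; s \<in> carrier S; n \<in> carrier N\<rbrakk> \<Longrightarrow> b (ract M m s) n = b m (lact N s n)"
    and "\<And>k m n. \<lbrakk>k \<in> carrier K; m \<in> carrier M; n \<in> carrier N\<rbrakk> \<Longrightarrow>
      b (k \<odot>\<^bsub>M\<^esub> m) n = b m (k \<odot>\<^bsub>N\<^esub> n)"
  using assms unfolding balanced_map_def by blast+

text \<open>The extension of \<open>f\<close> to the free abelian group, as it occurs in \<^const>\<open>tensor_lift\<close>.\<close>

definition frag_sum :: "('p, 'x) ring_scheme \<Rightarrow> ('c \<Rightarrow> 'p) \<Rightarrow> ('c \<Rightarrow>\<^sub>0 int) \<Rightarrow> 'p"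
  where "frag_sum P f c = (\<Oplus>\<^bsub>P\<^esub>p\<in>Poly_Mapping.keys c. [Poly_Mapping.lookup c p] \<cdot>\<^bsub>P\<^esub> f p)"

section \<open>Additive extension of a map from generators to the free abelian group\<close>

context abelian_group
begin

lemma add_pow_zero_int [simp]: "[(0::int)] \<cdot> x = \<zero>"
  by (simp add: add_pow_def)

lemma add_pow_one_int [simp]: "x \<in> carrier G \<Longrightarrow> [(1::int)] \<cdot> x = x"
  using add.int_pow_1 by (simp add: add_pow_def)

lemma add_pow_closed_int: "x \<in> carrier G \<Longrightarrow> [(n::int)] \<cdot> x \<in> carrier G"
  by (rule add.int_pow_closed)

lemma add_pow_add_int: "x \<in> carrier G \<Longrightarrow> [(m + n::int)] \<cdot> x = [m] \<cdot> x \<oplus> [n] \<cdot> x"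
  by (rule add.int_pow_mult)

text \<open>The support of a sum can be smaller than the union of the supports, because coefficients
  may cancel. Padding with zero coefficients lets sums over different supports be compared over one
  common finite set.\<close>

lemma frag_sum_superset:
  assumes "f ` S \<subseteq> carrier G" "Poly_Mapping.keys c \<subseteq> U" "U \<subseteq> S" "finite U"
  shows "frag_sum G f c = (\<Oplus>p\<in>U. [Poly_Mapping.lookup c p] \<cdot> f p)"
  unfolding frag_sum_def
proof (rule add.finprod_mono_neutral_cong_left)
  show "[Poly_Mapping.lookup c i] \<cdot> f i = \<zero>" if "i \<in> U - Poly_Mapping.keys c" for i
    using that by (auto simp: in_keys_iff)
  show "(\<lambda>p. [Poly_Mapping.lookup c p] \<cdot> f p) \<in> U \<rightarrow> carrier G"
    using assms by (auto intro!: add_pow_closed_int)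
qed (use assms in auto)

lemma frag_sum_hom:
  assumes "f ` S \<subseteq> carrier G"
  shows "frag_sum G f \<in> hom (free_Abelian_group S) (add_monoid G)"
proof (rule homI)
  fix c assume "c \<in> carrier (free_Abelian_group S)"
  then show "frag_sum G f c \<in> carrier (add_monoid G)"
    unfolding frag_sum_def using assms by (auto intro!: finsum_closed add_pow_closed_int)
next
  fix c d assume cd: "c \<in> carrier (free_Abelian_group S)" "d \<in> carrier (free_Abelian_group S)"
  let ?U = "Poly_Mapping.keys c \<union> Poly_Mapping.keys d"
  have U: "?U \<subseteq> S" "finite ?U" using cd by auto
  have fU: "f x \<in> carrier G" if "x \<in> ?U" for x
    using U that assms by auto
  have "frag_sum G f (c + d) = (\<Oplus>p\<in>?U. [Poly_Mapping.lookup (c + d) p] \<cdot> f p)"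
    by (rule frag_sum_superset[OF assms keys_add U])
  also have "\<dots> = (\<Oplus>p\<in>?U. [Poly_Mapping.lookup c p] \<cdot> f p \<oplus> [Poly_Mapping.lookup d p] \<cdot> f p)"
    by (rule add.finprod_cong')
      (auto simp: Poly_Mapping.lookup_add add_pow_add_int fU intro!: add_pow_closed_int)
  also have "\<dots> = (\<Oplus>p\<in>?U. [Poly_Mapping.lookup c p] \<cdot> f p) \<oplus> (\<Oplus>p\<in>?U. [Poly_Mapping.lookup d p] \<cdot> f p)"
    by (rule finsum_addf) (auto intro!: add_pow_closed_int fU)
  also have "\<dots> = frag_sum G f c \<oplus> frag_sum G f d"
    by (simp add: frag_sum_superset[OF assms _ U])
  finally show "frag_sum G f (c \<otimes>\<^bsub>free_Abelian_group S\<^esub> d) =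
      frag_sum G f c \<otimes>\<^bsub>add_monoid G\<^esub> frag_sum G f d"
    by simp
qed

lemma frag_sum_of: "f x \<in> carrier G \<Longrightarrow> frag_sum G f (frag_of x) = f x"
  by (simp add: frag_sum_def keys_frag_of)

end

lemma tensor_lift_frag_sum: "tensor_lift P b t = the_elem (frag_sum P (\<lambda>p. b (fst p) (snd p)) ` t)"
  by (simp add: tensor_lift_def frag_sum_def [abs_def])

text \<open>Forming the tensor product as a group involves only the two inner actions of
  \<open>S\<close>; the outer actions are added in \<open>bimodule_pair\<close>.\<close>

locale balanced_pair = M: right_module K S M + N: left_module K S N
  for K :: "'k ring" and S :: "('k, 's) module"
    and M :: "('k, 'r, 'm, 's) bimodule" and N :: "('k, 's, 'n, 't) bimodule"
begin

abbreviation "F \<equiv> free_Abelian_group (carrier M \<times> carrier N)"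
abbreviation "J \<equiv> tensor_kernel K S M N"
abbreviation "pt \<equiv> pure_tensor K S M N"
abbreviation "T \<equiv> tensor K S M N"

sublocale F: comm_group F
  by (rule abelian_free_Abelian_group)

lemma relations_closed: "tensor_relations K S M N \<subseteq> carrier F"
  unfolding tensor_relations_def
  by (auto dest!: subsetD[OF keys_diff] simp: M.ract_closed N.lact_closed)

sublocale J: normal J F
  unfolding tensor_kernel_def
  by (rule F.subgroup_imp_normal[OF F.generate_is_subgroup[OF relations_closed]])

lemma carrier_tensor: "carrier T = (\<lambda>c. J #>\<^bsub>F\<^esub> c) ` carrier F"
  by (simp add: tensor_def tensor_group_def Let_def carrier_FactGroup)

lemma add_monoid_tensor:
  "carrier (add_monoid T) = carrier (F Mod J)"
  "monoid.mult (add_monoid T) = monoid.mult (F Mod J)"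
  "one (add_monoid T) = one (F Mod J)"
  by (simp_all add: tensor_def tensor_group_def Let_def)

text \<open>\<open>add_monoid T\<close> is not literally the factor group \<open>F Mod J\<close>;
  the two records agree in carrier, product and unit, so the group laws are carried over one at a
  time.\<close>

lemma tensor_abelian_group: "abelian_group T"
proof -
  interpret Q: comm_group "F Mod J"
    by (rule F.abelian_FactGroup[OF J.subgroup_axioms])
  have "comm_group (add_monoid T)"
  proof (rule comm_groupI, unfold add_monoid_tensor)
    fix x assume "x \<in> carrier (F Mod J)"
    then show "\<exists>y\<in>carrier (F Mod J). y \<otimes>\<^bsub>F Mod J\<^esub> x = \<one>\<^bsub>F Mod J\<^esub>"
      by (rule Q.l_inv_ex)
  qed (rule Q.m_closed Q.one_closed Q.m_assoc Q.m_comm Q.l_one; assumption)+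
  then show ?thesis
    by (simp add: comm_group_abelian_groupI)
qed

sublocale T: abelian_group T
  by (rule tensor_abelian_group)

lemma coset_closed: "c \<in> carrier F \<Longrightarrow> J #>\<^bsub>F\<^esub> c \<in> carrier T"
  by (simp add: carrier_tensor)

lemma coset_add:
  assumes "c \<in> carrier F" "d \<in> carrier F"
  shows "(J #>\<^bsub>F\<^esub> c) \<oplus>\<^bsub>T\<^esub> (J #>\<^bsub>F\<^esub> d) = J #>\<^bsub>F\<^esub> (c + d)"
  using J.rcos_sum[OF assms] by (simp add: tensor_def tensor_group_def Let_def)

lemma coset_relation:
  assumes "c \<in> carrier F" "d \<in> carrier F" "c - d \<in> J"
  shows "J #>\<^bsub>F\<^esub> c = J #>\<^bsub>F\<^esub> d"
proof -
  have "c \<in> J #>\<^bsub>F\<^esub> d"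
    using J.rcos_module_rev[OF F.is_group assms(2,1)] assms by simp
  then show ?thesis
    by (metis F.repr_independence J.subgroup_axioms assms(2))
qed

lemma relation_in_kernel: "c \<in> tensor_relations K S M N \<Longrightarrow> c \<in> J"
  unfolding tensor_kernel_def by (rule generate.incl)

lemma frag_closed: "m \<in> carrier M \<Longrightarrow> n \<in> carrier N \<Longrightarrow> frag_of (m, n) \<in> carrier F"
  by simp

lemma pure_closed [simp, intro]: "m \<in> carrier M \<Longrightarrow> n \<in> carrier N \<Longrightarrow> pt m n \<in> carrier T"
  unfolding pure_tensor_def by (rule coset_closed) simp

lemma pure_add_l:
  assumes "m \<in> carrier M" "m' \<in> carrier M" "n \<in> carrier N"
  shows "pt (m \<oplus>\<^bsub>M\<^esub> m') n = pt m n \<oplus>\<^bsub>T\<^esub> pt m' n"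
  unfolding pure_tensor_def
proof (subst coset_add)
  have "frag_of (m \<oplus>\<^bsub>M\<^esub> m', n) - frag_of (m, n) - frag_of (m', n) \<in> J"
    by (rule relation_in_kernel) (use assms in \<open>auto simp: tensor_relations_def\<close>)
  then show "J #>\<^bsub>F\<^esub> frag_of (m \<oplus>\<^bsub>M\<^esub> m', n) = J #>\<^bsub>F\<^esub> (frag_of (m, n) + frag_of (m', n))"
    using assms F.m_closed[OF frag_closed frag_closed]
    by (intro coset_relation) (auto simp: diff_diff_eq)
qed (use assms in auto)

lemma pure_add_r:
  assumes "m \<in> carrier M" "n \<in> carrier N" "n' \<in> carrier N"
  shows "pt m (n \<oplus>\<^bsub>N\<^esub> n') = pt m n \<oplus>\<^bsub>T\<^esub> pt m n'"
  unfolding pure_tensor_def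
proof (subst coset_add)
  have "frag_of (m, n \<oplus>\<^bsub>N\<^esub> n') - frag_of (m, n) - frag_of (m, n') \<in> J"
    by (rule relation_in_kernel) (use assms in \<open>auto simp: tensor_relations_def\<close>)
  then show "J #>\<^bsub>F\<^esub> frag_of (m, n \<oplus>\<^bsub>N\<^esub> n') = J #>\<^bsub>F\<^esub> (frag_of (m, n) + frag_of (m, n'))"
    using assms F.m_closed[OF frag_closed frag_closed]
    by (intro coset_relation) (auto simp: diff_diff_eq)
qed (use assms in auto)

lemma pure_balanced:
  assumes "m \<in> carrier M" "s \<in> carrier S" "n \<in> carrier N"
  shows "pt (ract M m s) n = pt m (lact N s n)"
  unfolding pure_tensor_def
proof (rule coset_relation)
  show "frag_of (ract M m s, n) - frag_of (m, lact N s n) \<in> J"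
    by (rule relation_in_kernel) (use assms in \<open>auto simp: tensor_relations_def\<close>)
qed (use assms in \<open>auto simp: M.ract_closed N.lact_closed\<close>)

lemma pure_smult_balanced:
  assumes "k \<in> carrier K" "m \<in> carrier M" "n \<in> carrier N"
  shows "pt (k \<odot>\<^bsub>M\<^esub> m) n = pt m (k \<odot>\<^bsub>N\<^esub> n)"
  unfolding pure_tensor_def
proof (rule coset_relation)
  show "frag_of (k \<odot>\<^bsub>M\<^esub> m, n) - frag_of (m, k \<odot>\<^bsub>N\<^esub> n) \<in> J"
    by (rule relation_in_kernel) (use assms in \<open>auto simp: tensor_relations_def\<close>)
qed (use assms in auto)

lemma balanced_pure: "balanced_map K S M N T pt"
  by (rule balanced_mapI) (auto simp: pure_add_l pure_add_r pure_balanced pure_smult_balanced)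

lemma pure_zero_l:
  assumes "n \<in> carrier N"
  shows "pt \<zero>\<^bsub>M\<^esub> n = \<zero>\<^bsub>T\<^esub>"
proof -
  have "pt \<zero>\<^bsub>M\<^esub> n \<oplus>\<^bsub>T\<^esub> pt \<zero>\<^bsub>M\<^esub> n = pt \<zero>\<^bsub>M\<^esub> n"
    using assms by (simp flip: pure_add_l)
  then show ?thesis
    by (metis M.M.zero_closed T.add.l_cancel_one assms pure_closed)
qed

lemma pure_minus_l:
  assumes "m \<in> carrier M" "n \<in> carrier N"
  shows "pt (\<ominus>\<^bsub>M\<^esub> m) n = \<ominus>\<^bsub>T\<^esub> pt m n"
proof -
  have "pt (\<ominus>\<^bsub>M\<^esub> m) n \<oplus>\<^bsub>T\<^esub> pt m n = \<zero>\<^bsub>T\<^esub>"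
    using assms by (simp flip: pure_add_l add: M.M.l_neg pure_zero_l)
  then show ?thesis
    using T.minus_equality assms by (metis M.M.a_inv_closed pure_closed)
qed

text \<open>Inverses and zero are themselves pure tensors, so they need no case of their own.\<close>

lemma tensor_induct [consumes 1, case_names pure add]:
  assumes "x \<in> carrier T"
    and pure: "\<And>m n. \<lbrakk>m \<in> carrier M; n \<in> carrier N\<rbrakk> \<Longrightarrow> Q (pt m n)"
    and add: "\<And>x y. \<lbrakk>x \<in> carrier T; y \<in> carrier T; Q x; Q y\<rbrakk> \<Longrightarrow> Q (x \<oplus>\<^bsub>T\<^esub> y)"
  shows "Q x"
proof -
  have Q0: "Q \<zero>\<^bsub>T\<^esub>"
    using pure[of "\<zero>\<^bsub>M\<^esub>" "\<zero>\<^bsub>N\<^esub>"] by (simp add: pure_zero_l)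
  \<comment> \<open>The rule \<open>free_Abelian_group_induct\<close> builds elements by
    differences, so the claim for c - d needs the property for -d; hence both signs are carried
    through the induction.\<close>
  have "Q (J #>\<^bsub>F\<^esub> c) \<and> Q (\<ominus>\<^bsub>T\<^esub> (J #>\<^bsub>F\<^esub> c))" if "Poly_Mapping.keys c \<subseteq> carrier M \<times> carrier N" for c
  proof (rule free_Abelian_group_induct[OF that])
    have "J #>\<^bsub>F\<^esub> 0 = \<zero>\<^bsub>T\<^esub>"
      using F.coset_mult_one[OF J.subset] by (simp add: tensor_def tensor_group_def Let_def)
    moreover have "\<ominus>\<^bsub>T\<^esub> \<zero>\<^bsub>T\<^esub> = \<zero>\<^bsub>T\<^esub>"
      by (rule T.minus_equality) auto
    ultimately show "Q (J #>\<^bsub>F\<^esub> 0) \<and> Q (\<ominus>\<^bsub>T\<^esub> (J #>\<^bsub>F\<^esub> 0))"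
      using Q0 by (simp only:)
  next
    fix c d :: "'m \<times> 'n \<Rightarrow>\<^sub>0 int"
    assume 2: "Poly_Mapping.keys c \<subseteq> carrier M \<times> carrier N" "Poly_Mapping.keys d \<subseteq> carrier M \<times> carrier N"
      "Q (J #>\<^bsub>F\<^esub> c) \<and> Q (\<ominus>\<^bsub>T\<^esub> (J #>\<^bsub>F\<^esub> c))" "Q (J #>\<^bsub>F\<^esub> d) \<and> Q (\<ominus>\<^bsub>T\<^esub> (J #>\<^bsub>F\<^esub> d))"
    have c: "c \<in> carrier F" and d: "d \<in> carrier F" and cd: "c - d \<in> carrier F"
      using 2 by (auto dest!: subsetD[OF keys_diff])
    have "(J #>\<^bsub>F\<^esub> (c - d)) \<oplus>\<^bsub>T\<^esub> (J #>\<^bsub>F\<^esub> d) = J #>\<^bsub>F\<^esub> c"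
      by (simp add: coset_add[OF cd d])
    then have "J #>\<^bsub>F\<^esub> (c - d) = (J #>\<^bsub>F\<^esub> c) \<oplus>\<^bsub>T\<^esub> \<ominus>\<^bsub>T\<^esub> (J #>\<^bsub>F\<^esub> d)"
      by (metis T.add.inv_solve_right' cd c d coset_closed)
    moreover from this have "\<ominus>\<^bsub>T\<^esub> (J #>\<^bsub>F\<^esub> (c - d)) = \<ominus>\<^bsub>T\<^esub> (J #>\<^bsub>F\<^esub> c) \<oplus>\<^bsub>T\<^esub> (J #>\<^bsub>F\<^esub> d)"
      using coset_closed[OF c] coset_closed[OF d] by (simp add: T.minus_add)
    ultimately show "Q (J #>\<^bsub>F\<^esub> (c - d)) \<and> Q (\<ominus>\<^bsub>T\<^esub> (J #>\<^bsub>F\<^esub> (c - d)))"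
      using 2 coset_closed[OF c] coset_closed[OF d] by (auto intro!: add)
  next
    fix p assume "p \<in> carrier M \<times> carrier N"
    then obtain m n where p: "p = (m, n)" "m \<in> carrier M" "n \<in> carrier N" by auto
    have "Q (pt m n)" "Q (\<ominus>\<^bsub>T\<^esub> pt m n)"
      using p pure by (auto simp flip: pure_minus_l)
    then show "Q (J #>\<^bsub>F\<^esub> frag_of p) \<and> Q (\<ominus>\<^bsub>T\<^esub> (J #>\<^bsub>F\<^esub> frag_of p))"
      by (simp add: p pure_tensor_def)
  qed
  then show ?thesis
    using assms(1) by (auto simp: carrier_tensor)
qed

context
  fixes P :: "('p, 'x) ring_scheme" and b
  assumes P: "abelian_group P" and b: "balanced_map K S M N P b"
begin

interpretation P: abelian_group P by (rule P)

private abbreviation "f \<equiv> (\<lambda>p. b (fst p) (snd p))"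

lemma frag_sum_balanced_hom: "frag_sum P f \<in> hom F (add_monoid P)"
  by (rule P.frag_sum_hom) (use balanced_mapD(1)[OF b] in auto)

interpretation fs: group_hom F "add_monoid P" "frag_sum P f"
  by (rule group_hom.intro[OF F.is_group P.a_group])
    (simp add: group_hom_axioms_def frag_sum_balanced_hom)

lemma frag_sum_balanced_add:
  "c \<in> carrier F \<Longrightarrow> d \<in> carrier F \<Longrightarrow> frag_sum P f (c + d) = frag_sum P f c \<oplus>\<^bsub>P\<^esub> frag_sum P f d"
  using fs.hom_mult by simp

lemma frag_sum_balanced_diff:
  "c \<in> carrier F \<Longrightarrow> d \<in> carrier F \<Longrightarrow> frag_sum P f (c - d) = frag_sum P f c \<ominus>\<^bsub>P\<^esub> frag_sum P f d"
  using frag_sum_balanced_add[of c "- d"] fs.hom_inv[of d]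
  by (simp add: a_minus_def a_inv_def)

lemma frag_sum_balanced_of:
  "m \<in> carrier M \<Longrightarrow> n \<in> carrier N \<Longrightarrow> frag_sum P f (frag_of (m, n)) = b m n"
  by (subst P.frag_sum_of) (auto simp: balanced_mapD(1)[OF b])

text \<open>By additivity of the extension and balancedness of \<open>b\<close>, a relation of
  biadditivity is sent to x + y - x - y and a balance relation to x - x.\<close>

lemma frag_sum_relation:
  assumes "c \<in> tensor_relations K S M N"
  shows "frag_sum P f c = \<zero>\<^bsub>P\<^esub>"
proof -
  have *: "x \<oplus>\<^bsub>P\<^esub> y \<ominus>\<^bsub>P\<^esub> x \<ominus>\<^bsub>P\<^esub> y = \<zero>\<^bsub>P\<^esub>" if "x \<in> carrier P" "y \<in> carrier P" for x y
    using that by (simp add: P.minus_eq P.a_assoc P.a_comm[of y "\<ominus>\<^bsub>P\<^esub> x \<oplus>\<^bsub>P\<^esub> \<ominus>\<^bsub>P\<^esub> y"] P.l_neg P.r_neg)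
  have [simp]: "x \<ominus>\<^bsub>P\<^esub> x = \<zero>\<^bsub>P\<^esub>" if "x \<in> carrier P" for x
    using that by (simp add: P.minus_eq P.r_neg)
  have sub: "Poly_Mapping.keys (frag_of p - frag_of q) \<subseteq> carrier M \<times> carrier N"
    if "p \<in> carrier M \<times> carrier N" "q \<in> carrier M \<times> carrier N" for p q :: "'m \<times> 'n"
    using that by (auto dest!: subsetD[OF keys_diff])
  from assms show ?thesis
    unfolding tensor_relations_def
    by (auto simp: frag_sum_balanced_diff frag_sum_balanced_of balanced_mapD[OF b] sub *
        M.ract_closed N.lact_closed)
qed

text \<open>The kernel of a homomorphism is a subgroup, so containing the generating relations it
  contains all of \<open>J\<close>.\<close>

lemma frag_sum_kernel:
  assumes "c \<in> J"
  shows "frag_sum P f c = \<zero>\<^bsub>P\<^esub>"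
proof -
  have "J \<subseteq> kernel F (add_monoid P) (frag_sum P f)"
    unfolding tensor_kernel_def
    by (rule F.generate_subgroup_incl[OF _ fs.subgroup_kernel])
      (use relations_closed frag_sum_relation in \<open>auto simp only: kernel_def monoid.simps mem_Collect_eq subset_iff\<close>)
  then show ?thesis
    using assms by (auto simp: kernel_def)
qed

text \<open>The extension vanishes on \<open>J\<close>, hence is constant on each coset; the image
  taken in \<open>tensor_lift\<close> is a singleton and \<open>the_elem\<close> returns its member.
  This is the well-definedness from which the rules for values, closure and additivity
  follow.\<close>

lemma tensor_lift_coset:
  assumes "c \<in> carrier F"
  shows "tensor_lift P b (J #>\<^bsub>F\<^esub> c) = frag_sum P f c"
proof -
  have fc: "frag_sum P f c \<in> carrier P"
    using fs.hom_closed[OF assms] by simp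
  have "frag_sum P f (h + c) = frag_sum P f c" if "h \<in> J" for h
    using frag_sum_balanced_add[of h c] frag_sum_kernel[OF that] J.mem_carrier[OF that] assms fc
    by simp
  then have "frag_sum P f ` (J #>\<^bsub>F\<^esub> c) = {frag_sum P f c}"
    using J.one_closed by (force simp: r_coset_def)
  then show ?thesis
    by (simp add: tensor_lift_frag_sum)
qed

lemma tensor_lift_pure: "m \<in> carrier M \<Longrightarrow> n \<in> carrier N \<Longrightarrow> tensor_lift P b (pt m n) = b m n"
  unfolding pure_tensor_def by (simp add: tensor_lift_coset frag_sum_balanced_of)

lemma tensor_lift_closed: "x \<in> carrier T \<Longrightarrow> tensor_lift P b x \<in> carrier P"
  using fs.hom_closed by (auto simp: carrier_tensor tensor_lift_coset)

lemma tensor_lift_add: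
  assumes "x \<in> carrier T" "y \<in> carrier T"
  shows "tensor_lift P b (x \<oplus>\<^bsub>T\<^esub> y) = tensor_lift P b x \<oplus>\<^bsub>P\<^esub> tensor_lift P b y"
proof -
  obtain c d where cd: "c \<in> carrier F" "d \<in> carrier F" "x = J #>\<^bsub>F\<^esub> c" "y = J #>\<^bsub>F\<^esub> d"
    using assms by (auto simp: carrier_tensor)
  moreover have "c + d \<in> carrier F"
    using F.m_closed[OF cd(1,2)] by simp
  ultimately show ?thesis
    by (simp add: coset_add tensor_lift_coset frag_sum_balanced_add del: carrier_free_Abelian_group_iff)
qed

end

end

section \<open>Additive maps, bimodule maps and the calculus of lifts\<close>

definition additive_map :: "('p, 'x) ring_scheme \<Rightarrow> ('q, 'y) ring_scheme \<Rightarrow> ('p \<Rightarrow> 'q) \<Rightarrow> bool"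
  where "additive_map P Q f \<longleftrightarrow> f \<in> carrier P \<rightarrow> carrier Q \<and>
    (\<forall>x\<in>carrier P. \<forall>y\<in>carrier P. f (x \<oplus>\<^bsub>P\<^esub> y) = f x \<oplus>\<^bsub>Q\<^esub> f y)"

lemma additive_mapI:
  assumes "\<And>x. x \<in> carrier P \<Longrightarrow> f x \<in> carrier Q"
    and "\<And>x y. \<lbrakk>x \<in> carrier P; y \<in> carrier P\<rbrakk> \<Longrightarrow> f (x \<oplus>\<^bsub>P\<^esub> y) = f x \<oplus>\<^bsub>Q\<^esub> f y"
  shows "additive_map P Q f"
  using assms by (auto simp: additive_map_def)

lemma additive_mapD:
  assumes "additive_map P Q f"
  shows "\<And>x. x \<in> carrier P \<Longrightarrow> f x \<in> carrier Q"
    and "\<And>x y. \<lbrakk>x \<in> carrier P; y \<in> carrier P\<rbrakk> \<Longrightarrow> f (x \<oplus>\<^bsub>P\<^esub> y) = f x \<oplus>\<^bsub>Q\<^esub> f y"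
  using assms by (auto simp: additive_map_def)

lemma (in module) smult_commute:
  "\<lbrakk>a \<in> carrier R; b \<in> carrier R; x \<in> carrier M\<rbrakk> \<Longrightarrow> a \<odot>\<^bsub>M\<^esub> (b \<odot>\<^bsub>M\<^esub> x) = b \<odot>\<^bsub>M\<^esub> (a \<odot>\<^bsub>M\<^esub> x)"
  by (metis m_comm smult_assoc1)

lemma additive_map_id: "additive_map P P (\<lambda>x. x)"
  by (simp add: additive_map_def)

lemma additive_map_comp:
  "\<lbrakk>additive_map P Q f; additive_map Q V g\<rbrakk> \<Longrightarrow> additive_map P V (\<lambda>x. g (f x))"
  by (auto simp: additive_map_def Pi_iff)

lemma bimodule_homI:
  assumes "additive_map M N f"
    and "\<And>k x. \<lbrakk>k \<in> carrier K; x \<in> carrier M\<rbrakk> \<Longrightarrow> f (k \<odot>\<^bsub>M\<^esub> x) = k \<odot>\<^bsub>N\<^esub> f x"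
    and "\<And>r x. \<lbrakk>r \<in> carrier R; x \<in> carrier M\<rbrakk> \<Longrightarrow> f (lact M r x) = lact N r (f x)"
    and "\<And>s x. \<lbrakk>s \<in> carrier S; x \<in> carrier M\<rbrakk> \<Longrightarrow> f (ract M x s) = ract N (f x) s"
  shows "bimodule_hom K R S M N f"
  using assms by (auto simp: bimodule_hom_def additive_map_def)

lemma bimodule_homD:
  assumes "bimodule_hom K R S M N f"
  shows "\<And>x. x \<in> carrier M \<Longrightarrow> f x \<in> carrier N"
    and "\<And>x y. \<lbrakk>x \<in> carrier M; y \<in> carrier M\<rbrakk> \<Longrightarrow> f (x \<oplus>\<^bsub>M\<^esub> y) = f x \<oplus>\<^bsub>N\<^esub> f y"
    and "\<And>k x. \<lbrakk>k \<in> carrier K; x \<in> carrier M\<rbrakk> \<Longrightarrow> f (k \<odot>\<^bsub>M\<^esub> x) = k \<odot>\<^bsub>N\<^esub> f x"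
    and "\<And>r x. \<lbrakk>r \<in> carrier R; x \<in> carrier M\<rbrakk> \<Longrightarrow> f (lact M r x) = lact N r (f x)"
    and "\<And>s x. \<lbrakk>s \<in> carrier S; x \<in> carrier M\<rbrakk> \<Longrightarrow> f (ract M x s) = ract N (f x) s"
    and "additive_map M N f"
  using assms by (auto simp: bimodule_hom_def additive_map_def)

lemma bimodule_hom_id: "bimodule_hom K R S M M id"
  by (simp add: bimodule_hom_def)

lemma bimodule_hom_comp:
  "\<lbrakk>bimodule_hom K R S N L g; bimodule_hom K R S M N f\<rbrakk> \<Longrightarrow> bimodule_hom K R S M L (g \<circ> f)"
  by (auto simp: bimodule_hom_def Pi_iff)

text \<open>Writing every argument as an image under \<open>f\<close>, the laws for the inverse are
  those of \<open>f\<close> read from right to left. This provides the linearity of d.\<close>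

lemma bimodule_hom_the_inv_into:
  assumes f: "bimodule_hom K R S M N f" and bij: "bij_betw f (carrier M) (carrier N)"
    and M: "bimodule K R S M"
  shows "bimodule_hom K R S N M (the_inv_into (carrier M) f)"
proof -
  interpret M: bimodule K R S M by (rule M)
  have inj: "inj_on f (carrier M)" and im: "carrier N = f ` carrier M"
    using bij by (auto simp: bij_betw_def)
  note closed = M.M.add.m_closed M.M.smult_closed M.lact_closed M.ract_closed
  show ?thesis
    by (auto simp: bimodule_hom_def im the_inv_into_f_f[OF inj] closed
        simp flip: bimodule_homD(2-5)[OF f])
qed

lemma bimodule_abelian_group: "bimodule K R S M \<Longrightarrow> abelian_group M"
  unfolding bimodule_def left_module_def module_def by blast

lemma k_algebra_abelian_group: "k_algebra K R \<Longrightarrow> abelian_group R"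
  unfolding k_algebra_def module_def by blast

lemma balanced_pairI: "\<lbrakk>bimodule K Q S M; bimodule K S U N\<rbrakk> \<Longrightarrow> balanced_pair K S M N"
  unfolding bimodule_def balanced_pair_def by blast

text \<open>The sum in \<open>tensor_lift\<close> looks only at carrier, addition and zero of the
  target. So the target may be exchanged for a record with other actions or another multiplication,
  as between \<Sigma> and \<open>Sigma_R\<close>, or between \<open>A\<close> and
  \<open>regular A\<close>.\<close>

lemma tensor_lift_group_cong:
  assumes P: "carrier P = carrier P'" "ring.add P = ring.add P'" "ring.zero P = ring.zero P'"
  shows "tensor_lift P b = tensor_lift P' b"
  unfolding tensor_lift_def finsum_def add_pow_def finprod_def int_pow_def nat_pow_def m_inv_def
    partial_object.simps monoid.simps P ..

text \<open>Agreement is required on the carriers only; the pair of modules enters because the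
  arguments acted upon in the balance conditions must stay there.\<close>

lemma balanced_map_cong:
  assumes "balanced_pair K S M N" "balanced_map K S M N P b"
    and eq: "\<And>m n. \<lbrakk>m \<in> carrier M; n \<in> carrier N\<rbrakk> \<Longrightarrow> b' m n = b m n"
  shows "balanced_map K S M N P b'"
proof -
  interpret balanced_pair K S M N by (rule assms)
  show ?thesis
    by (rule balanced_mapI)
      (auto simp: eq balanced_mapD(1-3)[OF assms(2)] M.ract_closed N.lact_closed
        intro: balanced_mapD(4-5)[OF assms(2)])
qed

lemma balanced_map_compose:
  assumes "balanced_pair K S M N" "balanced_map K S M N P b" "additive_map P P' f"
  shows "balanced_map K S M N P' (\<lambda>m n. f (b m n))"
  by (rule balanced_mapI) (auto simp: balanced_mapD[OF assms(2)] additive_mapD[OF assms(3)])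

context balanced_pair
begin

lemma additive_tensor_lift:
  "\<lbrakk>abelian_group P; balanced_map K S M N P b\<rbrakk> \<Longrightarrow> additive_map T P (tensor_lift P b)"
  by (intro additive_mapI tensor_lift_closed tensor_lift_add)

lemma additive_tensor_ext:
  assumes "additive_map T P f" "additive_map T P g" "x \<in> carrier T"
    and "\<And>m n. \<lbrakk>m \<in> carrier M; n \<in> carrier N\<rbrakk> \<Longrightarrow> f (pt m n) = g (pt m n)"
  shows "f x = g x"
  using assms(3) by (induction rule: tensor_induct) (auto simp: assms(4) additive_mapD[OF assms(1)] additive_mapD[OF assms(2)])

text \<open>Both sides are additive in \<open>x\<close> and agree on pure tensors. The separate
  \<open>b'\<close>, known only on the carriers, lets moving \<open>f\<close> inside and simplifying
  the summand happen in one step; that \<open>b'\<close> is balanced follows from \<open>b\<close>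
  and \<open>f\<close>.\<close>

lemma tensor_lift_natural:
  assumes P: "abelian_group P" and P': "abelian_group P'"
    and f: "additive_map P P' f" and b: "balanced_map K S M N P b" and x: "x \<in> carrier T"
    and eq: "\<And>m n. \<lbrakk>m \<in> carrier M; n \<in> carrier N\<rbrakk> \<Longrightarrow> f (b m n) = b' m n"
  shows "f (tensor_lift P b x) = tensor_lift P' b' x"
proof -
  have b': "balanced_map K S M N P' b'"
    by (rule balanced_map_cong[OF balanced_pair_axioms balanced_map_compose[OF balanced_pair_axioms b f]])
      (simp add: eq)
  show ?thesis
    by (rule additive_tensor_ext[OF additive_map_comp[OF additive_tensor_lift[OF P b] f]
          additive_tensor_lift[OF P' b'] x])
      (simp add: tensor_lift_pure[OF P b] tensor_lift_pure[OF P' b'] eq)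
qed

lemma tensor_lift_cong:
  assumes "abelian_group P" "balanced_map K S M N P b" "x \<in> carrier T"
    and "\<And>m n. \<lbrakk>m \<in> carrier M; n \<in> carrier N\<rbrakk> \<Longrightarrow> b m n = b' m n"
  shows "tensor_lift P b x = tensor_lift P b' x"
  by (rule tensor_lift_natural[OF assms(1) assms(1) additive_map_id assms(2-4)])

lemma tensor_lift_pointwise_add:
  assumes P: "abelian_group P" and b: "balanced_map K S M N P b" and c: "balanced_map K S M N P c"
    and x: "x \<in> carrier T"
    and eq: "\<And>m n. \<lbrakk>m \<in> carrier M; n \<in> carrier N\<rbrakk> \<Longrightarrow> d m n = b m n \<oplus>\<^bsub>P\<^esub> c m n"
  shows "tensor_lift P d x = tensor_lift P b x \<oplus>\<^bsub>P\<^esub> tensor_lift P c x"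
proof -
  interpret P: abelian_group P by (rule P)
  have d: "balanced_map K S M N P d"
    by (rule balanced_map_cong[OF balanced_pair_axioms _ eq], rule balanced_mapI)
      (auto simp: balanced_mapD[OF b] balanced_mapD[OF c] P.a_ac)
  show ?thesis
    by (rule additive_tensor_ext[OF additive_tensor_lift[OF P d] additive_mapI x])
      (auto simp: tensor_lift_pure[OF P] b c d eq tensor_lift_closed[OF P] tensor_lift_add[OF P] P.a_ac)
qed

end

context
  fixes K :: "'k ring" and S :: "('k, 's) module" and S' :: "('k, 'v) module"
    and M :: "('k, 'r, 'm, 's) bimodule" and N :: "('k, 's, 'n, 't) bimodule"
    and M' :: "('k, 'q, 'x, 'v) bimodule" and N' :: "('k, 'v, 'y, 'u) bimodule"
    and P :: "('p, 'z) ring_scheme" and b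
  assumes pair: "balanced_pair K S M N" and pair': "balanced_pair K S' M' N'"
    and P: "abelian_group P"
    and b: "\<And>m n. \<lbrakk>m \<in> carrier M; n \<in> carrier N\<rbrakk> \<Longrightarrow> balanced_map K S' M' N' P (b m n)"
    and b': "\<And>m' n'. \<lbrakk>m' \<in> carrier M'; n' \<in> carrier N'\<rbrakk> \<Longrightarrow>
      balanced_map K S M N P (\<lambda>m n. b m n m' n')"
begin

interpretation X: balanced_pair K S M N by (rule pair)
interpretation Y: balanced_pair K S' M' N' by (rule pair')

text \<open>For fixed \<open>y\<close> the lift is a sum over \<open>y\<close>, and it inherits
  every condition in m and n that holds termwise: additivity by
  \<open>tensor_lift_pointwise_add\<close>, the balance conditions because the summands
  coincide.\<close>

lemma balanced_lift_param:
  assumes y: "y \<in> carrier (tensor K S' M' N')"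
  shows "balanced_map K S M N P (\<lambda>m n. tensor_lift P (b m n) y)"
proof (rule balanced_mapI)
  show "tensor_lift P (b m n) y \<in> carrier P" if "m \<in> carrier M" "n \<in> carrier N" for m n
    using that y by (rule Y.tensor_lift_closed[OF P b])
qed (auto intro!: Y.tensor_lift_pointwise_add[OF P] Y.tensor_lift_cong[OF P] y b
    simp: balanced_mapD[OF b'] X.M.ract_closed X.N.lact_closed)

end

text \<open>The exchange of two finite sums. Since elements of a tensor product have no chosen
  expansion, it is proved by additivity in \<open>y\<close>: at a pure tensor \<open>y\<close> both
  sides collapse to the same lift over \<open>x\<close>.\<close>

lemma tensor_lift_swap:
  assumes pair: "balanced_pair K S M N" and pair': "balanced_pair K S' M' N'"
    and P: "abelian_group P"
    and b: "\<And>m n. \<lbrakk>m \<in> carrier M; n \<in> carrier N\<rbrakk> \<Longrightarrow> balanced_map K S' M' N' P (b m n)"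
    and b': "\<And>m' n'. \<lbrakk>m' \<in> carrier M'; n' \<in> carrier N'\<rbrakk> \<Longrightarrow>
      balanced_map K S M N P (\<lambda>m n. b m n m' n')"
    and x: "x \<in> carrier (tensor K S M N)" and y: "y \<in> carrier (tensor K S' M' N')"
  shows "tensor_lift P (\<lambda>m n. tensor_lift P (b m n) y) x =
    tensor_lift P (\<lambda>m' n'. tensor_lift P (\<lambda>m n. b m n m' n') x) y"
proof -
  interpret X: balanced_pair K S M N by (rule pair)
  interpret Y: balanced_pair K S' M' N' by (rule pair')
  note bal = balanced_lift_param[where b = b, OF pair pair' P b b']
  have bal': "balanced_map K S' M' N' P (\<lambda>m' n'. tensor_lift P (\<lambda>m n. b m n m' n') x)"
    by (rule balanced_lift_param[OF pair' pair P b' b x])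
  show ?thesis
  proof (rule Y.additive_tensor_ext[OF _ Y.additive_tensor_lift[OF P bal'] y])
    show "additive_map Y.T P (\<lambda>y. tensor_lift P (\<lambda>m n. tensor_lift P (b m n) y) x)"
    proof (rule additive_mapI)
      fix y z assume yz: "y \<in> carrier Y.T" "z \<in> carrier Y.T"
      then show "tensor_lift P (\<lambda>m n. tensor_lift P (b m n) (y \<oplus>\<^bsub>Y.T\<^esub> z)) x =
        tensor_lift P (\<lambda>m n. tensor_lift P (b m n) y) x \<oplus>\<^bsub>P\<^esub> tensor_lift P (\<lambda>m n. tensor_lift P (b m n) z) x"
        by (intro X.tensor_lift_pointwise_add[OF P bal bal x] Y.tensor_lift_add[OF P b])
    qed (rule X.tensor_lift_closed[OF P bal x])
  next
    fix m' n' assume mn: "m' \<in> carrier M'" "n' \<in> carrier N'"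
    have "tensor_lift P (\<lambda>m n. tensor_lift P (b m n) (Y.pt m' n')) x = tensor_lift P (\<lambda>m n. b m n m' n') x"
      by (rule X.tensor_lift_cong[OF P bal x]) (use mn in \<open>auto simp: Y.tensor_lift_pure[OF P b]\<close>)
    then show "tensor_lift P (\<lambda>m n. tensor_lift P (b m n) (Y.pt m' n')) x =
        tensor_lift P (\<lambda>m' n'. tensor_lift P (\<lambda>m n. b m n m' n') x) (Y.pt m' n')"
      by (simp add: Y.tensor_lift_pure[OF P bal'] mn)
  qed
qed


section \<open>Tensor products of bimodules\<close>

locale bimodule_pair = M: bimodule K Q S M + N: bimodule K S U N
  for K :: "'k ring" and Q :: "('k, 'q) module" and S :: "('k, 's) module" and U :: "('k, 'u) module"
    and M :: "('k, 'q, 'm, 's) bimodule" and N :: "('k, 's, 'n, 'u) bimodule"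

sublocale bimodule_pair \<subseteq> balanced_pair K S M N ..

context bimodule_pair
begin

text \<open>Well-definedness of the scalar action. Once all scalars are moved to the second factor,
  the balance over \<open>K\<close> is the commutativity of \<open>K\<close>.\<close>

lemma balanced_smult: "k \<in> carrier K \<Longrightarrow> balanced_map K S M N T (\<lambda>m n. pt (k \<odot>\<^bsub>M\<^esub> m) n)"
  by (rule balanced_mapI)
    (auto simp: M.M.smult_r_distr pure_add_l pure_add_r pure_balanced M.lact_smult_r
      pure_smult_balanced N.M.smult_commute[of k]
      N.lact_closed N.lact_smult_r simp flip: M.ract_smult_l)

text \<open>Balance over \<open>S\<close> is where the two actions on a bimodule have to commute;
  the same happens in \<open>balanced_ract\<close>.\<close>

lemma balanced_lact: "q \<in> carrier Q \<Longrightarrow> balanced_map K S M N T (\<lambda>m n. pt (lact M q m) n)"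
  by (rule balanced_mapI)
    (auto simp: M.lact_add_r pure_add_l pure_add_r M.lact_closed M.lact_smult_r pure_smult_balanced
      pure_balanced simp flip: M.lact_ract)

lemma balanced_ract: "u \<in> carrier U \<Longrightarrow> balanced_map K S M N T (\<lambda>m n. pt m (ract N n u))"
  by (rule balanced_mapI)
    (auto simp: N.ract_add_l pure_add_l pure_add_r N.ract_closed N.ract_smult_l pure_smult_balanced
      pure_balanced N.lact_ract)

lemma tensor_smult: "smult T k = tensor_lift (tensor_group K S M N) (\<lambda>m n. pt (k \<odot>\<^bsub>M\<^esub> m) n)"
  by (simp add: tensor_def Let_def)

lemma tensor_lift_group: "tensor_lift (tensor_group K S M N) b = tensor_lift T b"
  by (rule tensor_lift_group_cong) (simp_all add: tensor_def Let_def)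

lemma tensor_smult_lift: "k \<odot>\<^bsub>T\<^esub> x = tensor_lift T (\<lambda>m n. pt (k \<odot>\<^bsub>M\<^esub> m) n) x"
  by (simp add: tensor_smult tensor_lift_group)

lemma tensor_lact_lift: "lact T q x = tensor_lift T (\<lambda>m n. pt (lact M q m) n) x"
  unfolding tensor_lift_group[symmetric] by (simp add: tensor_def Let_def)

lemma tensor_ract_lift: "ract T x u = tensor_lift T (\<lambda>m n. pt m (ract N n u)) x"
  unfolding tensor_lift_group[symmetric] by (simp add: tensor_def Let_def)

lemma tensor_smult_pure:
  "\<lbrakk>k \<in> carrier K; m \<in> carrier M; n \<in> carrier N\<rbrakk> \<Longrightarrow> k \<odot>\<^bsub>T\<^esub> pt m n = pt (k \<odot>\<^bsub>M\<^esub> m) n"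
  by (simp add: tensor_smult_lift tensor_lift_pure[OF tensor_abelian_group balanced_smult])

lemma tensor_lact_pure:
  "\<lbrakk>q \<in> carrier Q; m \<in> carrier M; n \<in> carrier N\<rbrakk> \<Longrightarrow> lact T q (pt m n) = pt (lact M q m) n"
  by (simp add: tensor_lact_lift tensor_lift_pure[OF tensor_abelian_group balanced_lact])

lemma tensor_ract_pure:
  "\<lbrakk>u \<in> carrier U; m \<in> carrier M; n \<in> carrier N\<rbrakk> \<Longrightarrow> ract T (pt m n) u = pt m (ract N n u)"
  by (simp add: tensor_ract_lift tensor_lift_pure[OF tensor_abelian_group balanced_ract])

lemma tensor_smult_closed: "\<lbrakk>k \<in> carrier K; x \<in> carrier T\<rbrakk> \<Longrightarrow> k \<odot>\<^bsub>T\<^esub> x \<in> carrier T"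
  by (simp add: tensor_smult_lift tensor_lift_closed[OF tensor_abelian_group balanced_smult])

lemma tensor_lact_closed: "\<lbrakk>q \<in> carrier Q; x \<in> carrier T\<rbrakk> \<Longrightarrow> lact T q x \<in> carrier T"
  by (simp add: tensor_lact_lift tensor_lift_closed[OF tensor_abelian_group balanced_lact])

lemma tensor_ract_closed: "\<lbrakk>u \<in> carrier U; x \<in> carrier T\<rbrakk> \<Longrightarrow> ract T x u \<in> carrier T"
  by (simp add: tensor_ract_lift tensor_lift_closed[OF tensor_abelian_group balanced_ract])

lemma tensor_smult_add:
  "\<lbrakk>k \<in> carrier K; x \<in> carrier T; y \<in> carrier T\<rbrakk> \<Longrightarrow> k \<odot>\<^bsub>T\<^esub> (x \<oplus>\<^bsub>T\<^esub> y) = k \<odot>\<^bsub>T\<^esub> x \<oplus>\<^bsub>T\<^esub> k \<odot>\<^bsub>T\<^esub> y"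
  by (simp add: tensor_smult_lift tensor_lift_add[OF tensor_abelian_group balanced_smult])

lemma tensor_lact_add:
  "\<lbrakk>q \<in> carrier Q; x \<in> carrier T; y \<in> carrier T\<rbrakk> \<Longrightarrow> lact T q (x \<oplus>\<^bsub>T\<^esub> y) = lact T q x \<oplus>\<^bsub>T\<^esub> lact T q y"
  by (simp add: tensor_lact_lift tensor_lift_add[OF tensor_abelian_group balanced_lact])

lemma tensor_ract_add:
  "\<lbrakk>u \<in> carrier U; x \<in> carrier T; y \<in> carrier T\<rbrakk> \<Longrightarrow> ract T (x \<oplus>\<^bsub>T\<^esub> y) u = ract T x u \<oplus>\<^bsub>T\<^esub> ract T y u"
  by (simp add: tensor_ract_lift tensor_lift_add[OF tensor_abelian_group balanced_ract])

lemmas tensor_pure_simps = tensor_smult_pure tensor_lact_pure tensor_ract_pure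
lemmas tensor_add_simps = tensor_smult_add tensor_lact_add tensor_ract_add
lemmas tensor_closed = tensor_smult_closed tensor_lact_closed tensor_ract_closed

lemma tensor_module: "module K T"
proof (rule moduleI)
  show "cring K" using M.M.module_axioms unfolding module_def by blast
  show "abelian_group T" by (rule tensor_abelian_group)
next
  fix a b x assume ab: "a \<in> carrier K" "b \<in> carrier K" and "x \<in> carrier T"
  from this(3) show "(a \<oplus>\<^bsub>K\<^esub> b) \<odot>\<^bsub>T\<^esub> x = a \<odot>\<^bsub>T\<^esub> x \<oplus>\<^bsub>T\<^esub> b \<odot>\<^bsub>T\<^esub> x"
    using ab by (induction rule: tensor_induct)
      (auto simp: tensor_pure_simps tensor_add_simps tensor_closed M.M.smult_l_distr pure_add_l T.a_ac)
  from \<open>x \<in> carrier T\<close> show "(a \<otimes>\<^bsub>K\<^esub> b) \<odot>\<^bsub>T\<^esub> x = a \<odot>\<^bsub>T\<^esub> (b \<odot>\<^bsub>T\<^esub> x)"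
    using ab by (induction rule: tensor_induct)
      (auto simp: tensor_pure_simps tensor_add_simps tensor_closed M.M.smult_assoc1)
next
  fix x assume "x \<in> carrier T"
  then show "\<one>\<^bsub>K\<^esub> \<odot>\<^bsub>T\<^esub> x = x"
    by (induction rule: tensor_induct) (auto simp: tensor_pure_simps tensor_add_simps)
qed (auto simp: tensor_closed tensor_add_simps)

text \<open>Every law is additive in the tensor, so it is enough to check it on pure tensors, where
  the left action lives on the first factor and the right action on the second.\<close>

lemma tensor_bimodule: "bimodule K Q U T"
proof (intro bimodule.intro left_module.intro right_module.intro bimodule_axioms.intro
    left_module_axioms.intro right_module_axioms.intro tensor_module)
  show "k_algebra K Q" "k_algebra K U"
    by (rule M.R.k_algebra_axioms N.S.k_algebra_axioms)+
next
  fix r r' x assume rr: "r \<in> carrier Q" "r' \<in> carrier Q" and "x \<in> carrier T"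
  from this(3) show "lact T (r \<oplus>\<^bsub>Q\<^esub> r') x = lact T r x \<oplus>\<^bsub>T\<^esub> lact T r' x"
    using rr by (induction rule: tensor_induct)
      (auto simp: tensor_pure_simps tensor_add_simps tensor_closed M.lact_add_l M.lact_closed pure_add_l T.a_ac)
  from \<open>x \<in> carrier T\<close> show "lact T (r \<otimes>\<^bsub>Q\<^esub> r') x = lact T r (lact T r' x)"
    using rr by (induction rule: tensor_induct)
      (auto simp: tensor_pure_simps tensor_add_simps tensor_closed M.lact_assoc M.lact_closed M.R.mult_closed)
next
  fix k r x assume kr: "k \<in> carrier K" "r \<in> carrier Q" and "x \<in> carrier T"
  from this(3) show "lact T (k \<odot>\<^bsub>Q\<^esub> r) x = k \<odot>\<^bsub>T\<^esub> lact T r x"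
    using kr by (induction rule: tensor_induct)
      (auto simp: tensor_pure_simps tensor_add_simps tensor_closed M.lact_smult_l M.lact_closed)
  from \<open>x \<in> carrier T\<close> show "lact T r (k \<odot>\<^bsub>T\<^esub> x) = k \<odot>\<^bsub>T\<^esub> lact T r x"
    using kr by (induction rule: tensor_induct)
      (auto simp: tensor_pure_simps tensor_add_simps tensor_closed M.lact_smult_r M.lact_closed)
next
  fix s s' x assume ss: "s \<in> carrier U" "s' \<in> carrier U" and "x \<in> carrier T"
  from this(3) show "ract T x (s \<oplus>\<^bsub>U\<^esub> s') = ract T x s \<oplus>\<^bsub>T\<^esub> ract T x s'"
    using ss by (induction rule: tensor_induct)
      (auto simp: tensor_pure_simps tensor_add_simps tensor_closed N.ract_add_r N.ract_closed pure_add_r T.a_ac)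
  from \<open>x \<in> carrier T\<close> show "ract T x (s \<otimes>\<^bsub>U\<^esub> s') = ract T (ract T x s) s'"
    using ss by (induction rule: tensor_induct)
      (auto simp: tensor_pure_simps tensor_add_simps tensor_closed N.ract_assoc N.ract_closed N.S.mult_closed)
next
  fix k s x assume ks: "k \<in> carrier K" "s \<in> carrier U" and "x \<in> carrier T"
  \<comment> \<open>The scalar arises in the second factor, while the scalar action on the tensor
    product is defined on the first; balance over \<open>K\<close> moves it.\<close>
  from this(3) show "ract T x (k \<odot>\<^bsub>U\<^esub> s) = k \<odot>\<^bsub>T\<^esub> ract T x s"
    using ks by (induction rule: tensor_induct)
      (auto simp: tensor_pure_simps tensor_add_simps tensor_closed N.ract_smult_r N.ract_closed pure_smult_balanced)
  from \<open>x \<in> carrier T\<close> show "ract T (k \<odot>\<^bsub>T\<^esub> x) s = k \<odot>\<^bsub>T\<^esub> ract T x s"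
    using ks by (induction rule: tensor_induct)
      (auto simp: tensor_pure_simps tensor_add_simps tensor_closed N.ract_closed)
next
  fix r x s assume rs: "r \<in> carrier Q" "s \<in> carrier U" and "x \<in> carrier T"
  from this(3) show "ract T (lact T r x) s = lact T r (ract T x s)"
    using rs by (induction rule: tensor_induct)
      (auto simp: tensor_pure_simps tensor_add_simps tensor_closed N.ract_closed M.lact_closed)
qed (auto simp: tensor_closed tensor_add_simps)

lemma tensor_left_unital:
  assumes "left_unital Q M" "\<one>\<^bsub>Q\<^esub> \<in> carrier Q"
  shows "left_unital Q T"
  unfolding left_unital_def
proof
  fix x assume "x \<in> carrier T"
  then show "lact T \<one>\<^bsub>Q\<^esub> x = x"
    using assms by (induction rule: tensor_induct)
      (auto simp: left_unital_def tensor_pure_simps tensor_add_simps)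
qed

lemma tensor_right_unital:
  assumes "right_unital U N" "\<one>\<^bsub>U\<^esub> \<in> carrier U"
  shows "right_unital U T"
  unfolding right_unital_def
proof
  fix x assume "x \<in> carrier T"
  then show "ract T x \<one>\<^bsub>U\<^esub> = x"
    using assms by (induction rule: tensor_induct)
      (auto simp: right_unital_def tensor_pure_simps tensor_add_simps)
qed

lemma tensor_lift_smult:
  assumes P: "module K P" and b: "balanced_map K S M N P b"
    and eq: "\<And>m n. \<lbrakk>m \<in> carrier M; n \<in> carrier N\<rbrakk> \<Longrightarrow> b (k \<odot>\<^bsub>M\<^esub> m) n = k \<odot>\<^bsub>P\<^esub> b m n"
    and k: "k \<in> carrier K" and x: "x \<in> carrier T"
  shows "tensor_lift P b (k \<odot>\<^bsub>T\<^esub> x) = k \<odot>\<^bsub>P\<^esub> tensor_lift P b x"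
proof -
  interpret P: module K P by (rule P)
  note P' = P.abelian_group_axioms
  from x show ?thesis
    by (induction rule: tensor_induct)
      (use k in \<open>auto simp: tensor_pure_simps tensor_add_simps tensor_closed eq P.smult_r_distr
        tensor_lift_pure[OF P' b] tensor_lift_add[OF P' b] tensor_lift_closed[OF P' b]\<close>)
qed

lemma tensor_lift_lact:
  assumes P: "left_module K Q P" and b: "balanced_map K S M N P b"
    and eq: "\<And>m n. \<lbrakk>m \<in> carrier M; n \<in> carrier N\<rbrakk> \<Longrightarrow> b (lact M q m) n = lact P q (b m n)"
    and q: "q \<in> carrier Q" and x: "x \<in> carrier T"
  shows "tensor_lift P b (lact T q x) = lact P q (tensor_lift P b x)"
proof -
  interpret P: left_module K Q P by (rule P)
  note P' = P.M.abelian_group_axioms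
  from x show ?thesis
    by (induction rule: tensor_induct)
      (use q in \<open>auto simp: tensor_pure_simps tensor_add_simps tensor_closed eq P.lact_add_r M.lact_closed
        tensor_lift_pure[OF P' b] tensor_lift_add[OF P' b] tensor_lift_closed[OF P' b]\<close>)
qed

lemma tensor_lift_ract:
  assumes P: "right_module K U P" and b: "balanced_map K S M N P b"
    and eq: "\<And>m n. \<lbrakk>m \<in> carrier M; n \<in> carrier N\<rbrakk> \<Longrightarrow> b m (ract N n u) = ract P (b m n) u"
    and u: "u \<in> carrier U" and x: "x \<in> carrier T"
  shows "tensor_lift P b (ract T x u) = ract P (tensor_lift P b x) u"
proof -
  interpret P: right_module K U P by (rule P)
  note P' = P.M.abelian_group_axioms
  from x show ?thesis
    by (induction rule: tensor_induct)
      (use u in \<open>auto simp: tensor_pure_simps tensor_add_simps tensor_closed eq P.ract_add_l N.ract_closed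
        tensor_lift_pure[OF P' b] tensor_lift_add[OF P' b] tensor_lift_closed[OF P' b]\<close>)
qed

lemma tensor_lift_bimodule_hom:
  assumes P: "bimodule K Q U P" and b: "balanced_map K S M N P b"
    and "\<And>k m n. \<lbrakk>k \<in> carrier K; m \<in> carrier M; n \<in> carrier N\<rbrakk> \<Longrightarrow> b (k \<odot>\<^bsub>M\<^esub> m) n = k \<odot>\<^bsub>P\<^esub> b m n"
    and "\<And>q m n. \<lbrakk>q \<in> carrier Q; m \<in> carrier M; n \<in> carrier N\<rbrakk> \<Longrightarrow> b (lact M q m) n = lact P q (b m n)"
    and "\<And>u m n. \<lbrakk>u \<in> carrier U; m \<in> carrier M; n \<in> carrier N\<rbrakk> \<Longrightarrow> b m (ract N n u) = ract P (b m n) u"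
  shows "bimodule_hom K Q U T P (tensor_lift P b)"
proof -
  interpret P: bimodule K Q U P by (rule P)
  show ?thesis
    using assms(3-5)
    by (intro bimodule_homI additive_tensor_lift tensor_lift_smult tensor_lift_lact tensor_lift_ract
        P.M.abelian_group_axioms P.M.module_axioms P.left_module_axioms P.right_module_axioms b)
qed

end

section \<open>Functoriality of the tensor product\<close>

lemma bimodule_pairI: "\<lbrakk>bimodule K Q S M; bimodule K S U N\<rbrakk> \<Longrightarrow> bimodule_pair K Q S U M N"
  by (rule bimodule_pair.intro)

context
  fixes K :: "'k ring" and Q S U and M :: "('k, 'q, 'm, 's) bimodule" and N :: "('k, 's, 'n, 'u) bimodule"
    and M' :: "('k, 'q, 'x, 's) bimodule" and N' :: "('k, 's, 'y, 'u) bimodule" and f g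
  assumes pair: "bimodule_pair K Q S U M N" and pair': "bimodule_pair K Q S U M' N'"
    and f: "bimodule_hom K Q S M M' f" and g: "bimodule_hom K S U N N' g"
begin

interpretation X: bimodule_pair K Q S U M N by (rule pair)
interpretation Y: bimodule_pair K Q S U M' N' by (rule pair')

lemma balanced_tensor_map: "balanced_map K S M N Y.T (\<lambda>m n. Y.pt (f m) (g n))"
  by (rule balanced_mapI)
    (auto simp: bimodule_homD[OF f] bimodule_homD[OF g]
      Y.pure_add_l Y.pure_add_r Y.pure_balanced Y.pure_smult_balanced)

lemma tensor_map_pure:
  "\<lbrakk>m \<in> carrier M; n \<in> carrier N\<rbrakk> \<Longrightarrow> tensor_map K S M' N' f g (X.pt m n) = Y.pt (f m) (g n)"
  unfolding tensor_map_def by (simp add: X.tensor_lift_pure[OF Y.tensor_abelian_group balanced_tensor_map])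

lemma tensor_map_hom: "bimodule_hom K Q U X.T Y.T (tensor_map K S M' N' f g)"
  unfolding tensor_map_def
  by (rule X.tensor_lift_bimodule_hom[OF Y.tensor_bimodule balanced_tensor_map])
    (auto simp: bimodule_homD[OF f] bimodule_homD[OF g] Y.tensor_pure_simps)

end

section \<open>Iterated tensor products and associativity\<close>

locale bimodule_triple = MN: bimodule_pair K Q S U M N + NL: bimodule_pair K S U V N L
  for K :: "'k ring" and Q :: "('k, 'q) module" and S :: "('k, 's) module" and U :: "('k, 'u) module"
    and V :: "('k, 'v) module"
    and M :: "('k, 'q, 'm, 's) bimodule" and N :: "('k, 's, 'n, 'u) bimodule"
    and L :: "('k, 'u, 'l, 'v) bimodule"
begin

abbreviation "MN \<equiv> tensor K S M N"
abbreviation "NL \<equiv> tensor K U N L"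

sublocale MN_L: bimodule_pair K Q U V MN L
  by (rule bimodule_pairI[OF MN.tensor_bimodule NL.N.bimodule_axioms])

sublocale M_NL: bimodule_pair K Q S V M NL
  by (rule bimodule_pairI[OF MN.M.bimodule_axioms NL.tensor_bimodule])

context
  fixes P :: "('p, 'x) ring_scheme" and b
  assumes P: "abelian_group P"
    and b: "\<And>l. l \<in> carrier L \<Longrightarrow> balanced_map K S M N P (\<lambda>m n. b m n l)"
    and b': "\<And>m. m \<in> carrier M \<Longrightarrow> balanced_map K U N L P (b m)"
begin

interpretation P: abelian_group P by (rule P)

text \<open>A map of three variables, balanced at both inner places, factors through (M \<otimes> N)
  \<otimes> L. The first place is used up by the lift. The conditions at the second are additive in
  \<open>x\<close>, so they reduce to pure tensors m \<otimes> n, where they follow from those of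
  \<open>b m\<close>; a scalar must first be moved from m to n.\<close>

lemma balanced_lift_left: "balanced_map K U MN L P (\<lambda>x l. tensor_lift P (\<lambda>m n. b m n l) x)"
proof -
  note simps = MN.tensor_lift_pure[OF P b] MN.tensor_lift_closed[OF P b] MN.tensor_lift_add[OF P b]
    MN.tensor_add_simps MN.tensor_pure_simps MN.tensor_closed P.a_ac
    MN.N.ract_closed NL.N.lact_closed
  show ?thesis
  proof (rule balanced_mapI)
    fix x l l' assume l: "l \<in> carrier L" "l' \<in> carrier L" and "x \<in> carrier MN"
    from this(3) show "tensor_lift P (\<lambda>m n. b m n (l \<oplus>\<^bsub>L\<^esub> l')) x =
      tensor_lift P (\<lambda>m n. b m n l) x \<oplus>\<^bsub>P\<^esub> tensor_lift P (\<lambda>m n. b m n l') x"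
      by (induction rule: MN.tensor_induct) (use l in \<open>auto simp: simps balanced_mapD[OF b']\<close>)
  next
    fix x u l assume l: "l \<in> carrier L" "u \<in> carrier U" and "x \<in> carrier MN"
    from this(3) show "tensor_lift P (\<lambda>m n. b m n l) (ract MN x u) =
      tensor_lift P (\<lambda>m n. b m n (lact L u l)) x"
      by (induction rule: MN.tensor_induct) (use l in \<open>auto simp: simps balanced_mapD[OF b']\<close>)
  next
    fix x k l assume l: "l \<in> carrier L" "k \<in> carrier K" and "x \<in> carrier MN"
    from this(3) show "tensor_lift P (\<lambda>m n. b m n l) (k \<odot>\<^bsub>MN\<^esub> x) =
      tensor_lift P (\<lambda>m n. b m n (k \<odot>\<^bsub>L\<^esub> l)) x"
      by (induction rule: MN.tensor_induct)
        (use l in \<open>auto simp: simps balanced_mapD(5)[OF b] balanced_mapD(5)[OF b']\<close>)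
  qed (auto simp: simps)
qed

lemma balanced_lift_right: "balanced_map K S M NL P (\<lambda>m y. tensor_lift P (b m) y)"
proof -
  note simps = NL.tensor_lift_pure[OF P b'] NL.tensor_lift_closed[OF P b'] NL.tensor_lift_add[OF P b']
    NL.tensor_add_simps NL.tensor_pure_simps NL.tensor_closed P.a_ac
    MN.M.ract_closed MN.N.lact_closed
  show ?thesis
  proof (rule balanced_mapI)
    fix x l l' assume l: "l \<in> carrier M" "l' \<in> carrier M" and "x \<in> carrier NL"
    from this(3) show "tensor_lift P (b (l \<oplus>\<^bsub>M\<^esub> l')) x =
      tensor_lift P (b l) x \<oplus>\<^bsub>P\<^esub> tensor_lift P (b l') x"
      by (induction rule: NL.tensor_induct) (use l in \<open>auto simp: simps balanced_mapD(2)[OF b]\<close>)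
  next
    fix x s l assume l: "l \<in> carrier M" "s \<in> carrier S" and "x \<in> carrier NL"
    from this(3) show "tensor_lift P (b (ract M l s)) x = tensor_lift P (b l) (lact NL s x)"
      by (induction rule: NL.tensor_induct) (use l in \<open>auto simp: simps balanced_mapD(4)[OF b]\<close>)
  next
    fix x k l assume l: "l \<in> carrier M" "k \<in> carrier K" and "x \<in> carrier NL"
    from this(3) show "tensor_lift P (b (k \<odot>\<^bsub>M\<^esub> l)) x = tensor_lift P (b l) (k \<odot>\<^bsub>NL\<^esub> x)"
      by (induction rule: NL.tensor_induct)
        (use l in \<open>auto simp: simps balanced_mapD(5)[OF b]\<close>)
  qed (auto simp: simps)
qed

end

lemma balanced_assoc_left:
  "l \<in> carrier L \<Longrightarrow> balanced_map K S M N M_NL.T (\<lambda>m n. M_NL.pt m (NL.pt n l))"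
  by (rule balanced_mapI)
    (auto simp: M_NL.pure_add_l M_NL.pure_add_r M_NL.pure_balanced M_NL.pure_smult_balanced
      NL.pure_add_l NL.tensor_pure_simps)

lemma balanced_assoc_right:
  "m \<in> carrier M \<Longrightarrow> balanced_map K U N L M_NL.T (\<lambda>n l. M_NL.pt m (NL.pt n l))"
  by (rule balanced_map_compose[OF NL.balanced_pair_axioms NL.balanced_pure])
    (rule additive_mapI, auto simp: M_NL.pure_add_r)

lemmas balanced_assoc = balanced_lift_left[OF M_NL.tensor_abelian_group balanced_assoc_left balanced_assoc_right]

lemma tensor_assoc_pure:
  "\<lbrakk>m \<in> carrier M; n \<in> carrier N; l \<in> carrier L\<rbrakk> \<Longrightarrow>
    tensor_assoc K S U M N L (MN_L.pt (MN.pt m n) l) = M_NL.pt m (NL.pt n l)"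
  unfolding tensor_assoc_def Let_def
  by (simp add: MN_L.tensor_lift_pure[OF M_NL.tensor_abelian_group balanced_assoc]
      MN.tensor_lift_pure[OF M_NL.tensor_abelian_group balanced_assoc_left])

lemma tensor_assoc_hom: "bimodule_hom K Q V MN_L.T M_NL.T (tensor_assoc K S U M N L)"
  unfolding tensor_assoc_def Let_def
proof (rule MN_L.tensor_lift_bimodule_hom[OF M_NL.tensor_bimodule balanced_assoc])
  interpret Z: bimodule K Q V M_NL.T by (rule M_NL.tensor_bimodule)
  let ?b = "\<lambda>l m n. M_NL.pt m (NL.pt n l)"
  fix k x l assume *: "k \<in> carrier K" "x \<in> carrier MN" "l \<in> carrier L"
  show "tensor_lift M_NL.T (?b l) (k \<odot>\<^bsub>MN\<^esub> x) = k \<odot>\<^bsub>M_NL.T\<^esub> tensor_lift M_NL.T (?b l) x"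
    by (rule MN.tensor_lift_smult[OF Z.M.module_axioms balanced_assoc_left])
      (use * in \<open>auto simp: M_NL.tensor_pure_simps\<close>)
next
  interpret Z: bimodule K Q V M_NL.T by (rule M_NL.tensor_bimodule)
  let ?b = "\<lambda>l m n. M_NL.pt m (NL.pt n l)"
  fix q x l assume *: "q \<in> carrier Q" "x \<in> carrier MN" "l \<in> carrier L"
  show "tensor_lift M_NL.T (?b l) (lact MN q x) = lact M_NL.T q (tensor_lift M_NL.T (?b l) x)"
    by (rule MN.tensor_lift_lact[OF Z.left_module_axioms balanced_assoc_left])
      (use * in \<open>auto simp: M_NL.tensor_pure_simps\<close>)
next
  let ?b = "\<lambda>l m n. M_NL.pt m (NL.pt n l)"
  fix v x l assume *: "v \<in> carrier V" "x \<in> carrier MN" "l \<in> carrier L"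
  show "tensor_lift M_NL.T (?b (ract L l v)) x = ract M_NL.T (tensor_lift M_NL.T (?b l) x) v"
    by (rule sym, rule MN.tensor_lift_natural[OF M_NL.tensor_abelian_group M_NL.tensor_abelian_group
        additive_mapI balanced_assoc_left])
      (use * in \<open>auto simp: M_NL.tensor_pure_simps M_NL.tensor_closed M_NL.tensor_add_simps NL.tensor_pure_simps\<close>)
qed

end

section \<open>Regrouping of four factors\<close>

locale bimodule_quadruple = LM: bimodule_pair K W Q S L M + triple: bimodule_triple K Q S U V M N P
  for K :: "'k ring" and W :: "('k, 'w) module" and Q :: "('k, 'q) module" and S :: "('k, 's) module"
    and U :: "('k, 'u) module" and V :: "('k, 'v) module"
    and L :: "('k, 'w, 'l, 'q) bimodule"
    and M :: "('k, 'q, 'm, 's) bimodule" and N :: "('k, 's, 'n, 'u) bimodule"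
    and P :: "('k, 'u, 'p, 'v) bimodule"
begin

abbreviation "LM \<equiv> tensor K Q L M"
abbreviation "MN \<equiv> tensor K S M N"
abbreviation "NP \<equiv> tensor K U N P"

sublocale L_MN: bimodule_triple K W Q S U L M N ..

sublocale L_MN_P: bimodule_triple K W Q U V L MN P
  by unfold_locales

sublocale LM_NP: bimodule_pair K W S V LM NP
  by (rule bimodule_pairI[OF LM.tensor_bimodule triple.NL.tensor_bimodule])

abbreviation "quad l m n p \<equiv> LM_NP.pt (LM.pt l m) (triple.NL.pt n p)"

text \<open>The middle pair (m, n) is where \<iota>(r) will be inserted. Its balance over
  \<open>S\<close> is that of the outer tensor product, as \<open>S\<close> acts on L \<otimes> M
  through \<open>M\<close> and on N \<otimes> P through \<open>N\<close>.\<close>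

lemma balanced_quad_mn:
  "\<lbrakk>l \<in> carrier L; p \<in> carrier P\<rbrakk> \<Longrightarrow> balanced_map K S M N LM_NP.T (\<lambda>m n. quad l m n p)"
  by (rule balanced_mapI)
    (auto simp: LM_NP.pure_add_l LM_NP.pure_add_r LM.pure_add_r triple.NL.pure_add_l
      LM_NP.pure_balanced LM_NP.pure_smult_balanced simp flip: LM.pure_smult_balanced
      triple.NL.tensor_smult_pure triple.NL.tensor_lact_pure LM.tensor_smult_pure LM.tensor_ract_pure)

lemma balanced_quad_np:
  "\<lbrakk>l \<in> carrier L; m \<in> carrier M\<rbrakk> \<Longrightarrow> balanced_map K U N P LM_NP.T (\<lambda>n p. quad l m n p)"
  by (rule balanced_map_compose[OF triple.NL.balanced_pair_axioms triple.NL.balanced_pure])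
    (rule additive_mapI, auto simp: LM_NP.pure_add_r)

lemma balanced_quad_lm:
  "\<lbrakk>n \<in> carrier N; p \<in> carrier P\<rbrakk> \<Longrightarrow> balanced_map K Q L M LM_NP.T (\<lambda>l m. quad l m n p)"
  by (rule balanced_map_compose[OF LM.balanced_pair_axioms LM.balanced_pure])
    (rule additive_mapI, auto simp: LM_NP.pure_add_l)

lemmas LM_NP_group = LM_NP.tensor_abelian_group

lemmas balanced_quad_right =
  triple.balanced_lift_left[OF LM_NP_group balanced_quad_mn balanced_quad_np]

lemmas balanced_quad_left =
  L_MN.balanced_lift_right[OF LM_NP_group balanced_quad_lm balanced_quad_mn]

lemmas balanced_quad =
  L_MN_P.balanced_lift_right[OF LM_NP_group balanced_quad_left balanced_quad_right]

text \<open>Here \<open>x\<close> stays an arbitrary element of M \<otimes> N: it will be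
  \<iota>(r), which need not be a pure tensor, so the innermost lift has to remain.\<close>

lemma tensor_regroup_left:
  "\<lbrakk>l \<in> carrier L; x \<in> carrier MN; p \<in> carrier P\<rbrakk> \<Longrightarrow>
    tensor_regroup K Q S U L M N P (L_MN_P.M_NL.pt l (triple.MN_L.pt x p)) =
    tensor_lift LM_NP.T (\<lambda>m n. quad l m n p) x"
  unfolding tensor_regroup_def Let_def
  by (simp add: L_MN_P.M_NL.tensor_lift_pure[OF LM_NP_group balanced_quad]
      triple.MN_L.tensor_lift_pure[OF LM_NP_group balanced_quad_right])

text \<open>Scalars and the left action on the regrouped product touch only the first entry; this
  moves such an endomorphism through both nested lifts.\<close>

lemma quad_lift_natural:
  assumes f: "additive_map LM_NP.T LM_NP.T f" and l: "l \<in> carrier L" and y: "y \<in> carrier triple.MN_L.T"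
    and eq: "\<And>m n p. \<lbrakk>m \<in> carrier M; n \<in> carrier N; p \<in> carrier P\<rbrakk> \<Longrightarrow> f (quad l m n p) = quad l' m n p"
  shows "f (tensor_lift LM_NP.T (\<lambda>x p. tensor_lift LM_NP.T (\<lambda>m n. quad l m n p) x) y) =
    tensor_lift LM_NP.T (\<lambda>x p. tensor_lift LM_NP.T (\<lambda>m n. quad l' m n p) x) y"
proof (rule triple.MN_L.tensor_lift_natural[OF LM_NP_group LM_NP_group f balanced_quad_right[OF l] y])
  fix x p assume "x \<in> carrier MN" "p \<in> carrier P"
  then show "f (tensor_lift LM_NP.T (\<lambda>m n. quad l m n p) x) = tensor_lift LM_NP.T (\<lambda>m n. quad l' m n p) x"
    by (intro triple.MN.tensor_lift_natural[OF LM_NP_group LM_NP_group f balanced_quad_mn] l eq)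
qed (use l in auto)

lemma tensor_regroup_hom:
  "bimodule_hom K W V L_MN_P.M_NL.T LM_NP.T (tensor_regroup K Q S U L M N P)"
  unfolding tensor_regroup_def Let_def
proof (rule L_MN_P.M_NL.tensor_lift_bimodule_hom[OF LM_NP.tensor_bimodule balanced_quad])
  fix k l y assume *: "k \<in> carrier K" "l \<in> carrier L" "y \<in> carrier triple.MN_L.T"
  have "additive_map LM_NP.T LM_NP.T (\<lambda>z. k \<odot>\<^bsub>LM_NP.T\<^esub> z)"
    by (rule additive_mapI) (use * in \<open>auto simp: LM_NP.tensor_closed LM_NP.tensor_add_simps\<close>)
  then show "tensor_lift LM_NP.T (\<lambda>x p. tensor_lift LM_NP.T (\<lambda>m n. quad (k \<odot>\<^bsub>L\<^esub> l) m n p) x) y =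
    k \<odot>\<^bsub>LM_NP.T\<^esub> tensor_lift LM_NP.T (\<lambda>x p. tensor_lift LM_NP.T (\<lambda>m n. quad l m n p) x) y"
    by (rule quad_lift_natural[symmetric])
      (use * in \<open>auto simp: LM_NP.tensor_pure_simps LM.tensor_pure_simps\<close>)
next
  fix w l y assume *: "w \<in> carrier W" "l \<in> carrier L" "y \<in> carrier triple.MN_L.T"
  have "additive_map LM_NP.T LM_NP.T (lact LM_NP.T w)"
    by (rule additive_mapI) (use * in \<open>auto simp: LM_NP.tensor_closed LM_NP.tensor_add_simps\<close>)
  then show "tensor_lift LM_NP.T (\<lambda>x p. tensor_lift LM_NP.T (\<lambda>m n. quad (lact L w l) m n p) x) y =
    lact LM_NP.T w (tensor_lift LM_NP.T (\<lambda>x p. tensor_lift LM_NP.T (\<lambda>m n. quad l m n p) x) y)"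
    by (rule quad_lift_natural[symmetric])
      (use * in \<open>auto simp: LM_NP.tensor_pure_simps LM.tensor_pure_simps\<close>)
next
  interpret Z: bimodule K W V LM_NP.T by (rule LM_NP.tensor_bimodule)
  fix v l y assume *: "v \<in> carrier V" "l \<in> carrier L" "y \<in> carrier triple.MN_L.T"
  have "additive_map LM_NP.T LM_NP.T (\<lambda>z. ract LM_NP.T z v)"
    by (rule additive_mapI) (use * in \<open>auto simp: LM_NP.tensor_closed LM_NP.tensor_add_simps\<close>)
  then have "ract LM_NP.T (tensor_lift LM_NP.T (\<lambda>m n. quad l m n p) x) v =
      tensor_lift LM_NP.T (\<lambda>m n. quad l m n (ract P p v)) x" if "x \<in> carrier MN" "p \<in> carrier P" for x p
    by (rule triple.MN.tensor_lift_natural[OF LM_NP_group LM_NP_group _ balanced_quad_mn])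
      (use * that in \<open>auto simp: LM_NP.tensor_pure_simps triple.NL.tensor_pure_simps\<close>)
  then show "tensor_lift LM_NP.T (\<lambda>x p. tensor_lift LM_NP.T (\<lambda>m n. quad l m n p) x) (ract triple.MN_L.T y v) =
    ract LM_NP.T (tensor_lift LM_NP.T (\<lambda>x p. tensor_lift LM_NP.T (\<lambda>m n. quad l m n p) x) y) v"
    by (intro triple.MN_L.tensor_lift_ract[OF Z.right_module_axioms balanced_quad_right]) (use * in auto)
qed

end


section \<open>Multiplication maps and firmness\<close>

lemma with_actions_simps [simp]:
  "carrier (with_actions M l r) = carrier M"
  "monoid.mult (with_actions M l r) = monoid.mult M"
  "one (with_actions M l r) = one M"
  "ring.zero (with_actions M l r) = ring.zero M"
  "ring.add (with_actions M l r) = ring.add M"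
  "smult (with_actions M l r) = smult M"
  "lact (with_actions M l r) = l"
  "ract (with_actions M l r) = r"
  by (simp_all add: with_actions_def)

lemma regular_simps [simp]:
  "carrier (regular R) = carrier R"
  "ring.zero (regular R) = ring.zero R"
  "ring.add (regular R) = ring.add R"
  "smult (regular R) = smult R"
  "lact (regular R) = monoid.mult R"
  "ract (regular R) = monoid.mult R"
  by (simp_all add: regular_def)

lemma abelian_group_transfer:
  assumes "abelian_group G" "carrier H = carrier G" "ring.add H = ring.add G" "ring.zero H = ring.zero G"
  shows "abelian_group H"
proof -
  interpret abelian_group G by fact
  show ?thesis
    by (rule abelian_groupI) (auto simp: assms a_ac intro: bexI[of _ "\<ominus>\<^bsub>G\<^esub> x" for x] l_neg)
qed

lemma module_transfer:
  assumes "module K G" "carrier H = carrier G" "ring.add H = ring.add G" "ring.zero H = ring.zero G"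
    "smult H = smult G"
  shows "module K H"
proof -
  interpret module K G by fact
  show ?thesis
  proof (rule moduleI)
    show "cring K" by (rule R.is_cring)
    show "abelian_group H" by (rule abelian_group_transfer[OF abelian_group_axioms assms(2-4)])
  qed (auto simp: assms smult_l_distr smult_r_distr smult_assoc1)
qed

lemma with_actions_module: "module K M \<Longrightarrow> module K (with_actions M l r)"
  by (rule module_transfer) auto

lemma regular_bimodule:
  fixes K :: "'k ring" and R :: "('k, 'r) module"
  assumes "k_algebra K R"
  shows "bimodule K R R (regular R)"
proof -
  interpret k_algebra K R by fact
  have "module K (regular R)"
    unfolding regular_def by (rule with_actions_module[OF module_axioms])
  then show ?thesis
    by (intro bimodule.intro left_module.intro right_module.intro bimodule_axioms.intro
        left_module_axioms.intro right_module_axioms.intro k_algebra_axioms)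
      (auto simp: mult_closed mult_assoc mult_l_distr mult_r_distr mult_smult_l mult_smult_r)
qed

context bimodule
begin

lemma left_mult_pair: "bimodule_pair K R R S (regular R) M"
  by (rule bimodule_pairI[OF regular_bimodule[OF R.k_algebra_axioms] bimodule_axioms])

lemma right_mult_pair: "bimodule_pair K R S S M (regular S)"
  by (rule bimodule_pairI[OF bimodule_axioms regular_bimodule[OF S.k_algebra_axioms]])

lemma balanced_lact: "balanced_map K R (regular R) M M (lact M)"
  by (rule balanced_mapI)
    (auto simp: lact_closed lact_add_l lact_add_r lact_assoc lact_smult_l lact_smult_r)

lemma balanced_ract: "balanced_map K S M (regular S) M (ract M)"
  by (rule balanced_mapI)
    (auto simp: ract_closed ract_add_l ract_add_r ract_assoc ract_smult_l ract_smult_r)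

lemma left_mult_map_pure:
  "\<lbrakk>r \<in> carrier R; m \<in> carrier M\<rbrakk> \<Longrightarrow> left_mult_map M (pure_tensor K R (regular R) M r m) = lact M r m"
proof -
  interpret X: bimodule_pair K R R S "regular R" M by (rule left_mult_pair)
  show "\<lbrakk>r \<in> carrier R; m \<in> carrier M\<rbrakk> \<Longrightarrow> left_mult_map M (X.pt r m) = lact M r m"
    unfolding left_mult_map_def
    by (simp add: X.tensor_lift_pure[OF M.abelian_group_axioms balanced_lact])
qed

lemma right_mult_map_pure:
  "\<lbrakk>m \<in> carrier M; s \<in> carrier S\<rbrakk> \<Longrightarrow> right_mult_map M (pure_tensor K S M (regular S) m s) = ract M m s"
proof -
  interpret X: bimodule_pair K R S S M "regular S" by (rule right_mult_pair)
  show "\<lbrakk>m \<in> carrier M; s \<in> carrier S\<rbrakk> \<Longrightarrow> right_mult_map M (X.pt m s) = ract M m s"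
    unfolding right_mult_map_def
    by (simp add: X.tensor_lift_pure[OF M.abelian_group_axioms balanced_ract])
qed

lemma left_mult_map_hom: "bimodule_hom K R S (tensor K R (regular R) M) M (left_mult_map M)"
  unfolding left_mult_map_def
  by (rule bimodule_pair.tensor_lift_bimodule_hom[OF left_mult_pair bimodule_axioms balanced_lact])
    (auto simp: lact_smult_l lact_assoc lact_ract)

lemma right_mult_map_hom: "bimodule_hom K R S (tensor K S M (regular S)) M (right_mult_map M)"
  unfolding right_mult_map_def
  by (rule bimodule_pair.tensor_lift_bimodule_hom[OF right_mult_pair bimodule_axioms balanced_ract])
    (auto simp: ract_smult_l ract_assoc lact_ract)

end

locale firm_bimodule = bimodule K R S M + firm_left_module K R M
  for K :: "'k ring" and R :: "('k, 'r) module" and S :: "('k, 's) module"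
    and M :: "('k, 'r, 'm, 's) bimodule"
begin

text \<open>The tensor r \<otimes> m is a preimage of r m under the multiplication map, and
  injectivity makes it the only one.\<close>

lemma firm_d_lact:
  assumes "r \<in> carrier R" "m \<in> carrier M"
  shows "firm_d K R M (lact M r m) = pure_tensor K R (regular R) M r m"
proof -
  interpret X: bimodule_pair K R R S "regular R" M by (rule left_mult_pair)
  show ?thesis
    unfolding firm_d_def
    by (rule the_inv_into_f_eq[OF bij_betw_imp_inj_on[OF left_mult_bij]])
      (use assms in \<open>auto simp: left_mult_map_pure\<close>)
qed

lemma firm_d_hom: "bimodule_hom K R S M (tensor K R (regular R) M) (firm_d K R M)"
  unfolding firm_d_def
  by (rule bimodule_hom_the_inv_into[OF left_mult_map_hom left_mult_bij
        bimodule_pair.tensor_bimodule[OF left_mult_pair]])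

text \<open>Induction through the surjective multiplication map: an element is the image of a
  tensor, and induction on that tensor writes it as a sum of products r m. This takes the place of m
  = 1 m.\<close>

lemma firm_induct [consumes 1, case_names lact add]:
  assumes "x \<in> carrier M"
    and lact: "\<And>r m. \<lbrakk>r \<in> carrier R; m \<in> carrier M\<rbrakk> \<Longrightarrow> Q (lact M r m)"
    and add: "\<And>x y. \<lbrakk>x \<in> carrier M; y \<in> carrier M; Q x; Q y\<rbrakk> \<Longrightarrow> Q (x \<oplus>\<^bsub>M\<^esub> y)"
  shows "Q x"
proof -
  interpret X: bimodule_pair K R R S "regular R" M by (rule left_mult_pair)
  note h = bimodule_homD[OF left_mult_map_hom]
  obtain t where t: "t \<in> carrier X.T" "x = left_mult_map M t"
    using assms(1) bij_betw_imp_surj_on[OF left_mult_bij] by auto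
  from t(1) have "Q (left_mult_map M t)"
    by (induction rule: X.tensor_induct) (auto simp: left_mult_map_pure h lact intro!: add)
  with t show ?thesis by simp
qed

end

lemma (in firm_ring) regular_firm: "firm_bimodule K R R (regular R)"
proof -
  interpret X: bimodule K R R "regular R" by (rule regular_bimodule[OF k_algebra_axioms])
  show ?thesis
    by (intro firm_bimodule.intro firm_left_module.intro firm_left_module_axioms.intro
        X.bimodule_axioms X.left_module_axioms) (use mult_bij in simp)
qed

section \<open>Coactions on firm modules\<close>

text \<open>Used with \<open>x\<close> = \<iota>(s): a factor acting on \<iota>(s) from the left
  becomes a factor on its first entry under the sum.\<close>

lemma (in bimodule_pair) tensor_lift_lact_arg:
  assumes P: "abelian_group P" and b: "balanced_map K S M N P b" and q: "q \<in> carrier Q" and x: "x \<in> carrier T"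
  shows "tensor_lift P b (lact T q x) = tensor_lift P (\<lambda>m n. b (lact M q m) n) x"
  unfolding tensor_lact_lift
  by (rule tensor_lift_natural[OF tensor_abelian_group P additive_tensor_lift[OF P b] balanced_lact[OF q] x])
    (simp add: tensor_lift_pure[OF P b] M.lact_closed q)

text \<open>The setting after \<open>B\<close> and the ring structure on \<Sigma> \<otimes>
  \<Sigma>' have been eliminated. Here \<open>S\<close> and \<open>S'\<close> carry their R-actions
  and \<mu> lives on the tensor product over \<open>R\<close>; \<open>lact_eq\<close> and
  \<open>ract_eq\<close> are what remains of the definition of these actions by \<iota> and \<mu>,
  and they yield the counit laws.\<close>

locale comatrix = A: unital_k_algebra K A + R: firm_ring K R + S: firm_bimodule K R A S
  + S': bimodule K A R S'
  for K :: "'k ring" and R :: "('k, 'r) module" and A :: "('k, 'a) module"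
    and S :: "('k, 'r, 's, 'a) bimodule" and S' :: "('k, 'a, 't, 'r) bimodule" +
  fixes \<mu> :: "('t, 's) tensor \<Rightarrow> 'a" and \<iota> :: "'r \<Rightarrow> ('s, 't) tensor"
  assumes right_unital_S: "right_unital A S" and left_unital_S': "left_unital A S'"
    and \<mu>_hom: "bimodule_hom K A A (tensor K R S' S) (regular A) \<mu>"
    and \<iota>_hom: "bimodule_hom K R R (regular R) (tensor K A S S') \<iota>"
    and lact_eq: "\<lbrakk>r \<in> carrier R; u \<in> carrier S\<rbrakk> \<Longrightarrow>
      lact S r u = tensor_lift S (\<lambda>e \<phi>. ract S e (\<mu> (pure_tensor K R S' S \<phi> u))) (\<iota> r)"
    and ract_eq: "\<lbrakk>\<phi> \<in> carrier S'; r \<in> carrier R\<rbrakk> \<Longrightarrow>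
      ract S' \<phi> r = tensor_lift S' (\<lambda>e \<psi>. lact S' (\<mu> (pure_tensor K R S' S \<phi> e)) \<psi>) (\<iota> r)"

definition firm_coaction ::
  "'k ring \<Rightarrow> ('k, 'r) module \<Rightarrow> ('k, 'a) module \<Rightarrow> ('k, 'r, 's, 'a) bimodule \<Rightarrow>
   ('k, 'a, 't, 'r) bimodule \<Rightarrow> ('r \<Rightarrow> ('s, 't) tensor) \<Rightarrow> ('k, 'r, 'p, 'q) bimodule \<Rightarrow>
   ('t, 'p) tensor \<Rightarrow> (('t, 's) tensor, ('t, 'p) tensor) tensor"
  where "firm_coaction K R A S S' \<iota> P =
    tensor_regroup K R A R S' S S' P
    \<circ> tensor_map K R S' (tensor K R (tensor K A S S') P)
        id (tensor_map K R (tensor K A S S') P \<iota> id)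
    \<circ> tensor_map K R S' (tensor K R (regular R) P) id (firm_d K R P)"

lemma comatrix_comult_firm_coaction: "comatrix_comult K R A S S' \<iota> = firm_coaction K R A S S' \<iota> S"
  by (simp add: comatrix_comult_def firm_coaction_def)

lemma Sigma_dag_coaction_firm_coaction:
  "Sigma_dag_coaction K R A S S' \<iota> = firm_coaction K R A S S' \<iota> (regular R)"
  by (simp add: Sigma_dag_coaction_def firm_coaction_def)

text \<open>\<open>U\<close> is the ring acting on the right of \<open>P\<close>: it is
  \<open>A\<close> for \<open>P = S\<close> and \<open>R\<close> for the regular bimodule.\<close>

locale comatrix_firm = comatrix K R A S S' \<mu> \<iota> + P: firm_bimodule K R U P
  for K :: "'k ring" and R :: "('k, 'r) module" and A :: "('k, 'a) module" and U :: "('k, 'u) module"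
    and S :: "('k, 'r, 's, 'a) bimodule" and S' :: "('k, 'a, 't, 'r) bimodule"
    and \<mu> \<iota> and P :: "('k, 'r, 'p, 'u) bimodule"
begin

sublocale q: bimodule_quadruple K A R A R U S' S S' P
  by (intro bimodule_quadruple.intro bimodule_triple.intro bimodule_pairI
      S'.bimodule_axioms S.bimodule_axioms P.bimodule_axioms)

abbreviation "C \<equiv> tensor K R S' S"
abbreviation "E \<equiv> tensor K A S S'"
abbreviation "N \<equiv> tensor K R S' P"
abbreviation "Z \<equiv> tensor K A (tensor K R S' S) (tensor K R S' P)"
abbreviation "\<Lambda> \<equiv> firm_coaction K R A S S' \<iota> P"

lemma pair_S'P: "bimodule_pair K A R U S' P"
  by (rule bimodule_pairI[OF S'.bimodule_axioms P.bimodule_axioms])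

lemma pair_S'RP: "bimodule_pair K A R U S' (tensor K R (regular R) P)"
  by (rule bimodule_pairI[OF S'.bimodule_axioms bimodule_pair.tensor_bimodule[OF P.left_mult_pair]])

lemma pair_S'EP: "bimodule_pair K A R U S' (tensor K R E P)"
  by (rule q.L_MN_P.M_NL.bimodule_pair_axioms)

lemma pair_EP: "bimodule_pair K R R U E P"
  by (rule q.triple.MN_L.bimodule_pair_axioms)

lemma \<iota>_closed: "r \<in> carrier R \<Longrightarrow> \<iota> r \<in> carrier E"
  using bimodule_homD(1)[OF \<iota>_hom] by simp

lemma \<iota>P_hom: "bimodule_hom K R U (tensor K R (regular R) P) (tensor K R E P) (tensor_map K R E P \<iota> id)"
  by (rule tensor_map_hom[OF P.left_mult_pair pair_EP \<iota>_hom bimodule_hom_id])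

lemma \<Lambda>_hom: "bimodule_hom K A U N Z \<Lambda>"
  unfolding firm_coaction_def
  by (intro bimodule_hom_comp[OF _ tensor_map_hom[OF pair_S'P pair_S'RP bimodule_hom_id P.firm_d_hom]]
      bimodule_hom_comp[OF q.tensor_regroup_hom
        tensor_map_hom[OF pair_S'RP pair_S'EP bimodule_hom_id \<iota>P_hom]])

text \<open>The inverse of the multiplication map drops out because d(r p) = r \<otimes> p. What
  remains is a sum over \<iota>(r), which cannot be split further as \<iota>(r) need not be
  pure.\<close>

lemma \<Lambda>_lact:
  assumes "\<phi> \<in> carrier S'" "r \<in> carrier R" "p \<in> carrier P"
  shows "\<Lambda> (q.triple.NL.pt \<phi> (lact P r p)) = tensor_lift Z (\<lambda>e \<psi>. q.quad \<phi> e \<psi> p) (\<iota> r)"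
proof -
  have rp: "pure_tensor K R (regular R) P r p \<in> carrier (tensor K R (regular R) P)"
    using balanced_pair.pure_closed[OF balanced_pairI] P.firm_d_lact assms
      bimodule_homD(1)[OF P.firm_d_hom] P.lact_closed by metis
  have "tensor_map K R S' (tensor K R (regular R) P) id (firm_d K R P) (q.triple.NL.pt \<phi> (lact P r p)) =
      pure_tensor K R S' (tensor K R (regular R) P) \<phi> (pure_tensor K R (regular R) P r p)"
    using assms by (simp add: tensor_map_pure[OF pair_S'P pair_S'RP bimodule_hom_id P.firm_d_hom]
        P.lact_closed P.firm_d_lact)
  moreover have "tensor_map K R S' (tensor K R E P) id (tensor_map K R E P \<iota> id)
      (pure_tensor K R S' (tensor K R (regular R) P) \<phi> (pure_tensor K R (regular R) P r p)) =
      q.L_MN_P.M_NL.pt \<phi> (q.triple.MN_L.pt (\<iota> r) p)"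
    using assms rp by (simp add: tensor_map_pure[OF pair_S'RP pair_S'EP bimodule_hom_id \<iota>P_hom]
        tensor_map_pure[OF P.left_mult_pair pair_EP \<iota>_hom bimodule_hom_id])
  ultimately show ?thesis
    using assms by (simp add: firm_coaction_def q.tensor_regroup_left \<iota>_closed)
qed

text \<open>As \<open>R\<close> acts on \<open>P\<close> with \<open>R P = P\<close>, two additive maps agree once they agree on all \<open>\<phi> \<otimes> r p\<close>.\<close>

lemma N_ext:
  assumes f: "additive_map N V f" and g: "additive_map N V g" and x: "x \<in> carrier N"
    and eq: "\<And>\<phi> r p. \<lbrakk>\<phi> \<in> carrier S'; r \<in> carrier R; p \<in> carrier P\<rbrakk> \<Longrightarrow>
      f (q.triple.NL.pt \<phi> (lact P r p)) = g (q.triple.NL.pt \<phi> (lact P r p))"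
  shows "f x = g x"
proof (rule q.triple.NL.additive_tensor_ext[OF f g x])
  fix \<phi> p assume "\<phi> \<in> carrier S'" "p \<in> carrier P"
  from this(2,1) show "f (q.triple.NL.pt \<phi> p) = g (q.triple.NL.pt \<phi> p)"
    by (induction rule: P.firm_induct)
      (auto simp: eq q.triple.NL.pure_add_r additive_mapD[OF f] additive_mapD[OF g])
qed

lemma \<mu>_pure_closed: "\<lbrakk>\<phi> \<in> carrier S'; u \<in> carrier S\<rbrakk> \<Longrightarrow> \<mu> (q.LM.pt \<phi> u) \<in> carrier A"
  using bimodule_homD(1)[OF \<mu>_hom] by simp

text \<open>On \<phi> \<otimes> r p the composite is the sum over \<iota>(r) of \<mu>(\<phi>
  \<otimes> e)\<psi> \<otimes> p, that is \<phi> r \<otimes> p, and this is \<phi> \<otimes> r p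
  because the tensor product is taken over \<open>R\<close>.\<close>

lemma counit_left:
  assumes x: "x \<in> carrier N"
  shows "left_mult_map N (tensor_map K A (regular A) N \<mu> id (\<Lambda> x)) = x"
proof -
  note N = q.triple.NL.tensor_bimodule
  note N_group = bimodule_abelian_group[OF N]
  let ?F = "left_mult_map N \<circ> tensor_map K A (regular A) N \<mu> id"
  note pairCN = q.LM_NP.bimodule_pair_axioms
  have F: "bimodule_hom K A U Z N ?F"
    by (rule bimodule_hom_comp[OF bimodule.left_mult_map_hom[OF N]
          tensor_map_hom[OF pairCN bimodule.left_mult_pair[OF N] \<mu>_hom bimodule_hom_id]])
  have F_pure: "?F (q.LM_NP.pt c n) = lact N (\<mu> c) n" if "c \<in> carrier C" "n \<in> carrier N" for c n
    using that bimodule_homD(1)[OF \<mu>_hom]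
    by (simp add: tensor_map_pure[OF pairCN bimodule.left_mult_pair[OF N] \<mu>_hom bimodule_hom_id] bimodule.left_mult_map_pure[OF N])
  have "(?F \<circ> \<Lambda>) x = id x"
  proof (rule N_ext[OF _ _ x])
    show "additive_map N N (?F \<circ> \<Lambda>)" "additive_map N N id"
      by (rule bimodule_homD(6)[OF bimodule_hom_comp[OF F \<Lambda>_hom]])
        (rule bimodule_homD(6)[OF bimodule_hom_id])
  next
    fix \<phi> r p assume *: "\<phi> \<in> carrier S'" "r \<in> carrier R" "p \<in> carrier P"
    have bal: "balanced_map K A S S' S' (\<lambda>e \<psi>. lact S' (\<mu> (q.LM.pt \<phi> e)) \<psi>)"
      by (rule balanced_mapI)
        (use * in \<open>auto simp: \<mu>_pure_closed S'.lact_closed q.LM.pure_add_r bimodule_homD[OF \<mu>_hom]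
            S'.lact_add_l S'.lact_add_r S'.lact_smult_r S'.lact_smult_l S'.lact_assoc[symmetric]
            simp flip: q.LM.tensor_ract_pure q.LM.tensor_smult_pure q.LM.pure_smult_balanced\<close>)
    have "(?F \<circ> \<Lambda>) (q.triple.NL.pt \<phi> (lact P r p)) =
        ?F (tensor_lift Z (\<lambda>e \<psi>. q.quad \<phi> e \<psi> p) (\<iota> r))"
      using * by (simp add: \<Lambda>_lact)
    also have "\<dots> = tensor_lift N (\<lambda>e \<psi>. q.triple.NL.pt (lact S' (\<mu> (q.LM.pt \<phi> e)) \<psi>) p) (\<iota> r)"
    proof (rule q.triple.MN.tensor_lift_natural[OF q.LM_NP_group N_group bimodule_homD(6)[OF F]
          q.balanced_quad_mn \<iota>_closed])
      fix e \<psi> assume "e \<in> carrier S" "\<psi> \<in> carrier S'"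
      then show "?F (q.quad \<phi> e \<psi> p) = q.triple.NL.pt (lact S' (\<mu> (q.LM.pt \<phi> e)) \<psi>) p"
        using * by (simp only: F_pure q.LM.pure_closed q.triple.NL.pure_closed \<mu>_pure_closed
            q.triple.NL.tensor_lact_pure)
    qed (use * in auto)
    also have "\<dots> = q.triple.NL.pt (tensor_lift S' (\<lambda>e \<psi>. lact S' (\<mu> (q.LM.pt \<phi> e)) \<psi>) (\<iota> r)) p"
      by (rule q.triple.MN.tensor_lift_natural[symmetric, OF S'.M.abelian_group_axioms
            N_group _ bal \<iota>_closed])
        (use * in \<open>auto intro!: additive_mapI simp: q.triple.NL.pure_add_l\<close>)
    also have "\<dots> = id (q.triple.NL.pt \<phi> (lact P r p))"
      using * by (simp add: q.triple.NL.pure_balanced flip: ract_eq)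
    finally show "(?F \<circ> \<Lambda>) (q.triple.NL.pt \<phi> (lact P r p)) = id (q.triple.NL.pt \<phi> (lact P r p))" .
  qed
  then show ?thesis by simp
qed


text \<open>The two composites need different readings of the same element \<phi> \<otimes> r(s p).
  For \<open>?G\<close> it is \<phi> \<otimes> (r s)p: then \<iota>(r s) = r \<iota>(s) leaves
  \<phi> \<otimes> r e in the first factor, where the comultiplication of \<open>C\<close> can be
  evaluated. For \<open>?H\<close> it is r applied to s p: \<open>\<Lambda>\<close> splits off r and
  leaves \<psi> \<otimes> s p in the second factor, where \<open>\<Lambda>\<close> can be evaluated
  again.\<close>

lemma coassociative:
  assumes S_firm: "comatrix_firm K R A A S S' \<mu> \<iota> S" and x: "x \<in> carrier N"
  shows "tensor_assoc K A A C C N (tensor_map K A (tensor K A C C) N (firm_coaction K R A S S' \<iota> S) id (\<Lambda> x)) =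
    tensor_map K A C Z id \<Lambda> (\<Lambda> x)"
proof -
  interpret D: comatrix_firm K R A A S S' \<mu> \<iota> S by (rule S_firm)
  let ?CC = "tensor K A C C" and ?Z = "tensor K A C Z"
  note C = q.LM.tensor_bimodule and N = q.triple.NL.tensor_bimodule
  note CC_pair = bimodule_pairI[OF C C] and CN_pair = q.LM_NP.bimodule_pair_axioms
  interpret t: bimodule_triple K A A A U C C N
    by (rule bimodule_triple.intro[OF CC_pair CN_pair])
  note Z_group = q.LM_NP_group
  note Z'_group = t.M_NL.tensor_abelian_group
  let ?G = "tensor_assoc K A A C C N \<circ> tensor_map K A ?CC N D.\<Lambda> id"
  let ?H = "tensor_map K A C Z id \<Lambda>"
  have G: "bimodule_hom K A U Z ?Z ?G"
    by (rule bimodule_hom_comp[OF t.tensor_assoc_hom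
          tensor_map_hom[OF CN_pair t.MN_L.bimodule_pair_axioms D.\<Lambda>_hom bimodule_hom_id]])
  have H: "bimodule_hom K A U Z ?Z ?H"
    by (rule tensor_map_hom[OF CN_pair t.M_NL.bimodule_pair_axioms bimodule_hom_id \<Lambda>_hom])
  have "(?G \<circ> \<Lambda>) x = (?H \<circ> \<Lambda>) x"
  proof (rule q.triple.NL.additive_tensor_ext[OF _ _ x])
    show add: "additive_map N ?Z (?G \<circ> \<Lambda>)" "additive_map N ?Z (?H \<circ> \<Lambda>)"
      by (rule bimodule_homD(6)[OF bimodule_hom_comp[OF G \<Lambda>_hom]]
          bimodule_homD(6)[OF bimodule_hom_comp[OF H \<Lambda>_hom]])+
    fix \<phi> p assume \<phi>: "\<phi> \<in> carrier S'" and "p \<in> carrier P"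
    have base: "(?G \<circ> \<Lambda>) (q.triple.NL.pt \<phi> (lact P r (lact P s p))) =
        (?H \<circ> \<Lambda>) (q.triple.NL.pt \<phi> (lact P r (lact P s p)))"
      if *: "r \<in> carrier R" "s \<in> carrier R" "p \<in> carrier P" for r s p
    proof -
      \<comment> \<open>The summand common to both sides: its first two arguments run through
        \<iota>(r), the last two through \<iota>(s).\<close>
      let ?B = "\<lambda>e' \<psi>' e \<psi>. t.M_NL.pt (q.LM.pt \<phi> e') (q.LM_NP.pt (q.LM.pt \<psi>' e) (q.triple.NL.pt \<psi> p))"
      have \<iota>s: "\<iota> r \<in> carrier E" "\<iota> s \<in> carrier E"
        using * by (simp_all add: \<iota>_closed)
      have \<iota>_rs: "\<iota> (r \<otimes>\<^bsub>R\<^esub> s) = lact E r (\<iota> s)"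
        using bimodule_homD(4)[OF \<iota>_hom] * by simp
      have add_l: "additive_map (tensor K A C C) ?Z (\<lambda>z. tensor_assoc K A A C C N (t.MN_L.pt z n))"
        if "n \<in> carrier N" for n
        by (rule additive_map_comp[OF _ bimodule_homD(6)[OF t.tensor_assoc_hom]], rule additive_mapI)
          (use that in \<open>auto simp: t.MN_L.pure_add_l\<close>)
      have add_r: "additive_map Z ?Z (\<lambda>z. t.M_NL.pt c z)" if "c \<in> carrier C" for c
        by (rule additive_mapI) (use that in \<open>auto simp: t.M_NL.pure_add_r\<close>)
      have G_quad: "?G (q.quad \<phi> (lact S r e) \<psi> p) = tensor_lift ?Z (\<lambda>e' \<psi>'. ?B e' \<psi>' e \<psi>) (\<iota> r)"
        if e: "e \<in> carrier S" "\<psi> \<in> carrier S'" for e \<psi>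
      proof -
        have n: "q.triple.NL.pt \<psi> p \<in> carrier N"
          using e * by simp
        have "?G (q.quad \<phi> (lact S r e) \<psi> p) =
            tensor_assoc K A A C C N (t.MN_L.pt (D.\<Lambda> (q.LM.pt \<phi> (lact S r e))) (q.triple.NL.pt \<psi> p))"
          using e * \<phi> by (simp add: S.lact_closed
              tensor_map_pure[OF CN_pair t.MN_L.bimodule_pair_axioms D.\<Lambda>_hom bimodule_hom_id])
        also have "\<dots> = tensor_assoc K A A C C N (t.MN_L.pt
            (tensor_lift (tensor K A C C) (\<lambda>e' \<psi>'. D.q.quad \<phi> e' \<psi>' e) (\<iota> r)) (q.triple.NL.pt \<psi> p))"
          using e * \<phi> by (simp add: D.\<Lambda>_lact)
        also have "\<dots> = tensor_lift ?Z (\<lambda>e' \<psi>'. ?B e' \<psi>' e \<psi>) (\<iota> r)"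
          by (rule q.triple.MN.tensor_lift_natural[OF D.q.LM_NP_group Z'_group add_l[OF n]
                D.q.balanced_quad_mn \<iota>s(1)])
            (use e * \<phi> in \<open>auto simp: t.tensor_assoc_pure\<close>)
        finally show ?thesis .
      qed
      have H_quad: "?H (q.quad \<phi> e \<psi> (lact P s p)) = tensor_lift ?Z (?B e \<psi>) (\<iota> s)"
        if e: "e \<in> carrier S" "\<psi> \<in> carrier S'" for e \<psi>
      proof -
        have "?H (q.quad \<phi> e \<psi> (lact P s p)) =
            t.M_NL.pt (q.LM.pt \<phi> e) (\<Lambda> (q.triple.NL.pt \<psi> (lact P s p)))"
          using e * \<phi> by (simp add: P.lact_closed
              tensor_map_pure[OF CN_pair t.M_NL.bimodule_pair_axioms bimodule_hom_id \<Lambda>_hom])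
        also have "\<dots> = t.M_NL.pt (q.LM.pt \<phi> e) (tensor_lift Z (\<lambda>e' \<psi>'. q.quad \<psi> e' \<psi>' p) (\<iota> s))"
          using e * by (simp add: \<Lambda>_lact)
        also have "\<dots> = tensor_lift ?Z (?B e \<psi>) (\<iota> s)"
          by (rule q.triple.MN.tensor_lift_natural[OF Z_group Z'_group add_r q.balanced_quad_mn \<iota>s(2)])
            (use e * \<phi> in auto)
        finally show ?thesis .
      qed
      have E_pair: "balanced_pair K A S S'" by (rule q.triple.MN.balanced_pair_axioms)
      \<comment> \<open>The \<open>?G\<close> side ends with the sum over \<iota>(s) outermost, the
        \<open>?H\<close> side with that over \<iota>(r).\<close>
      have swap: "tensor_lift ?Z (\<lambda>e' \<psi>'. tensor_lift ?Z (?B e' \<psi>') (\<iota> s)) (\<iota> r) =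
          tensor_lift ?Z (\<lambda>e \<psi>. tensor_lift ?Z (\<lambda>e' \<psi>'. ?B e' \<psi>' e \<psi>) (\<iota> r)) (\<iota> s)"
      proof (rule tensor_lift_swap[OF E_pair E_pair Z'_group _ _ \<iota>s])
        fix e' \<psi>' assume e: "e' \<in> carrier S" "\<psi>' \<in> carrier S'"
        show "balanced_map K A S S' ?Z (?B e' \<psi>')"
          by (rule balanced_map_compose[OF E_pair q.balanced_quad_mn add_r]) (use e * \<phi> in auto)
      next
        fix e \<psi> assume e: "e \<in> carrier S" "\<psi> \<in> carrier S'"
        show "balanced_map K A S S' ?Z (\<lambda>e' \<psi>'. ?B e' \<psi>' e \<psi>)"
          by (rule balanced_map_cong[OF E_pair
                balanced_map_compose[OF E_pair D.q.balanced_quad_mn[of \<phi> e]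
                  add_l[of "q.triple.NL.pt \<psi> p"]]])
            (use e * \<phi> in \<open>auto simp: t.tensor_assoc_pure\<close>)
      qed
      have lift_b: "balanced_map K A S S' Z (\<lambda>e \<psi>. q.quad \<phi> e \<psi> p)"
        by (rule q.balanced_quad_mn) (use * \<phi> in auto)
      \<comment> \<open>Inserting r before e keeps the map balanced over \<open>A\<close> because
        the left R-action on \<open>S\<close> commutes with the right A-action.\<close>
      have lift_b': "balanced_map K A S S' Z (\<lambda>e \<psi>. q.quad \<phi> (lact S r e) \<psi> p)"
        by (rule balanced_mapI)
          (use * in \<open>auto simp: S.lact_closed S.lact_add_r S.lact_smult_r balanced_mapD[OF lift_b]
            simp flip: S.lact_ract\<close>)
      have "(?G \<circ> \<Lambda>) (q.triple.NL.pt \<phi> (lact P r (lact P s p))) =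
          ?G (\<Lambda> (q.triple.NL.pt \<phi> (lact P (r \<otimes>\<^bsub>R\<^esub> s) p)))"
        using * by (simp add: P.lact_assoc)
      also have "\<dots> = ?G (tensor_lift Z (\<lambda>e \<psi>. q.quad \<phi> (lact S r e) \<psi> p) (\<iota> s))"
        using * \<phi> \<iota>s by (simp add: \<Lambda>_lact R.mult_closed \<iota>_rs
            q.triple.MN.tensor_lift_lact_arg[OF Z_group lift_b])
      also have "\<dots> = tensor_lift ?Z (\<lambda>e \<psi>. tensor_lift ?Z (\<lambda>e' \<psi>'. ?B e' \<psi>' e \<psi>) (\<iota> r)) (\<iota> s)"
        by (rule q.triple.MN.tensor_lift_natural[OF Z_group Z'_group bimodule_homD(6)[OF G] lift_b' \<iota>s(2) G_quad])
      also have "\<dots> = tensor_lift ?Z (\<lambda>e \<psi>. tensor_lift ?Z (?B e \<psi>) (\<iota> s)) (\<iota> r)"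
        by (rule swap[symmetric])
      also have "\<dots> = ?H (tensor_lift Z (\<lambda>e \<psi>. q.quad \<phi> e \<psi> (lact P s p)) (\<iota> r))"
        by (rule q.triple.MN.tensor_lift_natural[symmetric, OF Z_group Z'_group bimodule_homD(6)[OF H]
              q.balanced_quad_mn \<iota>s(1) H_quad])
          (use * \<phi> in \<open>auto simp: P.lact_closed\<close>)
      also have "\<dots> = (?H \<circ> \<Lambda>) (q.triple.NL.pt \<phi> (lact P r (lact P s p)))"
        using * \<phi> by (simp add: \<Lambda>_lact P.lact_closed)
      finally show ?thesis .
    qed
    note simps = q.triple.NL.pure_add_r additive_mapD[OF add(1)] additive_mapD[OF add(2)] \<phi>
      P.lact_add_r P.lact_closed q.triple.NL.pure_closed P.M.add.m_closed
    \<comment> \<open>Two rounds of induction remove the factors: here s p is replaced by an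
      arbitrary element of \<open>P\<close>, and afterwards r p is.\<close>
    have step: "(?G \<circ> \<Lambda>) (q.triple.NL.pt \<phi> (lact P r p)) = (?H \<circ> \<Lambda>) (q.triple.NL.pt \<phi> (lact P r p))"
      if "r \<in> carrier R" "p \<in> carrier P" for r p
      using that(2,1) by (induction rule: P.firm_induct) (simp_all only: base simps)
    from \<open>p \<in> carrier P\<close>
    show "(?G \<circ> \<Lambda>) (q.triple.NL.pt \<phi> p) = (?H \<circ> \<Lambda>) (q.triple.NL.pt \<phi> p)"
      by (induction rule: P.firm_induct) (simp_all only: step simps)
  qed
  then show ?thesis by simp
qed

end

section \<open>The comatrix coring and its bicomodules\<close>

context comatrix
begin

lemma comatrix_firm_S: "comatrix_firm K R A A S S' \<mu> \<iota> S"
  by (rule comatrix_firm.intro[OF comatrix_axioms S.firm_bimodule_axioms])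

lemma comatrix_firm_R: "comatrix_firm K R A R S S' \<mu> \<iota> (regular R)"
  by (rule comatrix_firm.intro[OF comatrix_axioms R.regular_firm])

interpretation D: comatrix_firm K R A A S S' \<mu> \<iota> S
  by (rule comatrix_firm_S)

abbreviation "C \<equiv> tensor K R S' S"
abbreviation "CC \<equiv> tensor K A (tensor K R S' S) (tensor K R S' S)"
abbreviation "SC \<equiv> tensor K A S (tensor K R S' S)"
abbreviation "\<Delta> \<equiv> firm_coaction K R A S S' \<iota> S"
abbreviation "\<rho> \<equiv> Sigma_coaction K R A S S' \<iota>"

lemma C_bimodule: "bimodule K A A C"
  by (rule D.q.LM.tensor_bimodule)

lemma C_unital: "left_unital A C" "right_unital A C"
  by (rule D.q.LM.tensor_left_unital[OF left_unital_S' A.A.one_closed]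
      D.q.LM.tensor_right_unital[OF right_unital_S A.A.one_closed])+

lemma CC_pair: "bimodule_pair K A A A C C"
  by (rule bimodule_pairI[OF C_bimodule C_bimodule])

lemma SC_pair: "bimodule_pair K R A A S C"
  by (rule bimodule_pairI[OF S.bimodule_axioms C_bimodule])

lemma balanced_e\<mu>:
  assumes "u \<in> carrier S"
  shows "balanced_map K A S S' S (\<lambda>e \<psi>. ract S e (\<mu> (D.q.LM.pt \<psi> u)))"
  by (rule balanced_mapI)
    (use assms in \<open>auto simp: D.\<mu>_pure_closed S.ract_closed D.q.LM.pure_add_l bimodule_homD[OF \<mu>_hom]
      S.ract_add_l S.ract_add_r S.ract_smult_l S.ract_smult_r S.ract_assoc[symmetric]
      simp flip: D.q.LM.tensor_lact_pure D.q.LM.tensor_smult_pure\<close>)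

text \<open>Unlike \<open>counit_left\<close> this concerns \<open>P = S\<close> only, since \<mu>
  is applied to the right-hand factor \<psi> \<otimes> u. The sum over \<iota>(r) of \<phi>
  \<otimes> e \<mu>(\<psi> \<otimes> u) is \<phi> \<otimes> r u by the formula for the left action
  on \<open>S\<close>.\<close>

lemma counit_right:
  assumes c: "c \<in> carrier C"
  shows "right_mult_map C (tensor_map K A C (regular A) id \<mu> (\<Delta> c)) = c"
proof -
  note pair = bimodule.right_mult_pair[OF C_bimodule]
  let ?F = "right_mult_map C \<circ> tensor_map K A C (regular A) id \<mu>"
  have F: "bimodule_hom K A A CC C ?F"
    by (rule bimodule_hom_comp[OF bimodule.right_mult_map_hom[OF C_bimodule]
          tensor_map_hom[OF CC_pair pair bimodule_hom_id \<mu>_hom]])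
  have F_pure: "?F (D.q.LM_NP.pt c d) = ract C c (\<mu> d)" if "c \<in> carrier C" "d \<in> carrier C" for c d
    using that bimodule_homD(1)[OF \<mu>_hom]
    by (simp add: tensor_map_pure[OF CC_pair pair bimodule_hom_id \<mu>_hom]
        bimodule.right_mult_map_pure[OF C_bimodule])
  have "(?F \<circ> \<Delta>) c = id c"
  proof (rule D.N_ext[OF _ _ c])
    show "additive_map C C (?F \<circ> \<Delta>)" "additive_map C C id"
      by (rule bimodule_homD(6)[OF bimodule_hom_comp[OF F D.\<Lambda>_hom]])
        (rule bimodule_homD(6)[OF bimodule_hom_id])
  next
    fix \<phi> r u assume *: "\<phi> \<in> carrier S'" "r \<in> carrier R" "u \<in> carrier S"
    have "(?F \<circ> \<Delta>) (D.q.LM.pt \<phi> (lact S r u)) = ?F (tensor_lift CC (\<lambda>e \<psi>. D.q.quad \<phi> e \<psi> u) (\<iota> r))"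
      using * by (simp add: D.\<Lambda>_lact)
    also have "\<dots> = tensor_lift C (\<lambda>e \<psi>. D.q.LM.pt \<phi> (ract S e (\<mu> (D.q.LM.pt \<psi> u)))) (\<iota> r)"
    proof (rule D.q.triple.MN.tensor_lift_natural[OF D.q.LM_NP_group D.q.LM.tensor_abelian_group
          bimodule_homD(6)[OF F] D.q.balanced_quad_mn D.\<iota>_closed])
      fix e \<psi> assume "e \<in> carrier S" "\<psi> \<in> carrier S'"
      then show "?F (D.q.quad \<phi> e \<psi> u) = D.q.LM.pt \<phi> (ract S e (\<mu> (D.q.LM.pt \<psi> u)))"
        using * by (simp only: F_pure D.q.LM.pure_closed D.\<mu>_pure_closed D.q.LM.tensor_ract_pure)
    qed (use * in auto)
    also have "\<dots> = D.q.LM.pt \<phi> (tensor_lift S (\<lambda>e \<psi>. ract S e (\<mu> (D.q.LM.pt \<psi> u))) (\<iota> r))"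
      by (rule D.q.triple.MN.tensor_lift_natural[symmetric, OF S.M.abelian_group_axioms
            D.q.LM.tensor_abelian_group _ balanced_e\<mu> D.\<iota>_closed])
        (use * in \<open>auto intro!: additive_mapI simp: D.q.LM.pure_add_r\<close>)
    also have "\<dots> = id (D.q.LM.pt \<phi> (lact S r u))"
      using * by (simp flip: lact_eq)
    finally show "(?F \<circ> \<Delta>) (D.q.LM.pt \<phi> (lact S r u)) = id (D.q.LM.pt \<phi> (lact S r u))" .
  qed
  then show ?thesis by simp
qed

lemma comatrix_coring: "coring K A C \<Delta> \<mu>"
proof (intro coring.intro coring_axioms.intro A.unital_k_algebra_axioms C_bimodule C_unital
    D.\<Lambda>_hom \<mu>_hom D.coassociative[OF comatrix_firm_S] D.counit_left counit_right)
qed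

lemma \<rho>_hom: "bimodule_hom K R A S SC \<rho>"
  unfolding Sigma_coaction_def
  by (intro bimodule_hom_comp[OF _ S.firm_d_hom]
      bimodule_hom_comp[OF D.q.triple.tensor_assoc_hom D.\<iota>P_hom])

lemma \<rho>_lact:
  assumes "r \<in> carrier R" "u \<in> carrier S"
  shows "\<rho> (lact S r u) = tensor_lift SC (\<lambda>e \<psi>. D.q.triple.M_NL.pt e (D.q.LM.pt \<psi> u)) (\<iota> r)"
  using assms
  by (simp add: Sigma_coaction_def S.firm_d_lact D.\<iota>_closed
      tensor_map_pure[OF S.left_mult_pair D.pair_EP \<iota>_hom bimodule_hom_id]
      tensor_assoc_def Let_def
      D.q.triple.MN_L.tensor_lift_pure[OF D.q.triple.M_NL.tensor_abelian_group D.q.triple.balanced_assoc])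

text \<open>The computation of \<open>counit_right\<close> without the factor \<phi>.\<close>

lemma \<rho>_counit:
  assumes u: "u \<in> carrier S"
  shows "right_mult_map S (tensor_map K A S (regular A) id \<mu> (\<rho> u)) = u"
proof -
  let ?F = "right_mult_map S \<circ> tensor_map K A S (regular A) id \<mu>"
  have F: "bimodule_hom K R A SC S ?F"
    by (rule bimodule_hom_comp[OF S.right_mult_map_hom
          tensor_map_hom[OF SC_pair S.right_mult_pair bimodule_hom_id \<mu>_hom]])
  have F_pure: "?F (D.q.triple.M_NL.pt e d) = ract S e (\<mu> d)" if "e \<in> carrier S" "d \<in> carrier C" for e d
    using that bimodule_homD(1)[OF \<mu>_hom]
    by (simp add: tensor_map_pure[OF SC_pair S.right_mult_pair bimodule_hom_id \<mu>_hom] S.right_mult_map_pure)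
  note F\<rho> = bimodule_homD[OF bimodule_hom_comp[OF F \<rho>_hom]]
  from u have "(?F \<circ> \<rho>) u = u"
  proof (induction rule: S.firm_induct)
    case (lact r u)
    have "(?F \<circ> \<rho>) (lact S r u) =
        ?F (tensor_lift SC (\<lambda>e \<psi>. D.q.triple.M_NL.pt e (D.q.LM.pt \<psi> u)) (\<iota> r))"
      using lact by (simp add: \<rho>_lact)
    also have "\<dots> = tensor_lift S (\<lambda>e \<psi>. ract S e (\<mu> (D.q.LM.pt \<psi> u))) (\<iota> r)"
    proof (rule D.q.triple.MN.tensor_lift_natural[OF D.q.triple.M_NL.tensor_abelian_group
          S.M.abelian_group_axioms bimodule_homD(6)[OF F] D.q.triple.balanced_assoc_left D.\<iota>_closed])
      fix e \<psi> assume "e \<in> carrier S" "\<psi> \<in> carrier S'"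
      then show "?F (D.q.triple.M_NL.pt e (D.q.LM.pt \<psi> u)) = ract S e (\<mu> (D.q.LM.pt \<psi> u))"
        using lact by (simp only: F_pure D.q.LM.pure_closed)
    qed (use lact in auto)
    also have "\<dots> = lact S r u"
      using lact by (simp flip: lact_eq)
    finally show ?case .
  next
    case (add x y)
    then show ?case by (simp only: F\<rho>)
  qed
  then show ?thesis by simp
qed

text \<open>The argument of \<open>coassociative\<close> without the factor \<phi>. It is not an
  instance of that lemma, because \<rho> is defined on \<open>S\<close> itself and
  \<open>firm_coaction\<close> on tensor products with \<open>S'\<close> on the left; so it is
  carried out again, on elements r(s v).\<close>

lemma \<rho>_coassociative:
  assumes u: "u \<in> carrier S"
  shows "tensor_assoc K A A S C C (tensor_map K A SC C \<rho> id (\<rho> u)) = tensor_map K A S CC id \<Delta> (\<rho> u)"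
proof -
  let ?Z = "tensor K A S CC"
  interpret t: bimodule_triple K R A A A S C C
    by (rule bimodule_triple.intro[OF SC_pair CC_pair])
  note SC_group = D.q.triple.M_NL.tensor_abelian_group and Z_group = t.M_NL.tensor_abelian_group
  let ?G = "tensor_assoc K A A S C C \<circ> tensor_map K A SC C \<rho> id"
  let ?H = "tensor_map K A S CC id \<Delta>"
  have G: "bimodule_hom K R A SC ?Z ?G"
    by (rule bimodule_hom_comp[OF t.tensor_assoc_hom
          tensor_map_hom[OF SC_pair t.MN_L.bimodule_pair_axioms \<rho>_hom bimodule_hom_id]])
  have H: "bimodule_hom K R A SC ?Z ?H"
    by (rule tensor_map_hom[OF SC_pair t.M_NL.bimodule_pair_axioms bimodule_hom_id D.\<Lambda>_hom])
  note G\<rho> = additive_mapD[OF bimodule_homD(6)[OF bimodule_hom_comp[OF G \<rho>_hom]]]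
  note H\<rho> = additive_mapD[OF bimodule_homD(6)[OF bimodule_hom_comp[OF H \<rho>_hom]]]
  have base: "(?G \<circ> \<rho>) (lact S r (lact S s v)) = (?H \<circ> \<rho>) (lact S r (lact S s v))"
    if *: "r \<in> carrier R" "s \<in> carrier R" "v \<in> carrier S" for r s v
  proof -
    let ?b = "\<lambda>v e \<psi>. D.q.triple.M_NL.pt e (D.q.LM.pt \<psi> v)"
    let ?B = "\<lambda>e' \<psi>' e \<psi>. t.M_NL.pt e' (D.q.LM_NP.pt (D.q.LM.pt \<psi>' e) (D.q.LM.pt \<psi> v))"
    have \<iota>s: "\<iota> r \<in> carrier D.E" "\<iota> s \<in> carrier D.E"
      using * by (simp_all add: D.\<iota>_closed)
    have \<iota>_rs: "\<iota> (r \<otimes>\<^bsub>R\<^esub> s) = lact D.E r (\<iota> s)"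
      using bimodule_homD(4)[OF \<iota>_hom] * by simp
    have add_l: "additive_map SC ?Z (\<lambda>z. tensor_assoc K A A S C C (t.MN_L.pt z c))"
      if "c \<in> carrier C" for c
      by (rule additive_map_comp[OF _ bimodule_homD(6)[OF t.tensor_assoc_hom]], rule additive_mapI)
        (use that in \<open>auto simp: t.MN_L.pure_add_l\<close>)
    have add_r: "additive_map CC ?Z (\<lambda>z. t.M_NL.pt e z)" if "e \<in> carrier S" for e
      by (rule additive_mapI) (use that in \<open>auto simp: t.M_NL.pure_add_r\<close>)
    have G_pure: "?G (?b v (lact S r e) \<psi>) = tensor_lift ?Z (\<lambda>e' \<psi>'. ?B e' \<psi>' e \<psi>) (\<iota> r)"
      if e: "e \<in> carrier S" "\<psi> \<in> carrier S'" for e \<psi>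
    proof -
      have c: "D.q.LM.pt \<psi> v \<in> carrier C"
        using e * by simp
      have "?G (?b v (lact S r e) \<psi>) =
          tensor_assoc K A A S C C (t.MN_L.pt (tensor_lift SC (?b e) (\<iota> r)) (D.q.LM.pt \<psi> v))"
        using e * by (simp add: S.lact_closed \<rho>_lact
            tensor_map_pure[OF SC_pair t.MN_L.bimodule_pair_axioms \<rho>_hom bimodule_hom_id])
      also have "\<dots> = tensor_lift ?Z (\<lambda>e' \<psi>'. ?B e' \<psi>' e \<psi>) (\<iota> r)"
        by (rule D.q.triple.MN.tensor_lift_natural[OF SC_group Z_group add_l[OF c]
              D.q.triple.balanced_assoc_left \<iota>s(1)])
          (use e * in \<open>auto simp: t.tensor_assoc_pure\<close>)
      finally show ?thesis .
    qed
    have H_pure: "?H (?b (lact S s v) e \<psi>) = tensor_lift ?Z (?B e \<psi>) (\<iota> s)"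
      if e: "e \<in> carrier S" "\<psi> \<in> carrier S'" for e \<psi>
    proof -
      have "?H (?b (lact S s v) e \<psi>) =
          t.M_NL.pt e (tensor_lift CC (\<lambda>e' \<psi>'. D.q.quad \<psi> e' \<psi>' v) (\<iota> s))"
        using e * by (simp add: S.lact_closed D.\<Lambda>_lact
            tensor_map_pure[OF SC_pair t.M_NL.bimodule_pair_axioms bimodule_hom_id D.\<Lambda>_hom])
      also have "\<dots> = tensor_lift ?Z (?B e \<psi>) (\<iota> s)"
        by (rule D.q.triple.MN.tensor_lift_natural[OF D.q.LM_NP_group Z_group add_r
              D.q.balanced_quad_mn \<iota>s(2)])
          (use e * in auto)
      finally show ?thesis .
    qed
    have E_pair: "balanced_pair K A S S'" by (rule D.q.triple.MN.balanced_pair_axioms)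
    have swap: "tensor_lift ?Z (\<lambda>e' \<psi>'. tensor_lift ?Z (?B e' \<psi>') (\<iota> s)) (\<iota> r) =
        tensor_lift ?Z (\<lambda>e \<psi>. tensor_lift ?Z (\<lambda>e' \<psi>'. ?B e' \<psi>' e \<psi>) (\<iota> r)) (\<iota> s)"
    proof (rule tensor_lift_swap[OF E_pair E_pair Z_group _ _ \<iota>s])
      fix e' \<psi>' assume e: "e' \<in> carrier S" "\<psi>' \<in> carrier S'"
      show "balanced_map K A S S' ?Z (?B e' \<psi>')"
        by (rule balanced_map_compose[OF E_pair D.q.balanced_quad_mn add_r]) (use e * in auto)
    next
      fix e \<psi> assume e: "e \<in> carrier S" "\<psi> \<in> carrier S'"
      show "balanced_map K A S S' ?Z (\<lambda>e' \<psi>'. ?B e' \<psi>' e \<psi>)"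
        by (rule balanced_map_cong[OF E_pair
              balanced_map_compose[OF E_pair D.q.triple.balanced_assoc_left[of e]
                add_l[of "D.q.LM.pt \<psi> v"]]])
          (use e * in \<open>auto simp: t.tensor_assoc_pure\<close>)
    qed
    have b: "balanced_map K A S S' SC (?b v)"
      by (rule D.q.triple.balanced_assoc_left) (use * in auto)
    have b': "balanced_map K A S S' SC (\<lambda>e \<psi>. ?b v (lact S r e) \<psi>)"
      by (rule balanced_mapI)
        (use * in \<open>auto simp: S.lact_closed S.lact_add_r S.lact_smult_r balanced_mapD[OF b]
          simp flip: S.lact_ract\<close>)
    have "(?G \<circ> \<rho>) (lact S r (lact S s v)) = ?G (\<rho> (lact S (r \<otimes>\<^bsub>R\<^esub> s) v))"
      using * by (simp add: S.lact_assoc)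
    also have "\<dots> = ?G (tensor_lift SC (\<lambda>e \<psi>. ?b v (lact S r e) \<psi>) (\<iota> s))"
      using * \<iota>s by (simp add: \<rho>_lact R.mult_closed \<iota>_rs
          D.q.triple.MN.tensor_lift_lact_arg[OF SC_group b])
    also have "\<dots> = tensor_lift ?Z (\<lambda>e \<psi>. tensor_lift ?Z (\<lambda>e' \<psi>'. ?B e' \<psi>' e \<psi>) (\<iota> r)) (\<iota> s)"
      by (rule D.q.triple.MN.tensor_lift_natural[OF SC_group Z_group bimodule_homD(6)[OF G] b' \<iota>s(2) G_pure])
    also have "\<dots> = tensor_lift ?Z (\<lambda>e \<psi>. tensor_lift ?Z (?B e \<psi>) (\<iota> s)) (\<iota> r)"
      by (rule swap[symmetric])
    also have "\<dots> = ?H (tensor_lift SC (?b (lact S s v)) (\<iota> r))"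
      by (rule D.q.triple.MN.tensor_lift_natural[symmetric, OF SC_group Z_group bimodule_homD(6)[OF H]
            D.q.triple.balanced_assoc_left \<iota>s(1) H_pure])
        (use * in \<open>auto simp: S.lact_closed\<close>)
    also have "\<dots> = (?H \<circ> \<rho>) (lact S r (lact S s v))"
      using * by (simp add: \<rho>_lact S.lact_closed)
    finally show ?thesis .
  qed
  have step: "(?G \<circ> \<rho>) (lact S r v) = (?H \<circ> \<rho>) (lact S r v)" if "r \<in> carrier R" "v \<in> carrier S" for r v
    using that(2,1)
    by (induction rule: S.firm_induct) (simp_all only: base G\<rho> H\<rho> S.lact_add_r S.lact_closed)
  from u have "(?G \<circ> \<rho>) u = (?H \<circ> \<rho>) u"
    by (induction rule: S.firm_induct) (simp_all only: step G\<rho> H\<rho>)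
  then show ?thesis by simp
qed

theorem comatrix_coring_bicomodules:
  shows "coring K A C (comatrix_comult K R A S S' \<iota>) \<mu>"
    and "ring_coring_bicomodule K R A C (comatrix_comult K R A S S' \<iota>) \<mu> S (Sigma_coaction K R A S S' \<iota>)"
    and "coring_ring_bicomodule K A C (comatrix_comult K R A S S' \<iota>) \<mu> R
      (tensor K R S' (regular R)) (Sigma_dag_coaction K R A S S' \<iota>)"
proof -
  have dag_pair: "bimodule_pair K A R R S' (regular R)"
    by (rule bimodule_pairI[OF S'.bimodule_axioms regular_bimodule[OF R.k_algebra_axioms]])
  show "coring K A C (comatrix_comult K R A S S' \<iota>) \<mu>"
    unfolding comatrix_comult_firm_coaction by (rule comatrix_coring)
  show "ring_coring_bicomodule K R A C (comatrix_comult K R A S S' \<iota>) \<mu> S (Sigma_coaction K R A S S' \<iota>)"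
    unfolding comatrix_comult_firm_coaction
    by (intro ring_coring_bicomodule.intro ring_coring_bicomodule_axioms.intro comatrix_coring
        S.bimodule_axioms right_unital_S \<rho>_hom \<rho>_coassociative \<rho>_counit)
  \<comment> \<open>The coaction is \<open>\<Lambda>\<close> with \<open>P\<close> the regular
    bimodule, while the comultiplication of \<open>C\<close> is the instance \<open>P = S\<close>;
    coassociativity combines the two.\<close>
  show "coring_ring_bicomodule K A C (comatrix_comult K R A S S' \<iota>) \<mu> R
      (tensor K R S' (regular R)) (Sigma_dag_coaction K R A S S' \<iota>)"
    unfolding comatrix_comult_firm_coaction Sigma_dag_coaction_firm_coaction
    by (intro coring_ring_bicomodule.intro coring_ring_bicomodule_axioms.intro comatrix_coring
        bimodule_pair.tensor_bimodule[OF dag_pair]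
        bimodule_pair.tensor_left_unital[OF dag_pair left_unital_S' A.A.one_closed]
        comatrix_firm.\<Lambda>_hom[OF comatrix_firm_R]
        comatrix_firm.coassociative[OF comatrix_firm_R comatrix_firm_S]
        comatrix_firm.counit_left[OF comatrix_firm_R])
qed

end

section \<open>The actions of \<open>R\<close> induced by \<open>\<iota>\<close>\<close>

text \<open>Here \<open>M\<close> and \<open>N\<close> are \<Sigma> and \<Sigma>' with their
  original \<open>B\<close>-actions; \<open>S\<close> and \<open>S'\<close> will be the same modules
  with the actions of \<open>R\<close> coming from \<iota>.\<close>

locale comatrix_context = M: bimodule K B A M + N: bimodule K A B N
  for K :: "'k ring" and R :: "('k, 'r) module" and A :: "('k, 'a) module" and B :: "('k, 'b) module"
    and M :: "('k, 'b, 's, 'a) bimodule" and N :: "('k, 'a, 't, 'b) bimodule" +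
  fixes \<mu> :: "('t, 's) tensor \<Rightarrow> 'a" and \<iota> :: "'r \<Rightarrow> ('s, 't) tensor"
  assumes R_k_algebra: "k_algebra K R"
    and \<mu>_hom: "bimodule_hom K A A (tensor K B N M) (regular A) \<mu>"
    and \<iota>_hom: "k_algebra_hom K R (tensor_ring K A B M N \<mu>) \<iota>"
begin

sublocale W: bimodule_pair K A B A N M
  by (rule bimodule_pairI[OF N.bimodule_axioms M.bimodule_axioms])

sublocale V: bimodule_pair K B A B M N
  by (rule bimodule_pairI[OF M.bimodule_axioms N.bimodule_axioms])

abbreviation "S \<equiv> Sigma_R K B M N \<mu> \<iota>"
abbreviation "S' \<equiv> Sigma'_R K B M N \<mu> \<iota>"
abbreviation "E \<equiv> tensor K A (Sigma_R K B M N \<mu> \<iota>) (Sigma'_R K B M N \<mu> \<iota>)"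

text \<open>This is \<mu> as a pairing of elements: its bilinearity becomes a set of rewrite rules,
  and it does not depend on whether the tensor product is formed over \<open>B\<close> or over
  \<open>R\<close>.\<close>

definition m :: "'t \<Rightarrow> 's \<Rightarrow> 'a" where "m \<phi> x = \<mu> (W.pt \<phi> x)"

lemma m_closed: "\<lbrakk>\<phi> \<in> carrier N; x \<in> carrier M\<rbrakk> \<Longrightarrow> m \<phi> x \<in> carrier A"
  using bimodule_homD(1)[OF \<mu>_hom] by (simp add: m_def)

lemma m_add:
  "\<lbrakk>\<phi> \<in> carrier N; \<psi> \<in> carrier N; x \<in> carrier M\<rbrakk> \<Longrightarrow> m (\<phi> \<oplus>\<^bsub>N\<^esub> \<psi>) x = m \<phi> x \<oplus>\<^bsub>A\<^esub> m \<psi> x"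
  "\<lbrakk>\<phi> \<in> carrier N; x \<in> carrier M; y \<in> carrier M\<rbrakk> \<Longrightarrow> m \<phi> (x \<oplus>\<^bsub>M\<^esub> y) = m \<phi> x \<oplus>\<^bsub>A\<^esub> m \<phi> y"
  using bimodule_homD(2)[OF \<mu>_hom] by (simp_all add: m_def W.pure_add_l W.pure_add_r)

lemma m_smult:
  "\<lbrakk>k \<in> carrier K; \<phi> \<in> carrier N; x \<in> carrier M\<rbrakk> \<Longrightarrow> m (k \<odot>\<^bsub>N\<^esub> \<phi>) x = k \<odot>\<^bsub>A\<^esub> m \<phi> x"
  "\<lbrakk>k \<in> carrier K; \<phi> \<in> carrier N; x \<in> carrier M\<rbrakk> \<Longrightarrow> m \<phi> (k \<odot>\<^bsub>M\<^esub> x) = k \<odot>\<^bsub>A\<^esub> m \<phi> x"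
proof -
  show 1: "m (k \<odot>\<^bsub>N\<^esub> \<phi>) x = k \<odot>\<^bsub>A\<^esub> m \<phi> x" if "k \<in> carrier K" "\<phi> \<in> carrier N" "x \<in> carrier M"
    using that bimodule_homD(3)[OF \<mu>_hom, of k "W.pt \<phi> x"] by (simp add: m_def W.tensor_smult_pure)
  show "m \<phi> (k \<odot>\<^bsub>M\<^esub> x) = k \<odot>\<^bsub>A\<^esub> m \<phi> x" if "k \<in> carrier K" "\<phi> \<in> carrier N" "x \<in> carrier M"
    using 1 that by (simp add: m_def W.pure_smult_balanced)
qed

lemma m_act:
  "\<lbrakk>a \<in> carrier A; \<phi> \<in> carrier N; x \<in> carrier M\<rbrakk> \<Longrightarrow> m (lact N a \<phi>) x = a \<otimes>\<^bsub>A\<^esub> m \<phi> x"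
  "\<lbrakk>a \<in> carrier A; \<phi> \<in> carrier N; x \<in> carrier M\<rbrakk> \<Longrightarrow> m \<phi> (ract M x a) = m \<phi> x \<otimes>\<^bsub>A\<^esub> a"
  using bimodule_homD(4)[OF \<mu>_hom, of a "W.pt \<phi> x"] bimodule_homD(5)[OF \<mu>_hom, of a "W.pt \<phi> x"]
  by (simp_all add: m_def W.tensor_lact_pure W.tensor_ract_pure)

lemmas m_simps = m_closed m_add m_smult m_act

text \<open>As \<mu> is left A-linear, (e a) m(\<phi>, u) = e m(a \<phi>, u). This makes the action
  of \<iota>(r) on \<open>u\<close> independent of how \<iota>(r) is written.\<close>

lemma balanced_em: "u \<in> carrier M \<Longrightarrow> balanced_map K A M N M (\<lambda>e \<phi>. ract M e (m \<phi> u))"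
  by (rule balanced_mapI)
    (simp_all add: m_simps M.ract_closed M.ract_add_l M.ract_add_r M.ract_assoc M.ract_smult_l M.ract_smult_r
      N.lact_closed)

lemma balanced_m\<psi>: "\<phi> \<in> carrier N \<Longrightarrow> balanced_map K A M N N (\<lambda>e \<psi>. lact N (m \<phi> e) \<psi>)"
  by (rule balanced_mapI)
    (simp_all add: m_simps N.lact_closed N.lact_add_l N.lact_add_r N.lact_assoc N.lact_smult_l N.lact_smult_r
      M.ract_closed)

lemma S_simps [simp]:
  "carrier S = carrier M" "ring.add S = ring.add M" "ring.zero S = ring.zero M" "smult S = smult M"
  "ract S = ract M" "lact S r u = tensor_lift M (\<lambda>e \<phi>. ract M e (m \<phi> u)) (\<iota> r)"
  by (simp_all add: Sigma_R_def m_def)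

lemma S'_simps [simp]:
  "carrier S' = carrier N" "ring.add S' = ring.add N" "ring.zero S' = ring.zero N" "smult S' = smult N"
  "lact S' = lact N" "ract S' \<phi> r = tensor_lift N (\<lambda>e \<psi>. lact N (m \<phi> e) \<psi>) (\<iota> r)"
  by (simp_all add: Sigma'_R_def m_def)

lemma \<iota>_closed: "r \<in> carrier R \<Longrightarrow> \<iota> r \<in> carrier V.T"
  using \<iota>_hom by (auto simp: k_algebra_hom_def tensor_ring_def Let_def)

lemma \<iota>_add: "\<lbrakk>r \<in> carrier R; s \<in> carrier R\<rbrakk> \<Longrightarrow> \<iota> (r \<oplus>\<^bsub>R\<^esub> s) = \<iota> r \<oplus>\<^bsub>V.T\<^esub> \<iota> s"
  using \<iota>_hom by (auto simp: k_algebra_hom_def tensor_ring_def Let_def)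

lemma \<iota>_smult: "\<lbrakk>k \<in> carrier K; r \<in> carrier R\<rbrakk> \<Longrightarrow> \<iota> (k \<odot>\<^bsub>R\<^esub> r) = k \<odot>\<^bsub>V.T\<^esub> \<iota> r"
  using \<iota>_hom by (auto simp: k_algebra_hom_def tensor_ring_def Let_def)

lemma \<iota>_mult: "\<lbrakk>r \<in> carrier R; s \<in> carrier R\<rbrakk> \<Longrightarrow> \<iota> (r \<otimes>\<^bsub>R\<^esub> s) =
    tensor_lift V.T (\<lambda>x \<phi>. tensor_lift V.T (\<lambda>y \<psi>. V.pt (ract M x (m \<phi> y)) \<psi>) (\<iota> s)) (\<iota> r)"
  using \<iota>_hom by (simp add: k_algebra_hom_def tensor_ring_def Let_def m_def)

lemma balanced_prod_left:
  "\<lbrakk>y \<in> carrier M; \<psi> \<in> carrier N\<rbrakk> \<Longrightarrow> balanced_map K A M N V.T (\<lambda>x \<phi>. V.pt (ract M x (m \<phi> y)) \<psi>)"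
  by (rule balanced_map_compose[OF V.balanced_pair_axioms balanced_em])
    (auto intro!: additive_mapI simp: V.pure_add_l)

text \<open>Across the tensor product over \<open>A\<close> the scalar m(\<phi>, y) moves to \<psi>,
  and then balancedness in (y, \<psi>) is \<open>balanced_m\<psi>\<close>.\<close>

lemma balanced_prod_right:
  assumes "x \<in> carrier M" "\<phi> \<in> carrier N"
  shows "balanced_map K A M N V.T (\<lambda>y \<psi>. V.pt (ract M x (m \<phi> y)) \<psi>)"
proof (rule balanced_map_cong[OF V.balanced_pair_axioms])
  show "balanced_map K A M N V.T (\<lambda>y \<psi>. V.pt x (lact N (m \<phi> y) \<psi>))"
    by (rule balanced_map_compose[OF V.balanced_pair_axioms balanced_m\<psi>])
      (use assms in \<open>auto intro!: additive_mapI simp: V.pure_add_r\<close>)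
qed (use assms in \<open>simp add: V.pure_balanced m_closed\<close>)

lemma balanced_prod:
  "v \<in> carrier V.T \<Longrightarrow> balanced_map K A M N V.T
    (\<lambda>x \<phi>. tensor_lift V.T (\<lambda>y \<psi>. V.pt (ract M x (m \<phi> y)) \<psi>) v)"
  by (rule balanced_lift_param[OF V.balanced_pair_axioms V.balanced_pair_axioms V.tensor_abelian_group
        balanced_prod_right balanced_prod_left])

text \<open>Multiplicativity of \<iota> in the form used under a sum: with \<iota>(r) = x \<otimes>
  \<phi> and \<iota>(s) = y \<otimes> \<psi>, sums understood, the terms of \<iota>(r s) are x
  m(\<phi>, y) \<otimes> \<psi>.\<close>

lemma lift_\<iota>_mult:
  assumes P: "abelian_group P" and c: "balanced_map K A M N P c" and rs: "r \<in> carrier R" "s \<in> carrier R"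
  shows "tensor_lift P c (\<iota> (r \<otimes>\<^bsub>R\<^esub> s)) =
    tensor_lift P (\<lambda>x \<phi>. tensor_lift P (\<lambda>y \<psi>. c (ract M x (m \<phi> y)) \<psi>) (\<iota> s)) (\<iota> r)"
  unfolding \<iota>_mult[OF rs]
proof (rule V.tensor_lift_natural[OF V.tensor_abelian_group P V.additive_tensor_lift[OF P c]
      balanced_prod[OF \<iota>_closed[OF rs(2)]] \<iota>_closed[OF rs(1)]])
  fix x \<phi> assume *: "x \<in> carrier M" "\<phi> \<in> carrier N"
  show "tensor_lift P c (tensor_lift V.T (\<lambda>y \<psi>. V.pt (ract M x (m \<phi> y)) \<psi>) (\<iota> s)) =
      tensor_lift P (\<lambda>y \<psi>. c (ract M x (m \<phi> y)) \<psi>) (\<iota> s)"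
    by (rule V.tensor_lift_natural[OF V.tensor_abelian_group P V.additive_tensor_lift[OF P c]
          balanced_prod_right[OF *] \<iota>_closed[OF rs(2)]])
      (use * in \<open>simp add: V.tensor_lift_pure[OF P c] M.ract_closed m_closed\<close>)
qed

lemmas M_group = M.M.abelian_group_axioms and N_group = N.M.abelian_group_axioms
lemmas lift_M = V.tensor_lift_natural[OF M_group M_group _ balanced_em _]
lemmas lift_N = V.tensor_lift_natural[OF N_group N_group _ balanced_m\<psi> _]

lemma lact_S_closed: "\<lbrakk>r \<in> carrier R; u \<in> carrier M\<rbrakk> \<Longrightarrow> lact S r u \<in> carrier M"
  by (simp add: V.tensor_lift_closed[OF M_group balanced_em] \<iota>_closed)

lemma ract_S'_closed: "\<lbrakk>\<phi> \<in> carrier N; r \<in> carrier R\<rbrakk> \<Longrightarrow> ract S' \<phi> r \<in> carrier N"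
  by (simp add: V.tensor_lift_closed[OF N_group balanced_m\<psi>] \<iota>_closed)

text \<open>The same sum appears in \<open>m_ract_S'\<close>, so m(\<phi>, r u) = m(\<phi> r, u).
  This is why \<mu> factors through the tensor product over \<open>R\<close>.\<close>

lemma m_lact_S:
  assumes "\<phi> \<in> carrier N" "r \<in> carrier R" "u \<in> carrier M"
  shows "m \<phi> (lact S r u) = tensor_lift A (\<lambda>e \<psi>. m \<phi> e \<otimes>\<^bsub>A\<^esub> m \<psi> u) (\<iota> r)"
  unfolding S_simps
  by (rule V.tensor_lift_natural[OF M_group k_algebra_abelian_group[OF M.S.k_algebra_axioms]
        additive_mapI balanced_em \<iota>_closed])
    (use assms in \<open>auto simp: m_simps\<close>)

lemma m_ract_S':
  assumes "\<phi> \<in> carrier N" "r \<in> carrier R" "u \<in> carrier M"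
  shows "m (ract S' \<phi> r) u = tensor_lift A (\<lambda>e \<psi>. m \<phi> e \<otimes>\<^bsub>A\<^esub> m \<psi> u) (\<iota> r)"
  unfolding S'_simps
  by (rule V.tensor_lift_natural[OF N_group k_algebra_abelian_group[OF M.S.k_algebra_axioms]
        additive_mapI[where f = "\<lambda>z. m z u"] balanced_m\<psi> \<iota>_closed])
    (use assms in \<open>auto simp: m_simps\<close>)

lemma S_module: "module K S"
  by (rule module_transfer[OF M.M.module_axioms]) simp_all

lemma S'_module: "module K S'"
  by (rule module_transfer[OF N.M.module_axioms]) simp_all

lemma S_bimodule: "bimodule K R A S"
proof (intro bimodule.intro left_module.intro right_module.intro bimodule_axioms.intro
    left_module_axioms.intro right_module_axioms.intro S_module R_k_algebra M.S.k_algebra_axioms)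
  fix r u assume "r \<in> carrier R" "u \<in> carrier S"
  then show "lact S r u \<in> carrier S"
    using lact_S_closed by simp
next
  fix r r' u assume "r \<in> carrier R" "r' \<in> carrier R" "u \<in> carrier S"
  then show "lact S (r \<oplus>\<^bsub>R\<^esub> r') u = lact S r u \<oplus>\<^bsub>S\<^esub> lact S r' u"
    by (simp add: \<iota>_add \<iota>_closed V.tensor_lift_add[OF M_group balanced_em])
next
  fix r u u' assume "r \<in> carrier R" "u \<in> carrier S" "u' \<in> carrier S"
  then show "lact S r (u \<oplus>\<^bsub>S\<^esub> u') = lact S r u \<oplus>\<^bsub>S\<^esub> lact S r u'"
    by (simp, intro V.tensor_lift_pointwise_add[OF M_group balanced_em balanced_em \<iota>_closed])
      (simp_all add: m_simps M.ract_add_r)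
next
  fix k r u assume *: "k \<in> carrier K" "r \<in> carrier R" "u \<in> carrier S"
  then show "lact S (k \<odot>\<^bsub>R\<^esub> r) u = k \<odot>\<^bsub>S\<^esub> lact S r u"
    by (simp add: \<iota>_smult, intro V.tensor_lift_smult[OF M.M.module_axioms balanced_em _ _ \<iota>_closed])
      (simp_all add: M.ract_smult_l m_closed)
  from * show "lact S r (k \<odot>\<^bsub>S\<^esub> u) = k \<odot>\<^bsub>S\<^esub> lact S r u"
    by (simp, intro lift_M[symmetric] \<iota>_closed additive_mapI)
      (simp_all add: m_simps M.ract_smult_r M.M.smult_r_distr)
next
  fix r r' u assume *: "r \<in> carrier R" "r' \<in> carrier R" "u \<in> carrier S"
  have "lact S (r \<otimes>\<^bsub>R\<^esub> r') u =
      tensor_lift M (\<lambda>x \<phi>. tensor_lift M (\<lambda>y \<psi>. ract M (ract M x (m \<phi> y)) (m \<psi> u)) (\<iota> r')) (\<iota> r)"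
    using * by (simp add: lift_\<iota>_mult[OF M_group balanced_em])
  \<comment> \<open>The inner sum folds up: x m(\<phi>, y) m(\<psi>, u) = x m(\<phi>, y m(\<psi>,
    u)), and the sum of y m(\<psi>, u) over \<iota>(r') is r' u.\<close>
  also have "\<dots> = tensor_lift M (\<lambda>x \<phi>. ract M x (m \<phi> (lact S r' u))) (\<iota> r)"
  proof (rule V.tensor_lift_cong[symmetric, OF M_group balanced_em \<iota>_closed])
    show "lact S r' u \<in> carrier M" "r \<in> carrier R"
      using * lact_S_closed by simp_all
    fix x \<phi> assume x: "x \<in> carrier M" "\<phi> \<in> carrier N"
    show "ract M x (m \<phi> (lact S r' u)) =
        tensor_lift M (\<lambda>y \<psi>. ract M (ract M x (m \<phi> y)) (m \<psi> u)) (\<iota> r')"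
      unfolding S_simps
      by (rule lift_M[of "\<lambda>z. ract M x (m \<phi> z)"])
        (use x * in \<open>auto intro!: additive_mapI simp: m_simps M.ract_closed M.ract_add_r M.ract_assoc \<iota>_closed\<close>)
  qed
  also have "\<dots> = lact S r (lact S r' u)"
    by simp
  finally show "lact S (r \<otimes>\<^bsub>R\<^esub> r') u = lact S r (lact S r' u)" .
next
  fix r u a assume *: "r \<in> carrier R" "u \<in> carrier S" "a \<in> carrier A"
  then show "ract S (lact S r u) a = lact S r (ract S u a)"
    by (simp, intro lift_M[where f = "\<lambda>z. ract M z a"] \<iota>_closed additive_mapI)
      (simp_all add: m_simps M.ract_assoc M.ract_closed M.ract_add_l)
qed (simp_all add: M.ract_closed M.ract_add_l M.ract_add_r M.ract_smult_l M.ract_smult_r M.ract_assoc)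

lemma S'_bimodule: "bimodule K A R S'"
proof (intro bimodule.intro left_module.intro right_module.intro bimodule_axioms.intro
    left_module_axioms.intro right_module_axioms.intro S'_module R_k_algebra M.S.k_algebra_axioms)
  fix \<phi> r assume "\<phi> \<in> carrier S'" "r \<in> carrier R"
  then show "ract S' \<phi> r \<in> carrier S'"
    using ract_S'_closed by simp
next
  fix \<phi> r r' assume "\<phi> \<in> carrier S'" "r \<in> carrier R" "r' \<in> carrier R"
  then show "ract S' \<phi> (r \<oplus>\<^bsub>R\<^esub> r') = ract S' \<phi> r \<oplus>\<^bsub>S'\<^esub> ract S' \<phi> r'"
    by (simp add: \<iota>_add \<iota>_closed V.tensor_lift_add[OF N_group balanced_m\<psi>])
next
  fix \<phi> \<phi>' r assume "\<phi> \<in> carrier S'" "\<phi>' \<in> carrier S'" "r \<in> carrier R"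
  then show "ract S' (\<phi> \<oplus>\<^bsub>S'\<^esub> \<phi>') r = ract S' \<phi> r \<oplus>\<^bsub>S'\<^esub> ract S' \<phi>' r"
    by (simp, intro V.tensor_lift_pointwise_add[OF N_group balanced_m\<psi> balanced_m\<psi> \<iota>_closed])
      (simp_all add: m_simps N.lact_add_l)
next
  fix k \<phi> r assume *: "k \<in> carrier K" "\<phi> \<in> carrier S'" "r \<in> carrier R"
  then show "ract S' \<phi> (k \<odot>\<^bsub>R\<^esub> r) = k \<odot>\<^bsub>S'\<^esub> ract S' \<phi> r"
    by (simp add: \<iota>_smult, intro V.tensor_lift_smult[OF N.M.module_axioms balanced_m\<psi> _ _ \<iota>_closed])
      (simp_all add: N.lact_smult_l m_simps)
next
  fix k \<phi> r assume *: "k \<in> carrier K" "\<phi> \<in> carrier S'" "r \<in> carrier R"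
  then show "ract S' (k \<odot>\<^bsub>S'\<^esub> \<phi>) r = k \<odot>\<^bsub>S'\<^esub> ract S' \<phi> r"
    by (simp, intro lift_N[symmetric] \<iota>_closed additive_mapI)
      (simp_all add: m_simps N.lact_smult_l N.M.smult_r_distr)
next
  fix \<phi> r r' assume *: "\<phi> \<in> carrier S'" "r \<in> carrier R" "r' \<in> carrier R"
  have \<phi>r: "ract S' \<phi> r \<in> carrier N"
    using * ract_S'_closed by simp
  have bal_l: "balanced_map K A M N N (\<lambda>x \<chi>. lact N (m \<phi> (ract M x (m \<chi> y))) \<psi>)"
    if "y \<in> carrier M" "\<psi> \<in> carrier N" for y \<psi>
    by (rule balanced_map_compose[OF V.balanced_pair_axioms balanced_em])
      (use that * in \<open>auto intro!: additive_mapI simp: m_simps N.lact_closed N.lact_add_l\<close>)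
  have bal_r: "balanced_map K A M N N (\<lambda>y \<psi>. lact N (m \<phi> (ract M x (m \<chi> y))) \<psi>)"
    if "x \<in> carrier M" "\<chi> \<in> carrier N" for x \<chi>
    by (rule balanced_map_cong[OF V.balanced_pair_axioms
          balanced_m\<psi>[of "lact N (m \<phi> x) \<chi>"]])
      (use that * in \<open>auto simp: m_simps N.lact_closed\<close>)
  have "ract S' \<phi> (r \<otimes>\<^bsub>R\<^esub> r') =
      tensor_lift N (\<lambda>x \<chi>. tensor_lift N (\<lambda>y \<psi>. lact N (m \<phi> (ract M x (m \<chi> y))) \<psi>) (\<iota> r')) (\<iota> r)"
    using * by (simp add: lift_\<iota>_mult[OF N_group balanced_m\<psi>])
  \<comment> \<open>On this side the factor to be folded is \<phi> r, a sum over \<iota>(r) with y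
    and \<psi> held fixed; the product formula has that sum outermost, so the sums are exchanged
    first.\<close>
  also have "\<dots> = tensor_lift N (\<lambda>y \<psi>. tensor_lift N (\<lambda>x \<chi>. lact N (m \<phi> (ract M x (m \<chi> y))) \<psi>) (\<iota> r)) (\<iota> r')"
    using * by (intro tensor_lift_swap[OF V.balanced_pair_axioms V.balanced_pair_axioms N_group bal_r bal_l]
        \<iota>_closed)
  also have "\<dots> = tensor_lift N (\<lambda>y \<psi>. lact N (m (ract S' \<phi> r) y) \<psi>) (\<iota> r')"
  proof (rule V.tensor_lift_cong[symmetric, OF N_group balanced_m\<psi>[OF \<phi>r] \<iota>_closed])
    fix y \<psi> assume y: "y \<in> carrier M" "\<psi> \<in> carrier N"
    show "lact N (m (ract S' \<phi> r) y) \<psi> =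
        tensor_lift N (\<lambda>x \<chi>. lact N (m \<phi> (ract M x (m \<chi> y))) \<psi>) (\<iota> r)"
      unfolding S'_simps
      by (rule lift_N[of "\<lambda>z. lact N (m z y) \<psi>"])
        (use y * in \<open>auto intro!: additive_mapI simp: m_simps N.lact_closed N.lact_add_l \<iota>_closed\<close>)
  qed (use * in auto)
  also have "\<dots> = ract S' (ract S' \<phi> r) r'"
    by simp
  finally show "ract S' \<phi> (r \<otimes>\<^bsub>R\<^esub> r') = ract S' (ract S' \<phi> r) r'" .
next
  fix a \<phi> r assume *: "a \<in> carrier A" "\<phi> \<in> carrier S'" "r \<in> carrier R"
  then show "ract S' (lact S' a \<phi>) r = lact S' a (ract S' \<phi> r)"
    by (simp, intro lift_N[symmetric] \<iota>_closed additive_mapI)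
      (simp_all add: m_simps N.lact_assoc N.lact_closed N.lact_add_r)
qed (simp_all add: N.lact_closed N.lact_add_l N.lact_add_r N.lact_smult_l N.lact_smult_r N.lact_assoc)

sublocale E: bimodule_pair K R A R S S'
  by (rule bimodule_pairI[OF S_bimodule S'_bimodule])

text \<open>Only the outer actions distinguish \<open>\<Sigma> \<otimes>\<^sub>A \<Sigma>'\<close> formed with the \<open>R\<close>-actions from the original one.\<close>

lemma E_eq:
  "pure_tensor K A S S' = V.pt" "carrier E = carrier V.T" "ring.add E = ring.add V.T"
  "ring.zero E = ring.zero V.T" "smult E = smult V.T"
proof -
  have "tensor_relations K A S S' = tensor_relations K A M N"
    by (simp add: tensor_relations_def)
  then have "tensor_kernel K A S S' = tensor_kernel K A M N"
    by (simp add: tensor_kernel_def)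
  then show pt: "pure_tensor K A S S' = V.pt" and "carrier E = carrier V.T" "ring.add E = ring.add V.T"
    "ring.zero E = ring.zero V.T" and "smult E = smult V.T"
    by (simp_all add: pure_tensor_def [abs_def] tensor_def tensor_group_def Let_def)
qed

lemma tensor_lift_E: "tensor_lift E b = tensor_lift V.T b"
  by (rule tensor_lift_group_cong) (simp_all add: E_eq)

text \<open>Both laws are the multiplicativity of \<iota>, with terms x m(\<phi>, y) \<otimes>
  \<psi>. Summed over \<iota>(r), x m(\<phi>, y) is r y, which gives r \<iota>(s) after an exchange
  of sums. With the scalar moved to \<psi>, the inner sum over \<iota>(s) of m(\<phi>, y) \<psi> is
  \<phi> s, which gives \<iota>(r) s.\<close>

lemma \<iota>_bimodule_hom: "bimodule_hom K R R (regular R) E \<iota>"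
proof (rule bimodule_homI)
  show "additive_map (regular R) E \<iota>"
    by (rule additive_mapI) (simp_all add: \<iota>_closed \<iota>_add E_eq)
  show "\<iota> (k \<odot>\<^bsub>regular R\<^esub> x) = k \<odot>\<^bsub>E\<^esub> \<iota> x" if "k \<in> carrier K" "x \<in> carrier (regular R)" for k x
    using that by (simp add: \<iota>_smult E_eq)
next
  fix r s assume *: "r \<in> carrier R" "s \<in> carrier (regular R)"
  have "\<iota> (r \<otimes>\<^bsub>R\<^esub> s) =
      tensor_lift V.T (\<lambda>y \<psi>. tensor_lift V.T (\<lambda>x \<phi>. V.pt (ract M x (m \<phi> y)) \<psi>) (\<iota> r)) (\<iota> s)"
    using * by (simp add: \<iota>_mult tensor_lift_swap[OF V.balanced_pair_axioms V.balanced_pair_axioms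
          V.tensor_abelian_group balanced_prod_right balanced_prod_left] \<iota>_closed)
  also have "\<dots> = tensor_lift V.T (\<lambda>y \<psi>. V.pt (lact S r y) \<psi>) (\<iota> s)"
  proof (rule V.tensor_lift_cong[OF V.tensor_abelian_group balanced_lift_param
        [OF V.balanced_pair_axioms V.balanced_pair_axioms V.tensor_abelian_group
          balanced_prod_left balanced_prod_right] \<iota>_closed])
    fix y \<psi> assume y: "y \<in> carrier M" "\<psi> \<in> carrier N"
    show "tensor_lift V.T (\<lambda>x \<phi>. V.pt (ract M x (m \<phi> y)) \<psi>) (\<iota> r) = V.pt (lact S r y) \<psi>"
      unfolding S_simps
      by (rule V.tensor_lift_natural[symmetric, OF M_group V.tensor_abelian_group _ balanced_em \<iota>_closed])
        (use y * in \<open>auto intro!: additive_mapI simp: V.pure_add_l\<close>)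
  qed (use * \<iota>_closed in auto)
  also have "\<dots> = lact E r (\<iota> s)"
    by (simp only: E.tensor_lact_lift tensor_lift_E E_eq)
  finally show "\<iota> (lact (regular R) r s) = lact E r (\<iota> s)"
    by simp
next
  fix s r assume *: "s \<in> carrier R" "r \<in> carrier (regular R)"
  have "\<iota> (r \<otimes>\<^bsub>R\<^esub> s) = tensor_lift V.T (\<lambda>x \<phi>. V.pt x (ract S' \<phi> s)) (\<iota> r)"
    unfolding \<iota>_mult[OF *(2)[simplified] *(1)]
  proof (rule V.tensor_lift_cong[OF V.tensor_abelian_group balanced_prod \<iota>_closed])
    fix x \<phi> assume x: "x \<in> carrier M" "\<phi> \<in> carrier N"
    show "tensor_lift V.T (\<lambda>y \<psi>. V.pt (ract M x (m \<phi> y)) \<psi>) (\<iota> s) = V.pt x (ract S' \<phi> s)"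
      unfolding S'_simps
      by (rule V.tensor_lift_natural[symmetric, OF N_group V.tensor_abelian_group _ balanced_m\<psi> \<iota>_closed])
        (use x * in \<open>auto intro!: additive_mapI simp: V.pure_add_r V.pure_balanced m_closed\<close>)
  qed (use * \<iota>_closed in auto)
  also have "\<dots> = ract E (\<iota> r) s"
    by (simp only: E.tensor_ract_lift tensor_lift_E E_eq)
  finally show "\<iota> (ract (regular R) r s) = ract E (\<iota> r) s"
    by simp
qed

sublocale C: bimodule_pair K A R A S' S
  by (rule bimodule_pairI[OF S'_bimodule S_bimodule])

lemma balanced_m: "balanced_map K R S' S A m"
  by (rule balanced_mapI)
    (simp_all only: S_simps(1-4) S'_simps(1-4) m_lact_S m_ract_S' m_simps)

lemma mu_R_pure: "\<lbrakk>\<phi> \<in> carrier N; u \<in> carrier M\<rbrakk> \<Longrightarrow> mu_R K A B M N \<mu> (C.pt \<phi> u) = m \<phi> u"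
  unfolding mu_R_def
  using C.tensor_lift_pure[OF k_algebra_abelian_group[OF M.S.k_algebra_axioms] balanced_m]
  by (simp add: m_def [abs_def])

lemma mu_R_hom: "bimodule_hom K A A C.T (regular A) (mu_R K A B M N \<mu>)"
proof -
  have A: "bimodule K A A (regular A)"
    by (rule regular_bimodule[OF M.S.k_algebra_axioms])
  \<comment> \<open>\<open>mu_R\<close> is a lift into \<open>A\<close>, while a bimodule map has to
    land in \<open>regular A\<close>; the lift sees only the additive structure, which they
    share.\<close>
  have "mu_R K A B M N \<mu> = tensor_lift (regular A) m"
    unfolding mu_R_def m_def [abs_def] by (rule tensor_lift_group_cong) simp_all
  moreover have "bimodule_hom K A A C.T (regular A) (tensor_lift (regular A) m)"
  proof (rule C.tensor_lift_bimodule_hom[OF A])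
    show "balanced_map K R S' S (regular A) m"
      using balanced_m by (simp add: balanced_map_def)
  qed (simp_all add: m_simps)
  ultimately show ?thesis by simp
qed

end

section \<open>From the given data to the comatrix setting\<close>

theorem theorem3p1:
  fixes K :: "'k ring"
    and R :: "('k, 'r) module" and A :: "('k, 'a) module" and B :: "('k, 'b) module"
    and \<Sigma> :: "('k, 'b, 's, 'a) bimodule" and \<Sigma>' :: "('k, 'a, 't, 'b) bimodule"
    and \<mu> :: "('t, 's) tensor \<Rightarrow> 'a" and \<iota> :: "'r \<Rightarrow> ('s, 't) tensor"
    and \<Sigma>R :: "('k, 'r, 's, 'a) bimodule" and \<Sigma>'R :: "('k, 'a, 't, 'r) bimodule"
    and C :: "('k, 'a, ('t, 's) tensor, 'a) bimodule"
  assumes "cring K"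
    and "firm_ring K R" and "unital_k_algebra K A" and "unital_k_algebra K B"
    and "bimodule K B A \<Sigma>" and "left_unital B \<Sigma>" and "right_unital A \<Sigma>"
    and "bimodule K A B \<Sigma>'" and "left_unital A \<Sigma>'" and "right_unital B \<Sigma>'"
    and "bimodule_hom K A A (tensor K B \<Sigma>' \<Sigma>) (regular A) \<mu>"
    and "k_algebra_hom K R (tensor_ring K A B \<Sigma> \<Sigma>' \<mu>) \<iota>"
    and "\<Sigma>R = Sigma_R K B \<Sigma> \<Sigma>' \<mu> \<iota>"
    and "\<Sigma>'R = Sigma'_R K B \<Sigma> \<Sigma>' \<mu> \<iota>"
    and "C = tensor K R \<Sigma>'R \<Sigma>R"
    and "firm_left_module K R \<Sigma>R"
  shows "coring K A C (comatrix_comult K R A \<Sigma>R \<Sigma>'R \<iota>) (mu_R K A B \<Sigma> \<Sigma>' \<mu>)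
    \<and> ring_coring_bicomodule K R A C (comatrix_comult K R A \<Sigma>R \<Sigma>'R \<iota>) (mu_R K A B \<Sigma> \<Sigma>' \<mu>)
        \<Sigma>R (Sigma_coaction K R A \<Sigma>R \<Sigma>'R \<iota>)
    \<and> coring_ring_bicomodule K A C (comatrix_comult K R A \<Sigma>R \<Sigma>'R \<iota>) (mu_R K A B \<Sigma> \<Sigma>' \<mu>) R
        (tensor K R \<Sigma>'R (regular R)) (Sigma_dag_coaction K R A \<Sigma>R \<Sigma>'R \<iota>)"
proof -
  interpret R: firm_ring K R by fact
  interpret X: comatrix_context K R A B \<Sigma> \<Sigma>' \<mu> \<iota>
    by (intro comatrix_context.intro comatrix_context_axioms.intro R.k_algebra_axioms assms)
  have "comatrix K R A \<Sigma>R \<Sigma>'R (mu_R K A B \<Sigma> \<Sigma>' \<mu>) \<iota>"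
  proof (intro comatrix.intro comatrix_axioms.intro firm_bimodule.intro assms(2,3,16))
    show "bimodule K R A \<Sigma>R" "bimodule K A R \<Sigma>'R"
      using X.S_bimodule X.S'_bimodule by (simp_all add: assms(13,14))
    show "right_unital A \<Sigma>R" "left_unital A \<Sigma>'R"
      using assms(7,9) by (simp_all add: assms(13,14) right_unital_def left_unital_def)
    show "bimodule_hom K A A (tensor K R \<Sigma>'R \<Sigma>R) (regular A) (mu_R K A B \<Sigma> \<Sigma>' \<mu>)"
      using X.mu_R_hom by (simp add: assms(13,14))
    show "bimodule_hom K R R (regular R) (tensor K A \<Sigma>R \<Sigma>'R) \<iota>"
      using X.\<iota>_bimodule_hom by (simp add: assms(13,14))
  next
    fix r u assume *: "r \<in> carrier R" "u \<in> carrier \<Sigma>R"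
    \<comment> \<open>The definition of the action uses the group \<Sigma> and the map \<mu> over
      \<open>B\<close>; what is wanted uses \<open>\<Sigma>R\<close> and the factored map. The
      target is changed first, then the summands are compared by \<open>mu_R_pure\<close>.\<close>
    have "tensor_lift \<Sigma>R (\<lambda>e \<phi>. ract \<Sigma>R e (mu_R K A B \<Sigma> \<Sigma>' \<mu> (pure_tensor K R \<Sigma>'R \<Sigma>R \<phi> u))) (\<iota> r) =
        tensor_lift \<Sigma> (\<lambda>e \<phi>. ract \<Sigma>R e (mu_R K A B \<Sigma> \<Sigma>' \<mu> (pure_tensor K R \<Sigma>'R \<Sigma>R \<phi> u))) (\<iota> r)"
      by (rule fun_cong[OF tensor_lift_group_cong]) (simp_all add: assms(13))
    also have "\<dots> = tensor_lift \<Sigma> (\<lambda>e \<phi>. ract \<Sigma> e (X.m \<phi> u)) (\<iota> r)"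
      by (rule X.V.tensor_lift_cong[symmetric, OF X.M_group X.balanced_em X.\<iota>_closed])
        (use * in \<open>simp_all add: assms(13,14) X.mu_R_pure\<close>)
    finally show "lact \<Sigma>R r u =
        tensor_lift \<Sigma>R (\<lambda>e \<phi>. ract \<Sigma>R e (mu_R K A B \<Sigma> \<Sigma>' \<mu> (pure_tensor K R \<Sigma>'R \<Sigma>R \<phi> u))) (\<iota> r)"
      by (simp add: assms(13))
  next
    fix \<phi> r assume *: "\<phi> \<in> carrier \<Sigma>'R" "r \<in> carrier R"
    have "tensor_lift \<Sigma>'R (\<lambda>e \<psi>. lact \<Sigma>'R (mu_R K A B \<Sigma> \<Sigma>' \<mu> (pure_tensor K R \<Sigma>'R \<Sigma>R \<phi> e)) \<psi>) (\<iota> r) =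
        tensor_lift \<Sigma>' (\<lambda>e \<psi>. lact \<Sigma>'R (mu_R K A B \<Sigma> \<Sigma>' \<mu> (pure_tensor K R \<Sigma>'R \<Sigma>R \<phi> e)) \<psi>) (\<iota> r)"
      by (rule fun_cong[OF tensor_lift_group_cong]) (simp_all add: assms(14))
    also have "\<dots> = tensor_lift \<Sigma>' (\<lambda>e \<psi>. lact \<Sigma>' (X.m \<phi> e) \<psi>) (\<iota> r)"
      by (rule X.V.tensor_lift_cong[symmetric, OF X.N_group X.balanced_m\<psi> X.\<iota>_closed])
        (use * in \<open>simp_all add: assms(13,14) X.mu_R_pure\<close>)
    finally show "ract \<Sigma>'R \<phi> r =
        tensor_lift \<Sigma>'R (\<lambda>e \<psi>. lact \<Sigma>'R (mu_R K A B \<Sigma> \<Sigma>' \<mu> (pure_tensor K R \<Sigma>'R \<Sigma>R \<phi> e)) \<psi>) (\<iota> r)"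
      by (simp add: assms(14))
  qed
  then show ?thesis
    unfolding assms(15) by (intro conjI comatrix.comatrix_coring_bicomodules)
qed

end
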